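(* Let $d\ge 3$ and let $K\subset\mathbb{R}^d$ be a non-empty compact set. If $\int_{(0,\infty)} \big(P(\tilde{K}_t)\big)^{-1}\,dt<\infty$, then \[ \operatorname{cap}(K)\le \Big(\int_{(0,\infty)} \big(P(\tilde{K}_t)\big)^{-1}\,dt\Big)^{-1}, \] with equality if $K$ is a closed ball.
   Context: For a compact $K\subset\mathbb{R}^d$, $d\ge3$, the Newtonian capacity is $\operatorname{cap}(K)=\inf\{\int_{\mathbb{R}^d}|Du|^2:\ u\ge \mathbf 1_K,\ u\in D^1(\mathbb{R}^d)\cap C^0(\mathbb{R}^d)\}$, where $D^1(\mathbb{R}^d)$ is the set of $f\in L^1_{\rm loc}(\mathbb{R}^d)$ with $Df\in L^2(\mathbb{R}^d)$ that vanish at infinity, i.e. $|\{|f|>\varepsilon\}|<\infty$ for all $\varepsilon>0$ ($|\cdot|$ is Lebesgue measure). For a non-empty compact set $A$ and $r>0$, $A_r=\{x\in\mathbb{R}^d: \min_{y\in A}|x-y|\le r\}$ is its closed $r$-parallel set. $U_K$ denotes the unique unbounded connected component of $\mathbb{R}^d\setminus K$, and $\tilde K=\mathbb{R}^d\setminus U_K$ (i.e. $K$ with its "holes" filled in). $P(\cdot)$ denotes perimeter; for all but countably many $t>0$, $P(\tilde K_t)=\mathcal H^{d-1}(\partial \tilde K_t)$, and $t\mapsto P(\tilde K_t)^{-1}$ is measurable. *)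

theory Defs
  imports "HOL-Analysis.Analysis"
begin

definition C1c :: "('a::euclidean_space \<Rightarrow> 'b::real_normed_vector) \<Rightarrow> bool" where
  "C1c \<phi> \<longleftrightarrow> (\<forall>x. \<phi> differentiable (at x))
      \<and> (\<forall>v. continuous_on UNIV (\<lambda>x. frechet_derivative \<phi> (at x) v))
      \<and> bounded {x. \<phi> x \<noteq> 0}"

definition divergence :: "('a::euclidean_space \<Rightarrow> 'a) \<Rightarrow> 'a \<Rightarrow> real" where
  "divergence \<phi> x = (\<Sum>b\<in>Basis. frechet_derivative \<phi> (at x) b \<bullet> b)"

definition perimeter :: "'a::euclidean_space set \<Rightarrow> ennreal" where
  "perimeter E = (SUP \<phi> \<in> {\<phi>. C1c \<phi> \<and> (\<forall>x. norm (\<phi> x) \<le> 1)}.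
        ennreal (LINT x:E|lebesgue. divergence \<phi> x))"

definition weak_gradient :: "('a::euclidean_space \<Rightarrow> real) \<Rightarrow> ('a \<Rightarrow> 'a) \<Rightarrow> bool" where
  "weak_gradient u g \<longleftrightarrow> g \<in> borel_measurable lebesgue \<and>
     (\<forall>S. compact S \<longrightarrow> set_integrable lebesgue S (\<lambda>x. norm (g x))) \<and>
     (\<forall>\<phi>::'a \<Rightarrow> real. C1c \<phi> \<longrightarrow> (\<forall>b\<in>Basis.
        (LINT x|lebesgue. u x * frechet_derivative \<phi> (at x) b)
          = - (LINT x|lebesgue. (g x \<bullet> b) * \<phi> x)))"

(* Admissible pairs (u, Du): u \<in> D^1 \<inter> C^0, u \<ge> 1_K *)
definition cap_admissible :: "'a::euclidean_space set \<Rightarrow> ('a \<Rightarrow> real) \<Rightarrow> ('a \<Rightarrow> 'a) \<Rightarrow> bool" where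
  "cap_admissible K u g \<longleftrightarrow>
     continuous_on UNIV u \<and>
     (\<forall>x. indicator K x \<le> u x) \<and>
     (\<forall>S. compact S \<longrightarrow> set_integrable lebesgue S u) \<and>
     weak_gradient u g \<and>
     (\<integral>\<^sup>+ x. ennreal ((norm (g x))\<^sup>2) \<partial>lebesgue) < \<infinity> \<and>
     (\<forall>\<epsilon>>0. emeasure lebesgue {x. \<bar>u x\<bar> > \<epsilon>} < \<infinity>)"

definition newton_cap :: "'a::euclidean_space set \<Rightarrow> ennreal" where
  "newton_cap K = (INF ug \<in> {(u, g). cap_admissible K u g}.
        \<integral>\<^sup>+ x. ennreal ((norm (snd ug x))\<^sup>2) \<partial>lebesgue)"

definition parallel_set :: "'a::euclidean_space set \<Rightarrow> real \<Rightarrow> 'a set" where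
  "parallel_set A r = {x. infdist x A \<le> r}"

definition fill_holes :: "'a::euclidean_space set \<Rightarrow> 'a set" where
  "fill_holes K = - outside K"

end

theory Submission
  imports Defs
begin

text \<open>
  Upper bound. Let \<open>\<delta>\<close> be the distance to \<open>A = fill_holes K\<close> and \<open>P t\<close> the perimeter of the parallel set
  \<open>A\<^sub>t = {\<delta> \<le> t}\<close>. One tests the capacity with a function of \<open>\<delta>\<close> whose slope is proportional to \<open>1 / P\<close>;
  its energy is \<open>1 / \<integral> 1 / P\<close> as soon as \<open>\<integral> w (\<delta> x) dx \<le> \<integral> w P dt\<close> for weights \<open>w \<ge> 0\<close>. Instead of
  differentiating \<open>\<delta>\<close> almost everywhere, replace \<open>\<delta>\<^sup>2\<close> by the soft minimum \<open>s\<close> of finitely many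
  \<open>|x - y|\<^sup>2\<close>, \<open>y \<in> A\<close>. Its gradient \<open>2 v\<close> satisfies \<open>div v \<le> d\<close>, and the defect \<open>\<delta>\<^sup>2 - |v|\<^sup>2\<close> is a
  small multiple of \<open>d - div v\<close>, so it tends to zero in \<open>L\<^sup>1\<close> by the divergence theorem. Thus
  \<open>v / sqrt s\<close>, cut off, is a competitor for the perimeter that nearly realises the unit normal of all
  level sets at once, and \<open>P t\<close> is bounded below by its flux through \<open>A\<^sub>t\<close>.

  Equality for balls. The perimeter of a ball is at most its surface area, which bounds the integral of
  \<open>1 / P\<close> from below. Conversely, for admissible \<open>u\<close> the truncation \<open>min u 1\<close> still satisfies
  \<open>\<integral> min u 1 div X \<le> ||Du||\<^sub>2 ||X||\<^sub>2\<close>, since truncation decreases difference quotients. Taking for \<open>X\<close>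
  the field \<open>x / |x|\<^sup>d\<close>, switched on just inside the ball and switched off far away, gives the matching
  lower bound for the energy of \<open>u\<close>.
\<close>

section \<open>Continuously differentiable functions and integration by parts\<close>

text \<open>If f has slope - w / I with I the integral of w, then f(\<delta>) has energy (integral
  of w(\<delta>)^2) / I^2. The inequality of the overview, applied to w^2, bounds this by (integral
  of w^2 P) / I^2, which equals 1 / I for w = 1 / P. The obstacle is that \<open>perimeter\<close>
  is a bare supremum and gives no continuity of P in t, so 1 / P cannot serve as a continuous slope.
  It is replaced by 1 / max h c, where h t is the flux of one fixed competitor through the parallel
  set and c > 0 a lower bound of P on a compact range of t. Then max h c <= P makes I large enough,
  and h is continuous because level sets of \<delta> are null, which itself follows from the flux
  inequality. Hence two approximations of \<delta> run side by side: index n fixes the competitor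
  before the weight is chosen, since the weight depends on h; index m smooths \<delta> inside the
  weight and goes to infinity first, leaving an error of order \<open>\<tau> n\<close>. For balls, u
  vanishes at infinity only in the sense of measure. The truncation makes the outer part of the flux
  small: \<open>min u 1\<close> is at most 1 on a set of finite measure and at most a small number
  elsewhere.\<close>

lemma bounded_subset_cballD:
  fixes S :: "'a::real_normed_vector set"
  assumes "bounded S" shows "\<exists>R>0. S \<subseteq> cball 0 R"
  using bounded_subset_ballD[OF assms, of 0] ball_subset_cball by (meson order_trans)

text \<open>The part of \<open>C1c\<close> without the support condition, split off because most
  products pair one compactly supported factor with one that is merely smooth.\<close>

definition C1 :: "('a::euclidean_space \<Rightarrow> 'b::real_normed_vector) \<Rightarrow> bool" where
  "C1 f \<longleftrightarrow> (\<forall>x. f differentiable (at x))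
      \<and> (\<forall>v. continuous_on UNIV (\<lambda>x. frechet_derivative f (at x) v))"

lemma C1c_iff: "C1c f \<longleftrightarrow> C1 f \<and> bounded {x. f x \<noteq> 0}"
  by (auto simp: C1c_def C1_def)

lemma C1I:
  assumes "\<And>x. (f has_derivative f' x) (at x)" "\<And>v. continuous_on UNIV (\<lambda>x. f' x v)"
  shows "C1 f"
proof -
  have "frechet_derivative f (at x) = f' x" for x
    using frechet_derivative_at[OF assms(1)] by simp
  then show ?thesis
    using assms by (auto simp: C1_def differentiable_def)
qed

lemma C1_has_derivative: "C1 f \<Longrightarrow> (f has_derivative frechet_derivative f (at x)) (at x)"
  by (simp add: C1_def frechet_derivative_works[symmetric])

lemma C1_continuous_derivative: "C1 f \<Longrightarrow> continuous_on UNIV (\<lambda>x. frechet_derivative f (at x) v)"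
  by (simp add: C1_def)

lemma C1_continuous: "C1 f \<Longrightarrow> continuous_on UNIV f"
  by (meson C1_has_derivative continuous_at_imp_continuous_on has_derivative_continuous)

lemma C1_const: "C1 (\<lambda>x. c)"
  by (rule C1I[where f'="\<lambda>_ _. 0"]) auto

lemma C1_bounded_linear: "bounded_linear f \<Longrightarrow> C1 f"
  by (rule C1I[where f'="\<lambda>_. f"]) (auto intro: bounded_linear_imp_has_derivative)

lemma C1_add:
  assumes "C1 f" "C1 g" shows "C1 (\<lambda>x. f x + g x)"
  by (rule C1I[OF has_derivative_add[OF C1_has_derivative[OF assms(1)] C1_has_derivative[OF assms(2)]]])
    (intro continuous_intros C1_continuous_derivative assms)

lemma C1_scaleR:
  assumes "C1 f" "C1 g" shows "C1 (\<lambda>x. f x *\<^sub>R g x)"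
  by (rule C1I[OF has_derivative_scaleR[OF C1_has_derivative[OF assms(1)] C1_has_derivative[OF assms(2)]]])
    (intro continuous_intros C1_continuous_derivative C1_continuous assms)

lemma C1_mult:
  fixes f g :: "_ \<Rightarrow> real"
  assumes "C1 f" "C1 g" shows "C1 (\<lambda>x. f x * g x)"
  using C1_scaleR[OF assms] by simp

lemma C1_inner:
  fixes f g :: "_ \<Rightarrow> _::euclidean_space"
  assumes "C1 f" "C1 g" shows "C1 (\<lambda>x. f x \<bullet> g x)"
  by (rule C1I[OF has_derivative_inner[OF C1_has_derivative[OF assms(1)] C1_has_derivative[OF assms(2)]]])
    (intro continuous_intros C1_continuous_derivative C1_continuous assms)

lemma C1_diff:
  assumes "C1 f" "C1 g" shows "C1 (\<lambda>x. f x - g x)"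
  by (rule C1I[OF has_derivative_diff[OF C1_has_derivative[OF assms(1)] C1_has_derivative[OF assms(2)]]])
    (intro continuous_intros C1_continuous_derivative assms)

lemma C1_translate:
  assumes "C1 f" shows "C1 (\<lambda>x. f (x + a))"
    and "frechet_derivative (\<lambda>x. f (x + a)) (at x) = frechet_derivative f (at (x + a))"
proof -
  have d: "((\<lambda>x. f (x + a)) has_derivative frechet_derivative f (at (x + a))) (at x)" for x
    by (rule has_derivative_compose[of "\<lambda>x. x + a" "\<lambda>h. h" x UNIV f, OF _ C1_has_derivative[OF assms]])
      (auto intro!: derivative_eq_intros)
  have "continuous_on UNIV (\<lambda>x. frechet_derivative f (at (x + a)) v)" for v
    by (rule continuous_on_compose2[OF C1_continuous_derivative[OF assms, of v]])
      (auto intro!: continuous_intros)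
  then show "C1 (\<lambda>x. f (x + a))" by (rule C1I[OF d])
  show "frechet_derivative (\<lambda>x. f (x + a)) (at x) = frechet_derivative f (at (x + a))"
    using frechet_derivative_at[OF d] by simp
qed

lemma C1_compose_real:
  fixes f :: "_ \<Rightarrow> real"
  assumes "C1 f" and "\<And>x. (\<eta> has_real_derivative \<eta>' (f x)) (at (f x))"
    and "continuous_on (range f) \<eta>'"
  shows "C1 (\<lambda>x. \<eta> (f x))"
proof (rule C1I)
  show "((\<lambda>x. \<eta> (f x)) has_derivative (\<lambda>h. \<eta>' (f x) * frechet_derivative f (at x) h)) (at x)" for x
    using has_derivative_compose[OF C1_has_derivative[OF assms(1)] assms(2)[unfolded has_field_derivative_def]]
    by simp
  show "continuous_on UNIV (\<lambda>x. \<eta>' (f x) * frechet_derivative f (at x) v)" for v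
    by (intro continuous_intros C1_continuous_derivative assms(1)
        continuous_on_compose2[OF assms(3) C1_continuous[OF assms(1)]]) auto
qed

lemma C1_real_polynomial_function:
  fixes p :: "'a::euclidean_space \<Rightarrow> real"
  shows "real_polynomial_function p \<Longrightarrow> C1 p"
  by (induction rule: real_polynomial_function.induct)
    (auto intro: C1_bounded_linear C1_const C1_add C1_mult)

lemma C1c_scaleR:
  assumes "C1c f" "C1 g" shows "C1c (\<lambda>x. f x *\<^sub>R g x)"
  using assms by (auto simp: C1c_iff intro: C1_scaleR bounded_subset)

lemma C1c_mult:
  fixes f g :: "_ \<Rightarrow> real"
  assumes "C1c f" "C1 g" shows "C1c (\<lambda>x. f x * g x)"
  using C1c_scaleR[OF assms] by simp

lemma C1c_inner_const:
  fixes f :: "_ \<Rightarrow> _::euclidean_space"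
  assumes "C1c f" shows "C1c (\<lambda>x. f x \<bullet> b)"
  using assms by (auto simp: C1c_iff intro!: C1_inner C1_const intro: bounded_subset[of "{x. f x \<noteq> 0}"])

lemma C1c_translate:
  assumes "C1c f" shows "C1c (\<lambda>x. f (x + a))"
proof -
  have "{x. f (x + a) \<noteq> 0} = (\<lambda>x. x - a) ` {x. f x \<noteq> 0}"
    by (auto intro!: image_eqI[of _ _ "_ + a"])
  moreover have "bounded \<dots>"
    using bounded_translation[of "{x. f x \<noteq> 0}" "- a"] assms by (simp add: C1c_iff add.commute)
  ultimately show ?thesis using assms C1_translate(1)[of f a] by (simp add: C1c_iff)
qed

lemma frechet_derivative_eq_0:
  assumes "open S" "x \<in> S" "\<And>y. y \<in> S \<Longrightarrow> f y = c"
  shows "frechet_derivative f (at x) = (\<lambda>_. 0)"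
proof -
  have "(f has_derivative (\<lambda>_. 0)) (at x)"
    using has_derivative_transform_within_open[OF has_derivative_const assms(1,2)] assms(3) by metis
  from frechet_derivative_at[OF this] show ?thesis by simp
qed

lemma C1c_derivative_support:
  assumes "C1c f" and "{x. f x \<noteq> 0} \<subseteq> cball 0 R" and "norm x > R"
  shows "frechet_derivative f (at x) = (\<lambda>_. 0)"
  by (rule frechet_derivative_eq_0[of "- cball 0 R" _ _ 0]) (use assms in auto)

lemma C1c_derivative_bounded_support:
  assumes "C1c f"
  shows "bounded {x. frechet_derivative f (at x) v \<noteq> 0}"
proof -
  obtain R where R: "{x. f x \<noteq> 0} \<subseteq> cball 0 R"
    using assms by (metis C1c_iff bounded_subset_cballD)
  have "{x. frechet_derivative f (at x) v \<noteq> 0} \<subseteq> cball 0 R"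
    using C1c_derivative_support[OF assms R] by (auto simp: not_less[symmetric])
  then show ?thesis by (meson bounded_cball bounded_subset)
qed

section \<open>Continuous functions with bounded support\<close>

lemma integrable_continuous_bounded_support:
  fixes f :: "'a::euclidean_space \<Rightarrow> 'b::{banach, second_countable_topology}"
  assumes "continuous_on UNIV f" "bounded {x. f x \<noteq> 0}"
  shows "integrable lborel f"
proof -
  obtain R where "{x. f x \<noteq> 0} \<subseteq> cball 0 R"
    using assms(2) by (meson bounded_subset_cballD)
  then have "f = (\<lambda>x. indicator (cball 0 R) x *\<^sub>R f x)"
    by (fastforce simp: indicator_def)
  then show ?thesis
    using borel_integrable_compact[of "cball 0 R" f] assms(1) continuous_on_subset by auto
qed

lemma integrable_continuous_mult_indicator:
  fixes f :: "'a::euclidean_space \<Rightarrow> real"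
  assumes "continuous_on UNIV f" "bounded S" "S \<in> sets borel"
  shows "integrable lborel (\<lambda>x. f x * indicator S x)"
proof -
  obtain R where R: "S \<subseteq> cball 0 R"
    using assms(2) by (meson bounded_subset_cballD)
  have "integrable lborel (\<lambda>x. indicator (cball 0 R) x *\<^sub>R f x)"
    using borel_integrable_compact[of "cball 0 R" f] assms(1) continuous_on_subset by auto
  then have "integrable lborel (\<lambda>x. indicator S x *\<^sub>R (indicator (cball 0 R) x *\<^sub>R f x))"
    by (rule integrable_mult_indicator[rotated]) (use assms in auto)
  also have "(\<lambda>x. indicator S x *\<^sub>R (indicator (cball 0 R) x *\<^sub>R f x)) = (\<lambda>x. f x * indicator S x)"
    using R by (fastforce simp: indicator_def)
  finally show ?thesis .
qed

lemma bounded_continuous_bounded_support: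
  fixes f :: "'a::euclidean_space \<Rightarrow> real"
  assumes "continuous_on UNIV f" "bounded {x. f x \<noteq> 0}"
  obtains B where "B > 0" "\<And>x. \<bar>f x\<bar> \<le> B"
proof -
  obtain R where R: "{x. f x \<noteq> 0} \<subseteq> cball 0 R"
    using assms(2) by (meson bounded_subset_cballD)
  have "compact (f ` cball 0 R)"
    by (intro compact_continuous_image continuous_on_subset[OF assms(1)]) auto
  then obtain B where B: "B > 0" "\<And>y. y \<in> f ` cball 0 R \<Longrightarrow> norm y \<le> B"
    by (meson bounded_pos compact_imp_bounded)
  have "\<bar>f x\<bar> \<le> B" for x
  proof (cases "f x = 0")
    case True then show ?thesis using B(1) by simp
  next
    case False then show ?thesis using B(2)[of "f x"] R by auto
  qed
  with B(1) show ?thesis by (rule that)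
qed

section \<open>Translation and the divergence theorem\<close>

lemma integral_lborel_translate:
  fixes f :: "'a::euclidean_space \<Rightarrow> 'b::{banach, second_countable_topology}"
  assumes "f \<in> borel_measurable borel"
  shows "(LINT x|lborel. f (x + a)) = (LINT x|lborel. f x)"
proof -
  have "integral\<^sup>L (distr lborel borel ((+) a)) f = (LINT x|lborel. f (a + x))"
    by (rule integral_distr) (use assms in auto)
  then show ?thesis by (simp add: lborel_distr_plus add.commute)
qed

text \<open>All difference quotients fall on the smooth factor \<psi>, so u need only be continuous.
  The case u = 1 yields the divergence theorem; an admissible u of the capacity problem yields the
  link to its weak gradient.\<close>

lemma has_real_derivative_integral_translate:
  fixes u \<psi> :: "'a::euclidean_space \<Rightarrow> real"
  assumes u: "continuous_on UNIV u" and \<psi>: "C1c \<psi>"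
  shows "((\<lambda>s. LINT x|lborel. u x * \<psi> (x + s *\<^sub>R b)) has_real_derivative
          (LINT x|lborel. u x * frechet_derivative \<psi> (at (x + s *\<^sub>R b)) b)) (at s)"
proof -
  \<comment> \<open>Absorbing the shift by s reduces the claim to the derivative at 0.\<close>
  define f where "f x = \<psi> (x + s *\<^sub>R b)" for x
  have f: "C1c f" unfolding f_def by (rule C1c_translate[OF \<psi>])
  have C1f: "C1 f" using f by (simp add: C1c_iff)
  have fd: "frechet_derivative f (at x) = frechet_derivative \<psi> (at (x + s *\<^sub>R b))" for x
    unfolding f_def using \<psi> by (intro C1_translate(2)) (simp add: C1c_iff)
  obtain R where R: "{x. f x \<noteq> 0} \<subseteq> cball 0 R" "R > 0"
    using f by (metis C1c_iff bounded_subset_cballD)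
  obtain B where B: "B > 0" "\<And>x. \<bar>frechet_derivative f (at x) b\<bar> \<le> B"
    using bounded_continuous_bounded_support[OF C1_continuous_derivative[OF C1f] C1c_derivative_bounded_support[OF f]]
    by metis
  have line: "((\<lambda>t. f (x + t *\<^sub>R b)) has_real_derivative frechet_derivative f (at (x + t *\<^sub>R b)) b) (at t)" for x t
  proof -
    have "((\<lambda>t. f (x + t *\<^sub>R b)) has_derivative (\<lambda>h. frechet_derivative f (at (x + t *\<^sub>R b)) (h *\<^sub>R b))) (at t)"
      by (rule has_derivative_compose[of _ _ _ _ f, OF _ C1_has_derivative[OF C1f]])
        (auto intro!: derivative_eq_intros)
    moreover have "frechet_derivative f (at (x + t *\<^sub>R b)) (h *\<^sub>R b) = frechet_derivative f (at (x + t *\<^sub>R b)) b * h" for h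
      using linear_cmul[OF has_derivative_linear[OF C1_has_derivative[OF C1f]]] by (simp add: mult.commute)
    ultimately show ?thesis by (simp add: has_field_derivative_def)
  qed
  have lip: "\<bar>f (x + t *\<^sub>R b) - f x\<bar> \<le> B * \<bar>t\<bar>" for x t
    using field_differentiable_bound[of UNIV "\<lambda>t. f (x + t *\<^sub>R b)" "\<lambda>t. frechet_derivative f (at (x + t *\<^sub>R b)) b" B t 0] line B(2)
    by (auto simp: has_field_derivative_at_within)
  \<comment> \<open>For |t| <= 1 every support shifted by t b lies in this enlarged ball, which
    supplies the integrable majorant.\<close>
  define S where "S = cball (0::'a) (R + norm b)"
  have dom: "\<bar>(f (x + t *\<^sub>R b) - f x) / t\<bar> \<le> B * indicator S x" if "\<bar>t\<bar> \<le> 1" "t \<noteq> 0" for x t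
  proof (cases "x \<in> S")
    case True
    then show ?thesis using lip[of x t] that by (simp add: divide_simps abs_divide)
  next
    case False
    have "norm x > R + norm b" using False by (auto simp: S_def)
    moreover have "norm (x + t *\<^sub>R b) \<ge> norm x - norm (t *\<^sub>R b)"
      by (rule norm_diff_ineq)
    moreover have "norm (t *\<^sub>R b) \<le> norm b" using that by (simp add: mult_left_le_one_le)
    ultimately have "norm x > R" "norm (x + t *\<^sub>R b) > R" using norm_ge_zero[of b] by linarith+
    then have "f x = 0" "f (x + t *\<^sub>R b) = 0" using R by auto
    then show ?thesis by (simp add: False)
  qed
  have cf: "continuous_on UNIV f" by (rule C1_continuous[OF C1f])
  have cft: "continuous_on UNIV (\<lambda>x. f (x + a))" for a
    by (rule continuous_on_compose2[OF cf]) (auto intro!: continuous_intros)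
  have int: "integrable lborel (\<lambda>x. u x * f (x + a))" for a
  proof (rule integrable_continuous_bounded_support)
    show "continuous_on UNIV (\<lambda>x. u x * f (x + a))" by (intro continuous_intros u cft)
    show "bounded {x. u x * f (x + a) \<noteq> 0}"
      using C1c_translate[OF f, of a] by (auto simp: C1c_iff intro: bounded_subset)
  qed
  have "((\<lambda>t. LINT x|lborel. u x * f (x + t *\<^sub>R b)) has_real_derivative
          (LINT x|lborel. u x * frechet_derivative f (at x) b)) (at 0)"
    unfolding has_field_derivative_iff tendsto_at_iff_sequentially
  proof (intro allI impI, unfold o_def)
    fix X :: "nat \<Rightarrow> real" assume X: "\<forall>i. X i \<in> UNIV - {0}" "X \<longlonglongrightarrow> 0"
    \<comment> \<open>The majorant is valid only for steps of size at most 1, so an initial segment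
      of the sequence is skipped; \<open>LIMSEQ_offset\<close> restores it at the end.\<close>
    have "\<exists>N. \<forall>n\<ge>N. \<bar>X n\<bar> \<le> 1"
      using X(2) by (metis LIMSEQ_D diff_zero less_imp_le real_norm_def zero_less_one)
    then obtain N where N: "\<And>n. \<bar>X (n + N)\<bar> \<le> 1" by (meson le_add2)
    have "(\<lambda>n. LINT x|lborel. u x * ((f (x + X (n + N) *\<^sub>R b) - f x) / X (n + N)))
         \<longlonglongrightarrow> (LINT x|lborel. u x * frechet_derivative f (at x) b)"
    proof (rule integral_dominated_convergence[where w="\<lambda>x. \<bar>u x\<bar> * indicator S x * B"])
      show "(\<lambda>x. u x * frechet_derivative f (at x) b) \<in> borel_measurable lborel"
        by (auto intro!: borel_measurable_continuous_onI continuous_intros u C1_continuous_derivative[OF C1f])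
      show "(\<lambda>x. u x * ((f (x + X (n + N) *\<^sub>R b) - f x) / X (n + N))) \<in> borel_measurable lborel" for n
        using X(1) by (auto intro!: borel_measurable_continuous_onI continuous_intros u cf cft)
      show "integrable lborel (\<lambda>x. \<bar>u x\<bar> * indicator S x * B)"
        by (intro integrable_mult_left integrable_continuous_mult_indicator) (auto intro!: continuous_intros u simp: S_def)
      show "AE x in lborel. (\<lambda>n. u x * ((f (x + X (n + N) *\<^sub>R b) - f x) / X (n + N))) \<longlonglongrightarrow> u x * frechet_derivative f (at x) b"
      proof (intro AE_I2 tendsto_intros)
        fix x
        have "((\<lambda>t. (f (x + t *\<^sub>R b) - f x) / t) \<longlongrightarrow> frechet_derivative f (at x) b) (at 0)"
          using line[of x 0] by (simp add: has_field_derivative_iff)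
        then have "(\<lambda>n. (f (x + X n *\<^sub>R b) - f x) / X n) \<longlonglongrightarrow> frechet_derivative f (at x) b"
          using X by (auto simp: tendsto_at_iff_sequentially o_def)
        then show "(\<lambda>n. (f (x + X (n + N) *\<^sub>R b) - f x) / X (n + N)) \<longlonglongrightarrow> frechet_derivative f (at x) b"
          by (rule LIMSEQ_ignore_initial_segment)
      qed
      show "AE x in lborel. norm (u x * ((f (x + X (n + N) *\<^sub>R b) - f x) / X (n + N))) \<le> \<bar>u x\<bar> * indicator S x * B" for n
      proof (rule AE_I2)
        fix x
        have "\<bar>u x\<bar> * \<bar>(f (x + X (n + N) *\<^sub>R b) - f x) / X (n + N)\<bar> \<le> \<bar>u x\<bar> * (B * indicator S x)"
          using dom[OF N, of n x] X(1) by (intro mult_left_mono) auto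
        then show "norm (u x * ((f (x + X (n + N) *\<^sub>R b) - f x) / X (n + N))) \<le> \<bar>u x\<bar> * indicator S x * B"
          by (simp add: abs_mult mult_ac)
      qed
    qed
    moreover have "(LINT x|lborel. u x * ((f (x + t *\<^sub>R b) - f x) / t))
       = ((LINT x|lborel. u x * f (x + t *\<^sub>R b)) - (LINT x|lborel. u x * f (x + 0 *\<^sub>R b))) / (t - 0)" for t
    proof -
      have "(LINT x|lborel. u x * ((f (x + t *\<^sub>R b) - f x) / t)) = (LINT x|lborel. (u x * f (x + t *\<^sub>R b) - u x * f (x + 0)) / t)"
        by (rule Bochner_Integration.integral_cong) (auto simp: right_diff_distrib diff_divide_distrib)
      also have "\<dots> = (LINT x|lborel. u x * f (x + t *\<^sub>R b) - u x * f (x + 0)) / t"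
        by (rule integral_divide_zero)
      also have "\<dots> = ((LINT x|lborel. u x * f (x + t *\<^sub>R b)) - (LINT x|lborel. u x * f (x + 0))) / t"
        by (subst Bochner_Integration.integral_diff[OF int int]) (rule refl)
      finally show ?thesis by simp
    qed
    ultimately have "(\<lambda>n. ((LINT x|lborel. u x * f (x + X (n + N) *\<^sub>R b)) - (LINT x|lborel. u x * f (x + 0 *\<^sub>R b))) / (X (n + N) - 0))
       \<longlonglongrightarrow> (LINT x|lborel. u x * frechet_derivative f (at x) b)"
      by (simp only:)
    then show "(\<lambda>n. ((LINT x|lborel. u x * f (x + X n *\<^sub>R b)) - (LINT x|lborel. u x * f (x + 0 *\<^sub>R b))) / (X n - 0))
       \<longlonglongrightarrow> (LINT x|lborel. u x * frechet_derivative f (at x) b)"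
      by (rule LIMSEQ_offset)
  qed
  then have "((\<lambda>t. LINT x|lborel. u x * \<psi> (x + (t + s) *\<^sub>R b)) has_real_derivative
          (LINT x|lborel. u x * frechet_derivative \<psi> (at (x + s *\<^sub>R b)) b)) (at 0)"
    unfolding fd by (simp add: f_def scaleR_add_left add_ac)
  then show ?thesis
    using DERIV_shift[of "\<lambda>t. LINT x|lborel. u x * \<psi> (x + t *\<^sub>R b)" _ 0 s] by simp
qed

text \<open>By translation invariance the integral of f (x + s b) is constant in s. Differentiating
  at s = 0 avoids Fubini and one-dimensional boundary terms.\<close>

lemma integral_derivative_C1c_eq_0:
  fixes f :: "'a::euclidean_space \<Rightarrow> real"
  assumes "C1c f"
  shows "(LINT x|lborel. frechet_derivative f (at x) b) = 0"
proof -
  have "((\<lambda>s. LINT x|lborel. 1 * f (x + s *\<^sub>R b)) has_real_derivative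
          (LINT x|lborel. 1 * frechet_derivative f (at (x + 0 *\<^sub>R b)) b)) (at 0)"
    by (rule has_real_derivative_integral_translate[OF _ assms]) auto
  moreover have "(\<lambda>s. LINT x|lborel. 1 * f (x + s *\<^sub>R b)) = (\<lambda>s. LINT x|lborel. f x)"
    using assms by (auto intro!: integral_lborel_translate borel_measurable_continuous_onI C1_continuous simp: C1c_iff)
  ultimately have "((\<lambda>s. LINT x|lborel. f x) has_real_derivative (LINT x|lborel. frechet_derivative f (at x) b)) (at 0)"
    by (simp only: mult_1 scaleR_zero_left add_0_right)
  then show ?thesis using DERIV_const[of "LINT x|lborel. f x"] DERIV_unique by blast
qed

lemma continuous_divergence: "C1 \<phi> \<Longrightarrow> continuous_on UNIV (divergence \<phi>)"
  unfolding divergence_def[abs_def] by (intro continuous_intros C1_continuous_derivative)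

lemma bounded_support_divergence:
  assumes "C1c \<phi>" shows "bounded {x. divergence \<phi> x \<noteq> 0}"
proof -
  obtain R where R: "{x. \<phi> x \<noteq> 0} \<subseteq> cball 0 R"
    using assms by (metis C1c_iff bounded_subset_cballD)
  have "{x. divergence \<phi> x \<noteq> 0} \<subseteq> cball 0 R"
    using C1c_derivative_support[OF assms R] by (auto simp: divergence_def not_less[symmetric])
  then show ?thesis by (meson bounded_cball bounded_subset)
qed

lemma divergence_scaleR:
  fixes V :: "'a::euclidean_space \<Rightarrow> 'a"
  assumes "(f has_derivative (\<lambda>h. G \<bullet> h)) (at x)" "(V has_derivative V') (at x)"
  shows "divergence (\<lambda>x. f x *\<^sub>R V x) x = f x * divergence V x + G \<bullet> V x"
proof -
  have "frechet_derivative (\<lambda>x. f x *\<^sub>R V x) (at x) = (\<lambda>h. f x *\<^sub>R V' h + (G \<bullet> h) *\<^sub>R V x)"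
    using frechet_derivative_at[OF has_derivative_scaleR[OF assms]] by simp
  moreover have "frechet_derivative V (at x) = V'"
    using frechet_derivative_at[OF assms(2)] by simp
  ultimately show ?thesis
    by (simp add: divergence_def inner_add_left sum.distrib sum_distrib_left euclidean_inner[of G "V x"])
qed

lemma integral_divergence_eq_0:
  fixes \<phi> :: "'a::euclidean_space \<Rightarrow> 'a"
  assumes "C1c \<phi>"
  shows "(LINT x|lborel. divergence \<phi> x) = 0"
proof -
  have C1: "C1 \<phi>" using assms by (simp add: C1c_iff)
  have "frechet_derivative (\<lambda>x. \<phi> x \<bullet> b) (at x) b = frechet_derivative \<phi> (at x) b \<bullet> b" for b x
  proof -
    have "((\<lambda>x. \<phi> x \<bullet> b) has_derivative (\<lambda>h. frechet_derivative \<phi> (at x) h \<bullet> b)) (at x)"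
      by (rule has_derivative_inner_left[OF C1_has_derivative[OF C1]])
    from fun_cong[OF frechet_derivative_at[OF this], of b] show ?thesis by simp
  qed
  then have "(LINT x|lborel. frechet_derivative \<phi> (at x) b \<bullet> b) = 0" for b
    using integral_derivative_C1c_eq_0[OF C1c_inner_const[OF assms, of b], of b] by simp
  moreover have "integrable lborel (\<lambda>x. frechet_derivative \<phi> (at x) b \<bullet> b)" for b
    using C1c_derivative_bounded_support[OF assms, of b]
    by (intro integrable_continuous_bounded_support continuous_intros C1_continuous_derivative[OF C1])
      (auto intro: bounded_subset[of "{x. frechet_derivative \<phi> (at x) b \<noteq> 0}"])
  ultimately show ?thesis by (simp add: divergence_def)
qed

text \<open>The divergence theorem for the product of U and \<phi>. The compact support comes from
  \<phi> alone, so U may be any C1 function of an approximate distance.\<close>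

lemma integral_mult_divergence:
  fixes \<phi> :: "'a::euclidean_space \<Rightarrow> 'a" and U :: "'a \<Rightarrow> real"
  assumes \<phi>: "C1c \<phi>" and U: "\<And>x. (U has_derivative (\<lambda>h. G x \<bullet> h)) (at x)" and G: "continuous_on UNIV G"
  shows "(LINT x|lborel. U x * divergence \<phi> x) = - (LINT x|lborel. G x \<bullet> \<phi> x)"
proof -
  have C1U: "C1 U" by (rule C1I[OF U]) (intro continuous_intros G)
  have C1\<phi>: "C1 \<phi>" using \<phi> by (simp add: C1c_iff)
  have div: "divergence (\<lambda>x. U x *\<^sub>R \<phi> x) x = U x * divergence \<phi> x + G x \<bullet> \<phi> x" for x
    by (rule divergence_scaleR[OF U C1_has_derivative[OF C1\<phi>]])
  have "C1c (\<lambda>x. U x *\<^sub>R \<phi> x)"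
    using C1_scaleR[OF C1U C1\<phi>] \<phi> by (auto simp: C1c_iff intro: bounded_subset)
  from integral_divergence_eq_0[OF this]
  have "(LINT x|lborel. U x * divergence \<phi> x + G x \<bullet> \<phi> x) = 0" by (simp add: div)
  moreover have "integrable lborel (\<lambda>x. U x * divergence \<phi> x)"
    using bounded_support_divergence[OF \<phi>]
    by (intro integrable_continuous_bounded_support continuous_intros C1_continuous[OF C1U] continuous_divergence C1\<phi>)
      (auto intro: bounded_subset)
  moreover have "integrable lborel (\<lambda>x. G x \<bullet> \<phi> x)"
    using \<phi> by (intro integrable_continuous_bounded_support continuous_intros C1_continuous[OF C1\<phi>] G)
      (auto simp: C1c_iff intro: bounded_subset[of "{x. \<phi> x \<noteq> 0}"])
  ultimately show ?thesis by simp
qed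

text \<open>Integration by parts against the field \<phi> b, whose divergence is the partial
  derivative of \<phi> along b. This makes classical competitors usable in the capacity
  problem.\<close>

lemma weak_gradient_C1:
  fixes U :: "'a::euclidean_space \<Rightarrow> real"
  assumes U: "\<And>x. (U has_derivative (\<lambda>h. G x \<bullet> h)) (at x)" and G: "continuous_on UNIV G"
  shows "weak_gradient U G"
  unfolding weak_gradient_def
proof (intro conjI allI impI ballI)
  have mG: "G \<in> borel_measurable borel" by (rule borel_measurable_continuous_onI[OF G])
  have C1U: "C1 U" by (rule C1I[OF U]) (intro continuous_intros G)
  then have cU: "continuous_on UNIV U" by (rule C1_continuous)
  show "G \<in> borel_measurable lebesgue"
    using mG by (simp add: measurable_completion)
  show "set_integrable lebesgue S (\<lambda>x. norm (G x))" if "compact S" for S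
  proof -
    have "integrable lborel (\<lambda>x. indicator S x *\<^sub>R norm (G x))"
      by (rule borel_integrable_compact[OF that]) (intro continuous_intros continuous_on_subset[OF G], auto)
    then show ?thesis
      unfolding set_integrable_def using integrable_completion borel_measurable_integrable by blast
  qed
  fix \<phi> :: "'a \<Rightarrow> real" and b :: 'a assume \<phi>: "C1c \<phi>" and b: "b \<in> Basis"
  have C1\<phi>: "C1 \<phi>" using \<phi> by (simp add: C1c_iff)
  note c = C1_continuous[OF C1\<phi>] C1_continuous_derivative[OF C1\<phi>]
  have "C1c (\<lambda>x. \<phi> x *\<^sub>R b)" by (rule C1c_scaleR[OF \<phi> C1_const])
  moreover have "divergence (\<lambda>x. \<phi> x *\<^sub>R b) x = frechet_derivative \<phi> (at x) b" for x
  proof -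
    have "frechet_derivative (\<lambda>x. \<phi> x *\<^sub>R b) (at x) = (\<lambda>h. frechet_derivative \<phi> (at x) h *\<^sub>R b)"
      using frechet_derivative_at[OF has_derivative_scaleR_left[OF C1_has_derivative[OF C1\<phi>]], of x b] by simp
    then show ?thesis using b by (simp add: divergence_def inner_Basis if_distrib sum.delta cong: if_cong)
  qed
  ultimately have "(LINT x|lborel. U x * frechet_derivative \<phi> (at x) b) = - (LINT x|lborel. (G x \<bullet> b) * \<phi> x)"
    using integral_mult_divergence[of "\<lambda>x. \<phi> x *\<^sub>R b" U G, OF _ U G] by (simp add: mult.commute)
  moreover have "(\<lambda>x. U x * frechet_derivative \<phi> (at x) b) \<in> borel_measurable lborel"
    "(\<lambda>x. (G x \<bullet> b) * \<phi> x) \<in> borel_measurable lborel"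
    by (auto intro!: borel_measurable_continuous_onI continuous_intros cU c G)
  ultimately show "(LINT x|lebesgue. U x * frechet_derivative \<phi> (at x) b) = - (LINT x|lebesgue. (G x \<bullet> b) * \<phi> x)"
    by (simp add: integral_completion)
qed

section \<open>Smooth approximation of the distance function\<close>

lemma has_derivative_compose_gradient:
  fixes f :: "'a::euclidean_space \<Rightarrow> real"
  assumes "(f has_derivative (\<lambda>h. G \<bullet> h)) (at x)" "(\<eta> has_real_derivative c) (at (f x))"
  shows "((\<lambda>x. \<eta> (f x)) has_derivative (\<lambda>h. (c *\<^sub>R G) \<bullet> h)) (at x)"
  using has_derivative_compose[OF assms(1) assms(2)[unfolded has_field_derivative_def]] by simp

lemma C1_sum:
  assumes "finite I" "\<And>i. i \<in> I \<Longrightarrow> C1 (f i)"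
  shows "C1 (\<lambda>x. \<Sum>i\<in>I. f i x)"
  using assms by (induction I rule: finite_induct) (auto intro: C1_const C1_add)

lemma divergence_sum:
  assumes "finite I" "\<And>i. i \<in> I \<Longrightarrow> C1 (f i)"
  shows "divergence (\<lambda>x. \<Sum>i\<in>I. f i x) x = (\<Sum>i\<in>I. divergence (f i) x)"
proof -
  have "((\<lambda>x. \<Sum>i\<in>I. f i x) has_derivative (\<lambda>h. \<Sum>i\<in>I. frechet_derivative (f i) (at x) h)) (at x)"
    by (intro has_derivative_sum C1_has_derivative assms(2))
  from frechet_derivative_at[OF this]
  have "frechet_derivative (\<lambda>x. \<Sum>i\<in>I. f i x) (at x) = (\<lambda>h. \<Sum>i\<in>I. frechet_derivative (f i) (at x) h)"
    by simp
  then show ?thesis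
    by (simp add: divergence_def inner_sum_left sum.swap[of _ _ I])
qed

lemma C1_diff_const: "C1 (\<lambda>x::'a::euclidean_space. x - y)"
  by (intro C1_diff C1_const C1_bounded_linear bounded_linear_ident)

lemma divergence_diff_const: "divergence (\<lambda>x::'a::euclidean_space. x - y) x = DIM('a)"
proof -
  have "((\<lambda>x. x - y) has_derivative (\<lambda>h. h)) (at x)"
    by (auto intro!: derivative_eq_intros)
  from frechet_derivative_at[OF this] have "frechet_derivative (\<lambda>x. x - y) (at x) = (\<lambda>h. h)" by simp
  then show ?thesis by (simp add: divergence_def)
qed

text \<open>
  With the Gibbs weights \<open>p\<^sub>y = exp (- k |x - y|\<^sup>2) / E\<close> on a finite net of \<open>A\<close>, \<open>v\<close> is the mean of \<open>x - y\<close>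
  and \<open>S\<close> the mean of \<open>|x - y|\<^sup>2\<close>; differentiating the weights yields \<open>div v = d - 2 k (S - |v|\<^sup>2)\<close>, so the
  variance \<open>S - |v|\<^sup>2\<close> is of order \<open>1 / k\<close> in the mean.
\<close>

lemma softmin_sq_dist:
  fixes A :: "'a::euclidean_space set"
  assumes "compact A" "A \<noteq> {}" "\<theta> > 0"
  obtains s :: "'a \<Rightarrow> real" and v :: "'a \<Rightarrow> 'a" where
    "\<And>x. (s has_derivative (\<lambda>h. 2 * (v x \<bullet> h))) (at x)"
    "C1 v"
    "\<And>x. divergence v x \<le> DIM('a)"
    "\<And>x. (infdist x A)\<^sup>2 - \<theta> \<le> s x"
    "\<And>x. (norm (v x))\<^sup>2 \<le> s x + \<theta>"
    "\<And>x. s x \<le> (infdist x A + \<theta>)\<^sup>2"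
    "\<And>x. (infdist x A)\<^sup>2 - (norm (v x))\<^sup>2 \<le> \<theta> * (DIM('a) - divergence v x)"
proof -
  obtain Y where Y: "finite Y" "Y \<subseteq> A" "A \<subseteq> (\<Union>y\<in>Y. ball y \<theta>)"
  proof -
    have "seq_compact A" using assms(1) by (simp add: compact_eq_seq_compact_metric)
    from seq_compact_imp_totally_bounded[OF this, rule_format, OF assms(3)] show ?thesis using that by blast
  qed
  have Y0: "Y \<noteq> {}" using Y(3) assms(2) by auto
  have cY: "card Y \<ge> 1" using Y(1) Y0 by (simp add: Suc_le_eq card_gt_0_iff)
  \<comment> \<open>One k serves two error terms: ln (card Y) / k bounds the gap between soft
    minimum and mean, and 1 / (2 k) is the ratio of variance to d - div v. Both become at most
    \<theta>.\<close>
  define k where "k = (ln (card Y) + 1) / \<theta>"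
  have "ln (card Y) \<ge> 0" using cY by simp
  then have k: "k > 0" "ln (card Y) / k \<le> \<theta>" "1 / (2 * k) \<le> \<theta>"
    using assms(3) by (auto simp: k_def divide_simps algebra_simps intro: mult_nonneg_nonneg add_pos_nonneg)
  define e where "e y x = exp (- k * ((x - y) \<bullet> (x - y)))" for x y :: 'a
  define E where "E x = (\<Sum>y\<in>Y. e y x)" for x
  define W where "W x = (\<Sum>y\<in>Y. e y x *\<^sub>R (x - y))" for x
  define S where "S x = (\<Sum>y\<in>Y. e y x * ((x - y) \<bullet> (x - y))) / E x" for x
  define v where "v x = inverse (E x) *\<^sub>R W x" for x
  \<comment> \<open>The free energy of the Gibbs weights. Its gradient is 2 v because E has gradient
    - 2 k W.\<close>
  define s where "s x = - ln (E x) / k" for x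
  have e_pos: "e y x > 0" for x y by (simp add: e_def)
  have E_pos: "E x > 0" for x unfolding E_def using Y(1) Y0 e_pos by (simp add: sum_pos)
  have de: "(e y has_derivative (\<lambda>h. (- 2 * k * e y x) *\<^sub>R (x - y) \<bullet> h)) (at x)" for x y
    unfolding e_def by (auto intro!: derivative_eq_intros ext simp: algebra_simps inner_commute)
  have C1e: "C1 (e y)" for y
    by (rule C1I[OF de]) (auto simp: e_def intro!: continuous_intros)
  have dE: "(E has_derivative (\<lambda>h. (- 2 * k) *\<^sub>R W x \<bullet> h)) (at x)" for x
  proof -
    have "(E has_derivative (\<lambda>h. \<Sum>y\<in>Y. (- 2 * k * e y x) *\<^sub>R (x - y) \<bullet> h)) (at x)"
      unfolding E_def by (intro has_derivative_sum de)
    moreover have "(\<Sum>y\<in>Y. (- 2 * k * e y x) *\<^sub>R (x - y) \<bullet> h) = (- 2 * k) *\<^sub>R W x \<bullet> h" for h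
      unfolding W_def scaleR_sum_right inner_sum_left by (auto intro!: sum.cong)
    ultimately show ?thesis by simp
  qed
  have C1ey: "C1 (\<lambda>x. e y x *\<^sub>R (x - y))" for y by (intro C1_scaleR C1e C1_diff_const)
  have C1W: "C1 W" unfolding W_def by (intro C1_sum Y(1) C1ey)
  have C1E: "C1 E" unfolding E_def by (intro C1_sum Y(1) C1e)
  have cW: "continuous_on UNIV W" by (rule C1_continuous[OF C1W])
  have cE: "continuous_on UNIV E" by (rule C1_continuous[OF C1E])
  have dinv: "((\<lambda>x. inverse (E x)) has_derivative (\<lambda>h. (2 * k / (E x)\<^sup>2) *\<^sub>R W x \<bullet> h)) (at x)" for x
    using has_derivative_compose_gradient[OF dE DERIV_inverse, of x] E_pos[of x]
    by (simp add: power2_eq_square divide_inverse mult_ac)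
  have C1inv: "C1 (\<lambda>x. inverse (E x))"
    by (rule C1I[OF dinv]) (use E_pos in \<open>auto intro!: continuous_intros cW cE simp: less_imp_neq[symmetric]\<close>)
  have C1v: "C1 v" unfolding v_def by (rule C1_scaleR[OF C1inv C1W])
  have divW: "divergence W x = (\<Sum>y\<in>Y. e y x * DIM('a) - 2 * k * e y x * ((x - y) \<bullet> (x - y)))" for x
    unfolding W_def divergence_sum[OF Y(1) C1ey]
    by (intro sum.cong refl) (simp add: divergence_scaleR[OF de C1_has_derivative[OF C1_diff_const]] divergence_diff_const)
  have divv: "divergence v x = DIM('a) - 2 * k * (S x - (norm (v x))\<^sup>2)" for x
  proof -
    have "divergence v x = inverse (E x) * divergence W x + (2 * k / (E x)\<^sup>2) *\<^sub>R W x \<bullet> W x"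
      unfolding v_def by (rule divergence_scaleR[OF dinv C1_has_derivative[OF C1W]])
    moreover have "(norm (v x))\<^sup>2 = (W x \<bullet> W x) / (E x)\<^sup>2"
      by (simp add: v_def power_mult_distrib power2_norm_eq_inner field_simps)
    moreover have "divergence W x = E x * DIM('a) - 2 * k * (S x * E x)"
    proof -
      have "S x * E x = (\<Sum>y\<in>Y. e y x * ((x - y) \<bullet> (x - y)))" using E_pos[of x] by (simp add: S_def)
      then show ?thesis
        by (simp add: divW E_def sum_subtractf sum_distrib_left sum_distrib_right mult.assoc)
    qed
    ultimately have "divergence v x = inverse (E x) * (E x * DIM('a) - 2 * k * (S x * E x)) + 2 * k * (norm (v x))\<^sup>2"
      by simp
    moreover have "inverse (E x) * (E x * DIM('a) - 2 * k * (S x * E x)) = DIM('a) - 2 * k * S x"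
      using E_pos[of x] by (simp add: field_simps)
    ultimately show ?thesis by (simp add: algebra_simps)
  qed
  \<comment> \<open>The variance of x - y under the Gibbs weights is nonnegative.\<close>
  have var: "(norm (v x))\<^sup>2 \<le> S x" for x
  proof -
    have "0 \<le> (\<Sum>y\<in>Y. e y x * ((x - y - v x) \<bullet> (x - y - v x)))"
      by (intro sum_nonneg mult_nonneg_nonneg) (auto simp: e_def)
    also have "\<dots> = (\<Sum>y\<in>Y. e y x * ((x - y) \<bullet> (x - y)) - 2 * (v x \<bullet> (e y x *\<^sub>R (x - y))) + e y x * (v x \<bullet> v x))"
      by (intro sum.cong refl) (simp add: inner_diff_left inner_diff_right inner_commute algebra_simps)
    also have "\<dots> = (\<Sum>y\<in>Y. e y x * ((x - y) \<bullet> (x - y))) - 2 * (v x \<bullet> W x) + E x * (v x \<bullet> v x)"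
      by (simp only: sum.distrib sum_subtractf W_def inner_sum_right E_def sum_distrib_left sum_distrib_right)
    also have "\<dots> = E x * S x - E x * (v x \<bullet> v x)"
      using E_pos[of x] by (simp add: S_def v_def)
    finally show ?thesis using E_pos[of x] by (simp add: power2_norm_eq_inner)
  qed
  have dist_Y: "(infdist x A)\<^sup>2 \<le> (x - y) \<bullet> (x - y)" if "y \<in> Y" for x y
  proof -
    have "infdist x A \<le> dist x y" using that Y(2) by (auto intro: infdist_le)
    then have "(infdist x A)\<^sup>2 \<le> (dist x y)\<^sup>2" by (intro power_mono infdist_nonneg)
    then show ?thesis by (simp add: dist_norm power2_norm_eq_inner)
  qed
  have S_ge: "(infdist x A)\<^sup>2 \<le> S x" for x
  proof -
    have "(infdist x A)\<^sup>2 * E x \<le> (\<Sum>y\<in>Y. e y x * ((x - y) \<bullet> (x - y)))"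
      unfolding E_def sum_distrib_left
      by (intro sum_mono) (simp add: dist_Y e_pos mult.commute)
    then show ?thesis using E_pos[of x] by (simp add: S_def field_simps)
  qed
  have s_ge: "(infdist x A)\<^sup>2 - \<theta> \<le> s x" for x
  proof -
    have "E x \<le> (\<Sum>y\<in>Y. exp (- k * (infdist x A)\<^sup>2))"
      unfolding E_def e_def using k(1) dist_Y by (intro sum_mono) simp
    then have "E x \<le> card Y * exp (- k * (infdist x A)\<^sup>2)" by simp
    then have "ln (E x) \<le> ln (card Y * exp (- k * (infdist x A)\<^sup>2))"
      using E_pos[of x] by simp
    also have "\<dots> = ln (card Y) - k * (infdist x A)\<^sup>2"
      using cY by (simp add: ln_mult)
    finally have "ln (E x) / k \<le> (ln (card Y) - k * (infdist x A)\<^sup>2) / k" using k(1) by (intro divide_right_mono) auto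
    then have "(infdist x A)\<^sup>2 - ln (card Y) / k \<le> s x" using k(1) by (simp add: s_def diff_divide_distrib)
    then show ?thesis using k(2) by linarith
  qed
  \<comment> \<open>Here k (S - s) is the entropy of the Gibbs weights, hence at most ln (card Y).
    The proof applies 1 + z <= exp z to z = k |x - y|^2 - k S, which has mean zero.\<close>
  have S_le: "S x \<le> s x + \<theta>" for x
  proof -
    have "E x * exp (k * S x) = (\<Sum>y\<in>Y. e y x * exp (k * S x) * (1 + (k * ((x - y) \<bullet> (x - y)) - k * S x)))"
    proof -
      have "(\<Sum>y\<in>Y. e y x * (k * ((x - y) \<bullet> (x - y)) - k * S x)) = 0"
      proof -
        have "(\<Sum>y\<in>Y. e y x * (k * ((x - y) \<bullet> (x - y)) - k * S x))
            = (\<Sum>y\<in>Y. k * (e y x * ((x - y) \<bullet> (x - y))) - e y x * (k * S x))"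
          by (intro sum.cong refl) (simp only: right_diff_distrib mult.left_commute)
        also have "\<dots> = k * (\<Sum>y\<in>Y. e y x * ((x - y) \<bullet> (x - y))) - E x * (k * S x)"
          by (simp only: sum_subtractf sum_distrib_left sum_distrib_right E_def)
        also have "\<dots> = 0" using E_pos[of x] by (simp add: S_def)
        finally show ?thesis .
      qed
      then have "(\<Sum>y\<in>Y. e y x * (1 + (k * ((x - y) \<bullet> (x - y)) - k * S x))) = E x"
        by (simp add: distrib_left sum.distrib E_def)
      from arg_cong[OF this, of "\<lambda>z. z * exp (k * S x)"] show ?thesis
        unfolding sum_distrib_right by (simp add: mult_ac)
    qed
    also have "\<dots> \<le> (\<Sum>y\<in>Y. e y x * exp (k * S x) * exp (k * ((x - y) \<bullet> (x - y)) - k * S x))"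
      by (intro sum_mono mult_left_mono exp_ge_add_one_self) (auto simp: e_def)
    also have "\<dots> = (\<Sum>y\<in>Y. 1)"
      by (intro sum.cong refl) (simp add: e_def flip: exp_add)
    finally have "ln (E x * exp (k * S x)) \<le> ln (card Y)"
      using E_pos[of x] by (intro ln_mono) auto
    then have "(ln (E x) + k * S x) / k \<le> ln (card Y) / k"
      using E_pos[of x] k(1) by (intro divide_right_mono) (auto simp: ln_mult)
    then have "S x \<le> s x + ln (card Y) / k" using k(1) by (simp add: s_def add_divide_distrib)
    then show ?thesis using k(2) by linarith
  qed
  have s_le: "s x \<le> (infdist x A + \<theta>)\<^sup>2" for x
  proof -
    obtain a where a: "a \<in> A" "infdist x A = dist x a"
      using infdist_attains_inf[OF compact_imp_closed[OF assms(1)] assms(2)] by blast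
    obtain y where y: "y \<in> Y" "dist y a < \<theta>" using a(1) Y(3) by auto
    have "dist x y \<le> infdist x A + \<theta>"
      using dist_triangle[of x y a] y(2) a(2) by (simp add: dist_commute)
    then have "(dist x y)\<^sup>2 \<le> (infdist x A + \<theta>)\<^sup>2" by (intro power_mono) auto
    moreover have "s x \<le> (dist x y)\<^sup>2"
    proof -
      have "e y x \<le> E x" unfolding E_def using Y(1) y(1) e_pos
        by (intro member_le_sum) (auto intro: less_imp_le)
      then have "ln (e y x) \<le> ln (E x)" using e_pos E_pos by (simp add: ln_mono)
      then have "- k * (dist x y)\<^sup>2 / k \<le> ln (E x) / k"
        using k(1) by (intro divide_right_mono) (auto simp: e_def dist_norm power2_norm_eq_inner)
      then show ?thesis using k(1) by (simp add: s_def)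
    qed
    ultimately show ?thesis by linarith
  qed
  show ?thesis
  proof
    show "(s has_derivative (\<lambda>h. 2 * (v x \<bullet> h))) (at x)" for x
    proof -
      have "((\<lambda>t. - ln t / k) has_real_derivative - inverse (E x) / k) (at (E x))"
        using E_pos[of x] k(1) by (auto intro!: derivative_eq_intros simp: divide_inverse)
      from has_derivative_compose_gradient[OF dE this] show ?thesis
        using k(1) by (simp add: s_def[abs_def] v_def mult_ac)
    qed
    show "C1 v" by (rule C1v)
    show "divergence v x \<le> DIM('a)" for x using var[of x] k(1) by (simp add: divv)
    show "(infdist x A)\<^sup>2 - \<theta> \<le> s x" for x by (rule s_ge)
    show "(norm (v x))\<^sup>2 \<le> s x + \<theta>" for x using var[of x] S_le[of x] by linarith
    show "s x \<le> (infdist x A + \<theta>)\<^sup>2" for x by (rule s_le)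
    show "(infdist x A)\<^sup>2 - (norm (v x))\<^sup>2 \<le> \<theta> * (DIM('a) - divergence v x)" for x
    proof -
      \<comment> \<open>The mean S of squared distances to points of A dominates the squared
        distance, so the defect is at most the variance, which is (d - div v) / (2 k).\<close>
      have "(infdist x A)\<^sup>2 - (norm (v x))\<^sup>2 \<le> 1 * (S x - (norm (v x))\<^sup>2)" using S_ge[of x] by simp
      also have "\<dots> \<le> (\<theta> * (2 * k)) * (S x - (norm (v x))\<^sup>2)"
        using k var[of x] by (intro mult_right_mono) (auto simp: field_simps)
      finally show ?thesis by (simp add: divv)
    qed
  qed
qed

text \<open>D = sqrt (s + 2 \<theta>). The shift makes D positive, since s >= - \<theta>, and gives
  |V| <= D, since |v|^2 <= s + \<theta>. The gradient of D is V / D, close to a unit vector where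
  the defect is small.\<close>

lemma smooth_dist:
  fixes A :: "'a::euclidean_space set"
  assumes "compact A" "A \<noteq> {}" "\<tau> > 0"
  obtains D :: "'a \<Rightarrow> real" and V :: "'a \<Rightarrow> 'a" where
    "\<And>x. D x > 0"
    "\<And>x. (D has_derivative (\<lambda>h. ((1 / D x) *\<^sub>R V x) \<bullet> h)) (at x)"
    "C1 V"
    "\<And>x. divergence V x \<le> DIM('a)"
    "\<And>x. norm (V x) \<le> D x"
    "\<And>x. infdist x A \<le> D x"
    "\<And>x. D x \<le> infdist x A + \<tau>"
    "\<And>x. (infdist x A)\<^sup>2 - (norm (V x))\<^sup>2 \<le> \<tau> * (DIM('a) - divergence V x)"
proof -
  \<comment> \<open>The bound \<tau> / 2 absorbs the error of the net, and \<tau>^2 / 8 makes the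
    shift 2 \<theta> at most (\<tau> / 2)^2.\<close>
  define \<theta> where "\<theta> = min (\<tau> / 2) (\<tau>\<^sup>2 / 8)"
  have \<theta>: "\<theta> > 0" "2 * \<theta> \<le> \<tau>" "8 * \<theta> \<le> \<tau>\<^sup>2" using assms(3) by (auto simp: \<theta>_def)
  obtain s v where sv: "\<And>x. (s has_derivative (\<lambda>h. 2 * (v x \<bullet> h))) (at x)"
    "C1 v"
    "\<And>x. divergence v x \<le> DIM('a)"
    "\<And>x. (infdist x A)\<^sup>2 - \<theta> \<le> s x"
    "\<And>x. (norm (v x))\<^sup>2 \<le> s x + \<theta>"
    "\<And>x. s x \<le> (infdist x A + \<theta>)\<^sup>2"
    "\<And>x. (infdist x A)\<^sup>2 - (norm (v x))\<^sup>2 \<le> \<theta> * (DIM('a) - divergence v x)"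
    using softmin_sq_dist[OF assms(1,2) \<theta>(1)] by metis
  define D where "D x = sqrt (s x + 2 * \<theta>)" for x
  have pos: "s x + 2 * \<theta> > 0" for x using sv(4)[of x] \<theta>(1) zero_le_power2[of "infdist x A"] by linarith
  have Dpos: "D x > 0" for x using pos by (simp add: D_def)
  show ?thesis
  proof
    show "D x > 0" for x by (rule Dpos)
    show "(D has_derivative (\<lambda>h. ((1 / D x) *\<^sub>R v x) \<bullet> h)) (at x)" for x
    proof -
      have "((\<lambda>t. sqrt (t + 2 * \<theta>)) has_real_derivative inverse (D x) / 2) (at (s x))"
        unfolding D_def using pos[of x] DERIV_shift[of sqrt _ "s x" "2 * \<theta>"] DERIV_real_sqrt[OF pos[of x]] by simp
      note sqrt = this
      have "(s has_derivative (\<lambda>h. (2 *\<^sub>R v x) \<bullet> h)) (at x)"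
        using sv(1)[of x] by (simp only: inner_scaleR_left)
      from has_derivative_compose_gradient[OF this sqrt] have "(D has_derivative (\<lambda>h. ((inverse (D x) / 2) *\<^sub>R (2 *\<^sub>R v x)) \<bullet> h)) (at x)"
        unfolding D_def[abs_def] .
      then show ?thesis by (simp only: scaleR_scaleR) (simp add: inverse_eq_divide)
    qed
    show "C1 v" by (rule sv)
    show "divergence v x \<le> DIM('a)" for x by (rule sv)
    show "norm (v x) \<le> D x" for x
      unfolding D_def using sv(5)[of x] \<theta>(1) by (intro real_le_rsqrt) simp
    show "infdist x A \<le> D x" for x
      unfolding D_def using sv(4)[of x] \<theta>(1) by (intro real_le_rsqrt) simp
    show "D x \<le> infdist x A + \<tau>" for x
    proof -
      have "s x + 2 * \<theta> \<le> (infdist x A + \<theta>)\<^sup>2 + \<tau>\<^sup>2 / 4" using sv(6)[of x] \<theta> by linarith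
      also have "\<dots> \<le> (infdist x A + \<tau> / 2)\<^sup>2 + (\<tau> / 2)\<^sup>2"
        using \<theta> by (intro add_mono power_mono) (auto simp: power2_eq_square infdist_nonneg)
      also have "\<dots> \<le> (infdist x A + \<tau>)\<^sup>2"
        using assms(3) infdist_nonneg[of x A] by (simp add: power2_eq_square algebra_simps)
      finally show ?thesis unfolding D_def using assms(3) infdist_nonneg[of x A] by (intro real_le_lsqrt) auto
    qed
    show "(infdist x A)\<^sup>2 - (norm (v x))\<^sup>2 \<le> \<tau> * (DIM('a) - divergence v x)" for x
    proof -
      have "\<theta> * (DIM('a) - divergence v x) \<le> \<tau> * (DIM('a) - divergence v x)"
        using \<theta> sv(3)[of x] by (intro mult_right_mono) auto
      then show ?thesis using sv(7)[of x] by linarith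
    qed
  qed
qed

section \<open>Cutoff functions\<close>

text \<open>Minus a primitive of w, normalised to vanish far to the right. It is written with an
  indicator of the upper half-line so that at t = \<open>infdist x A\<close> the indicator becomes
  membership of x in \<open>parallel_set A s\<close>.\<close>

definition tail_integral :: "(real \<Rightarrow> real) \<Rightarrow> real \<Rightarrow> real" where
  "tail_integral w t = (LINT s|lborel. w s * indicator {t..} s)"

context
  fixes w :: "real \<Rightarrow> real" and a b :: real
  assumes w: "continuous_on UNIV w" and ab: "a < b" and w0: "\<And>t. t \<notin> {a<..<b} \<Longrightarrow> w t = 0"
begin

lemma tail_integral_antiderivative:
  obtains F where "\<And>t. (F has_real_derivative w t) (at t)" "\<And>t. tail_integral w t = F b - F t"
proof -
  have "\<exists>F. \<forall>x :: real. -\<infinity> < ereal x \<longrightarrow> ereal x < \<infinity> \<longrightarrow> (F has_vector_derivative w x) (at x)"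
    by (rule einterval_antiderivative) (use w in \<open>auto simp: continuous_on_eq_continuous_at\<close>)
  then obtain F where F: "\<And>t. (F has_real_derivative w t) (at t)"
    by (auto simp: has_real_derivative_iff_has_vector_derivative)
  have FTC: "(LINT s|lborel. w s * indicator {x..y} s) = F y - F x" if "x \<le> y" for x y
    using that F w by (intro integral_FTC_Icc_real) (auto simp: continuous_on_eq_continuous_at)
  have "tail_integral w t = F b - F t" for t
  proof (cases "t \<le> b")
    case True
    have "tail_integral w t = (LINT s|lborel. w s * indicator {t..b} s)"
      unfolding tail_integral_def using w0 by (intro Bochner_Integration.integral_cong) (auto simp: indicator_def)
    then show ?thesis using FTC[OF True] by simp
  next
    case False
    have "(\<lambda>s. w s * indicator {b..t} s) = (\<lambda>s. 0)" "(\<lambda>s. w s * indicator {t..} s) = (\<lambda>s. 0)"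
      using w0 False by (auto simp: indicator_def fun_eq_iff)
    then show ?thesis using FTC[of b t] False by (simp add: tail_integral_def)
  qed
  with F show ?thesis by (rule that)
qed

lemma DERIV_tail_integral: "(tail_integral w has_real_derivative - w t) (at t)"
proof -
  obtain F where F: "\<And>t. (F has_real_derivative w t) (at t)" "\<And>t. tail_integral w t = F b - F t"
    using tail_integral_antiderivative by metis
  have "tail_integral w = (\<lambda>t. F b - F t)" using F(2) by auto
  then show ?thesis using F(1) by (auto intro!: derivative_eq_intros)
qed

lemma continuous_tail_integral: "continuous_on UNIV (tail_integral w)"
  by (meson DERIV_tail_integral DERIV_isCont continuous_at_imp_continuous_on)

lemma tail_integral_eq_0: "t \<ge> b \<Longrightarrow> tail_integral w t = 0"
proof -
  assume "t \<ge> b"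
  then have "(\<lambda>s. w s * indicator {t..} s) = (\<lambda>s. 0)" using w0 by (auto simp: indicator_def fun_eq_iff)
  then show ?thesis by (simp add: tail_integral_def)
qed

lemma tail_integral_eq_integral: "t \<le> a \<Longrightarrow> tail_integral w t = (LINT s|lborel. w s)"
proof -
  assume "t \<le> a"
  then have "(\<lambda>s. w s * indicator {t..} s) = w" using w0 by (auto simp: indicator_def fun_eq_iff)
  then show ?thesis by (simp add: tail_integral_def)
qed

lemma integrable_bump: "integrable lborel w"
proof (rule integrable_continuous_bounded_support[OF w])
  have "{t. w t \<noteq> 0} \<subseteq> {a<..<b}" using w0 by blast
  then show "bounded {t. w t \<noteq> 0}" using bounded_subset[OF bounded_closed_interval[of a b]] by (meson greaterThanLessThan_subseteq_atLeastAtMost_iff order_refl order_trans)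
qed

lemma tail_integral_bounds:
  assumes "\<And>t. w t \<ge> 0"
  shows "0 \<le> tail_integral w t" "tail_integral w t \<le> (LINT s|lborel. w s)"
proof -
  show "0 \<le> tail_integral w t" using assms by (simp add: tail_integral_def)
  have "integrable lborel (\<lambda>s. indicator {t..} s *\<^sub>R w s)"
    by (intro integrable_mult_indicator integrable_bump) simp
  then have "integrable lborel (\<lambda>s. w s * indicator {t..} s)" by (simp add: mult.commute)
  then show "tail_integral w t \<le> (LINT s|lborel. w s)"
    unfolding tail_integral_def using assms
    by (intro integral_mono integrable_bump) (auto simp: indicator_def)
qed

text \<open>A primitive of w increases strictly just to the right of t0 and decreases
  nowhere.\<close>

lemma integral_bump_pos:
  assumes "\<And>t. w t \<ge> 0" "w t0 > 0"
  shows "(LINT s|lborel. w s) > 0"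
proof -
  obtain F where F: "\<And>t. (F has_real_derivative w t) (at t)" "\<And>t. tail_integral w t = F b - F t"
    using tail_integral_antiderivative by metis
  have I: "(LINT s|lborel. w s) = F b - F a" using F(2)[of a] tail_integral_eq_integral[of a] by simp
  have mono: "F x \<le> F y" if "x \<le> y" for x y
    using that F(1) assms(1) by (intro DERIV_nonneg_imp_nondecreasing[of x y F]) auto
  have t0: "a < t0" "t0 < b" using assms(2) w0[of t0] by force+
  have "\<exists>d>0. \<forall>h>0. h < d \<longrightarrow> F t0 < F (t0 + h)"
    using DERIV_pos_inc_right[OF F(1) assms(2)] by blast
  then obtain d where d: "d > 0" "\<And>h. h > 0 \<Longrightarrow> h < d \<Longrightarrow> F t0 < F (t0 + h)" by blast
  define h where "h = min (d/2) (b - t0)"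
  have "h > 0" "h < d" "t0 + h \<le> b" using d(1) t0 by (auto simp: h_def)
  with d(2)[of h] mono[of a t0] mono[of "t0 + h" b] t0 show ?thesis by (simp add: I)
qed

end

lemma smooth_step:
  fixes a b :: real
  assumes "a < b"
  obtains \<eta> w :: "real \<Rightarrow> real" where
    "\<And>t. (\<eta> has_real_derivative - w t) (at t)" "continuous_on UNIV w" "\<And>t. w t \<ge> 0"
    "\<And>t. t \<notin> {a<..<b} \<Longrightarrow> w t = 0" "(LINT t|lborel. w t) = 1"
    "\<And>t. t \<le> a \<Longrightarrow> \<eta> t = 1" "\<And>t. t \<ge> b \<Longrightarrow> \<eta> t = 0" "\<And>t. 0 \<le> \<eta> t" "\<And>t. \<eta> t \<le> 1"
proof -
  \<comment> \<open>A tent. Continuity is enough, because only its normalised tail integral \<eta>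
    has to be C1.\<close>
  define v where "v t = max 0 (min (t - a) (b - t))" for t
  have v: "continuous_on UNIV v" "\<And>t. t \<notin> {a<..<b} \<Longrightarrow> v t = 0" "\<And>t. v t \<ge> 0"
    unfolding v_def by (auto intro!: continuous_intros)
  have "v ((a + b) / 2) > 0" using assms by (simp add: v_def field_simps)
  then have I: "(LINT t|lborel. v t) > 0" using integral_bump_pos[of v a b] v assms by blast
  define w where "w t = v t / (LINT t|lborel. v t)" for t
  have w: "continuous_on UNIV w" "\<And>t. t \<notin> {a<..<b} \<Longrightarrow> w t = 0" "\<And>t. w t \<ge> 0"
    using v I unfolding w_def by (auto intro!: continuous_intros)
  have w1: "(LINT t|lborel. w t) = 1" using I by (simp add: w_def)
  show ?thesis
    using DERIV_tail_integral[OF w(1) assms w(2)] w w1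
      tail_integral_eq_integral[OF w(1) assms w(2)] tail_integral_eq_0[OF w(1) assms w(2)]
      tail_integral_bounds[OF w(1) assms w(2) w(3)]
    by (intro that[of "tail_integral w" w]) auto
qed

section \<open>Gradient vectors and a cutoff in space\<close>

definition grad :: "('a::euclidean_space \<Rightarrow> real) \<Rightarrow> 'a \<Rightarrow> 'a" where
  "grad f x = (\<Sum>b\<in>Basis. frechet_derivative f (at x) b *\<^sub>R b)"

lemma has_derivative_grad:
  assumes "C1 f" shows "(f has_derivative (\<lambda>h. grad f x \<bullet> h)) (at x)"
proof -
  have "frechet_derivative f (at x) h = grad f x \<bullet> h" for h
  proof -
    interpret linear "frechet_derivative f (at x)"
      by (rule has_derivative_linear[OF C1_has_derivative[OF assms]])
    have "frechet_derivative f (at x) h = frechet_derivative f (at x) (\<Sum>b\<in>Basis. (h \<bullet> b) *\<^sub>R b)"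
      by (simp add: euclidean_representation)
    then show ?thesis by (simp add: grad_def sum scale inner_sum_left inner_sum_right inner_commute mult.commute)
  qed
  then have "frechet_derivative f (at x) = (\<lambda>h. grad f x \<bullet> h)" by auto
  then show ?thesis using C1_has_derivative[OF assms, of x] by simp
qed

lemma continuous_grad: "C1 f \<Longrightarrow> continuous_on UNIV (grad f)"
  unfolding grad_def[abs_def] by (intro continuous_intros C1_continuous_derivative)

lemma grad_support:
  assumes "C1c f" "{x. f x \<noteq> 0} \<subseteq> cball 0 R" "norm x > R"
  shows "grad f x = 0"
  by (simp add: grad_def C1c_derivative_support[OF assms])

lemma smooth_cutoff:
  fixes R :: real
  obtains \<xi> :: "'a::euclidean_space \<Rightarrow> real" where "C1c \<xi>" "\<And>x. 0 \<le> \<xi> x" "\<And>x. \<xi> x \<le> 1"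
    "\<And>x. norm x \<le> R \<Longrightarrow> \<xi> x = 1" "\<And>x. norm x \<ge> \<bar>R\<bar> + 1 \<Longrightarrow> \<xi> x = 0"
proof -
  have "R\<^sup>2 < (\<bar>R\<bar> + 1)\<^sup>2" by (simp add: power2_eq_square algebra_simps)
  then obtain \<eta> w :: "real \<Rightarrow> real" where \<eta>: 
    "\<And>t. (\<eta> has_real_derivative - w t) (at t)" "continuous_on UNIV w" "\<And>t. w t \<ge> 0"
    "\<And>t. t \<notin> {R\<^sup>2<..<(\<bar>R\<bar> + 1)\<^sup>2} \<Longrightarrow> w t = 0" "(LINT t|lborel. w t) = 1"
    "\<And>t. t \<le> R\<^sup>2 \<Longrightarrow> \<eta> t = 1" "\<And>t. t \<ge> (\<bar>R\<bar> + 1)\<^sup>2 \<Longrightarrow> \<eta> t = 0" "\<And>t. 0 \<le> \<eta> t" "\<And>t. \<eta> t \<le> 1"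
    by (rule smooth_step) blast
  \<comment> \<open>Composing with |x|^2 instead of |x| keeps the cutoff differentiable at the
    origin.\<close>
  define \<xi> :: "'a \<Rightarrow> real" where "\<xi> x = \<eta> (x \<bullet> x)" for x
  have "C1 (\<lambda>x::'a. x \<bullet> x)"
    by (intro C1_inner C1_bounded_linear bounded_linear_ident)
  then have C1: "C1 \<xi>" unfolding \<xi>_def
    by (rule C1_compose_real[OF _ \<eta>(1)]) (intro continuous_intros continuous_on_subset[OF \<eta>(2)], auto)
  have zero: "\<xi> x = 0" if "norm x \<ge> \<bar>R\<bar> + 1" for x
  proof -
    have "(norm x)\<^sup>2 \<ge> (\<bar>R\<bar> + 1)\<^sup>2" using that by (intro power_mono) auto
    then show ?thesis unfolding \<xi>_def by (intro \<eta>(7)) (simp add: power2_norm_eq_inner)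
  qed
  have one: "\<xi> x = 1" if "norm x \<le> R" for x
  proof -
    have "(norm x)\<^sup>2 \<le> R\<^sup>2" using that by (intro power_mono) auto
    then show ?thesis unfolding \<xi>_def by (intro \<eta>(6)) (simp add: power2_norm_eq_inner)
  qed
  have "{x. \<xi> x \<noteq> 0} \<subseteq> cball 0 (\<bar>R\<bar> + 1)" using zero by force
  then have "bounded {x. \<xi> x \<noteq> 0}" by (meson bounded_cball bounded_subset)
  with C1 have "C1c \<xi>" by (simp add: C1c_iff)
  then show ?thesis using zero one \<eta>(8,9) by (intro that[of \<xi>]) (auto simp: \<xi>_def)
qed

section \<open>Level sets of the distance function\<close>

lemma divergence_diff:
  assumes "C1 f" "C1 g"
  shows "divergence (\<lambda>x. f x - g x) x = divergence f x - divergence g x"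
proof -
  have "frechet_derivative (\<lambda>x. f x - g x) (at x) = (\<lambda>h. frechet_derivative f (at x) h - frechet_derivative g (at x) h)"
    using frechet_derivative_at[OF has_derivative_diff[OF C1_has_derivative[OF assms(1)] C1_has_derivative[OF assms(2)]]]
    by metis
  then show ?thesis by (simp add: divergence_def inner_diff_left sum_subtractf)
qed

lemma infdist_le_norm: "infdist x A \<le> norm x + infdist 0 A"
  using infdist_triangle[of x A 0] by simp

text \<open>The interface to the soft minimum. \<open>defect\<close> stands in for the identity
  |grad \<delta>| = 1: its error term is nonnegative by \<open>div_V\<close> and is controlled in
  the mean, not pointwise.\<close>

locale smooth_dist_approx =
  fixes A :: "'a::euclidean_space set" and D :: "nat \<Rightarrow> 'a \<Rightarrow> real" and V :: "nat \<Rightarrow> 'a \<Rightarrow> 'a"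
    and \<tau> :: "nat \<Rightarrow> real"
  assumes A: "compact A" "A \<noteq> {}"
    and \<tau>: "\<And>n. \<tau> n > 0" "\<And>n. \<tau> n \<le> 1" "\<tau> \<longlonglongrightarrow> 0"
    and D_pos: "\<And>n x. D n x > 0"
    and D_deriv: "\<And>n x. (D n has_derivative (\<lambda>h. ((1 / D n x) *\<^sub>R V n x) \<bullet> h)) (at x)"
    and C1_V: "\<And>n. C1 (V n)"
    and div_V: "\<And>n x. divergence (V n) x \<le> DIM('a)"
    and norm_V: "\<And>n x. norm (V n x) \<le> D n x"
    and D_ge: "\<And>n x. infdist x A \<le> D n x"
    and D_le: "\<And>n x. D n x \<le> infdist x A + \<tau> n"
    and defect: "\<And>n x. (infdist x A)\<^sup>2 - (norm (V n x))\<^sup>2 \<le> \<tau> n * (DIM('a) - divergence (V n) x)"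
begin

lemma D_cont: "continuous_on UNIV (D n)"
  by (meson D_deriv continuous_at_imp_continuous_on has_derivative_continuous)

lemma V_cont: "continuous_on UNIV (V n)"
  by (rule C1_continuous[OF C1_V])

lemma C1_D: "C1 (D n)"
  by (rule C1I[OF D_deriv]) (use D_pos in \<open>auto intro!: continuous_intros D_cont V_cont simp: less_imp_neq[symmetric]\<close>)

lemma D_tendsto: "(\<lambda>n. D n x) \<longlonglongrightarrow> infdist x A"
proof (rule tendsto_sandwich[OF _ _ tendsto_const])
  show "\<forall>\<^sub>F n in sequentially. infdist x A \<le> D n x" using D_ge by auto
  show "\<forall>\<^sub>F n in sequentially. D n x \<le> infdist x A + \<tau> n" using D_le by auto
  show "(\<lambda>n. infdist x A + \<tau> n) \<longlonglongrightarrow> infdist x A" using tendsto_add[OF tendsto_const \<tau>(3)] by simp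
qed

text \<open>
  The bound \<open>divergence (V n) \<le> DIM('a)\<close> turns the divergence theorem into an \<open>L\<^sup>1\<close> bound for the divergence;
  testing \<open>V n - V m\<close>, half the gradient of \<open>(D n)\<^sup>2 - (D m)\<^sup>2\<close>, with that uniformly small function then shows that
  \<open>V\<close> is Cauchy in \<open>L\<^sup>2\<close>.
\<close>

lemma energy_estimates:
  fixes \<xi> :: "'a \<Rightarrow> real"
  assumes \<xi>: "C1c \<xi>" "\<And>x. 0 \<le> \<xi> x"
  obtains C where "C \<ge> 0" "\<And>n. (LINT x|lborel. \<xi> x * (DIM('a) - divergence (V n) x)) \<le> C"
    "\<And>n m. (LINT x|lborel. \<xi> x * (norm (V n x - V m x))\<^sup>2) \<le> C * (\<tau> n + \<tau> m)"
proof -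
  have C1\<xi>: "C1 \<xi>" using \<xi>(1) by (simp add: C1c_iff)
  have c\<xi>: "continuous_on UNIV \<xi>" by (rule C1_continuous[OF C1\<xi>])
  have cg: "continuous_on UNIV (grad \<xi>)" by (rule continuous_grad[OF C1\<xi>])
  have cdiv: "continuous_on UNIV (divergence (V n))" for n by (rule continuous_divergence[OF C1_V])
  obtain R where R: "R > 0" "{x. \<xi> x \<noteq> 0} \<subseteq> cball 0 R"
    using \<xi>(1) by (metis C1c_iff bounded_subset_cballD)
  have \<xi>R: "\<xi> x = 0" if "norm x > R" for x using R(2) that by force
  have gR: "grad \<xi> x = 0" if "norm x > R" for x by (rule grad_support[OF \<xi>(1) R(2) that])
  have supp: "bounded {x. \<xi> x * f x \<noteq> 0}" for f
    using \<xi>(1) by (auto simp: C1c_iff intro: bounded_subset)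
  have suppg: "bounded {x. grad \<xi> x \<noteq> 0}"
    by (rule bounded_subset[of "cball 0 R"]) (use gR in \<open>auto simp: not_less[symmetric]\<close>)
  \<comment> \<open>A bound on the ball of radius R, uniform in n, for D n and hence for |V n|; the
    summand 1 covers \<open>\<tau> n\<close>.\<close>
  define M where "M = R + infdist 0 A + 1"
  have M: "M > 0" using R(1) infdist_nonneg[of 0 A] by (simp add: M_def)
  have DM: "D n x \<le> M" if "norm x \<le> R" for n x
    using D_le[of n x] \<tau>(2)[of n] infdist_le_norm[of x A] that by (simp add: M_def)
  have VM: "norm (V n x) \<le> M" if "norm x \<le> R" for n x
    using norm_V[of n x] DM[OF that, of n] by linarith
  define B where "B = (LINT x|lborel. norm (grad \<xi> x))"
  have iB: "integrable lborel (\<lambda>x. norm (grad \<xi> x))"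
    using suppg by (intro integrable_continuous_bounded_support continuous_intros cg) simp
  have B: "B \<ge> 0" by (simp add: B_def)
  have i\<xi>: "integrable lborel \<xi>"
    using \<xi>(1) by (intro integrable_continuous_bounded_support c\<xi>) (simp add: C1c_iff)
  \<comment> \<open>The divergence theorem trades the integral of \<xi> div V for that of grad \<xi>
    . V, which is at most M B in absolute value; the other summand is the constant d weighted by
    \<xi>.\<close>
  define C0 where "C0 = DIM('a) * (LINT x|lborel. \<xi> x) + M * B"
  have C0_0: "C0 \<ge> 0" using M B \<xi>(2) by (simp add: C0_def)
  have idiv: "integrable lborel (\<lambda>x. \<xi> x * (DIM('a) - divergence (V n) x))" for n
    by (intro integrable_continuous_bounded_support continuous_intros c\<xi> cdiv supp)
  have est1: "(LINT x|lborel. \<xi> x * (DIM('a) - divergence (V n) x)) \<le> C0" for n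
  proof -
    have "C1c (\<lambda>x. \<xi> x *\<^sub>R V n x)" by (rule C1c_scaleR[OF \<xi>(1) C1_V])
    from integral_divergence_eq_0[OF this]
    have 0: "(LINT x|lborel. \<xi> x * divergence (V n) x + grad \<xi> x \<bullet> V n x) = 0"
      by (simp add: divergence_scaleR[OF has_derivative_grad[OF C1\<xi>] C1_has_derivative[OF C1_V]])
    have ig: "integrable lborel (\<lambda>x. grad \<xi> x \<bullet> V n x)"
      using suppg by (intro integrable_continuous_bounded_support continuous_intros cg V_cont)
        (auto intro: bounded_subset[of "{x. grad \<xi> x \<noteq> 0}"])
    have id: "integrable lborel (\<lambda>x. \<xi> x * divergence (V n) x)"
      by (intro integrable_continuous_bounded_support continuous_intros c\<xi> cdiv supp)
    have "(LINT x|lborel. \<xi> x * (DIM('a) - divergence (V n) x))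
        = (LINT x|lborel. DIM('a) * \<xi> x - \<xi> x * divergence (V n) x)"
      by (simp add: algebra_simps)
    also have "\<dots> = DIM('a) * (LINT x|lborel. \<xi> x) - (LINT x|lborel. \<xi> x * divergence (V n) x)"
      using i\<xi> id by simp
    also have "\<dots> = DIM('a) * (LINT x|lborel. \<xi> x) + (LINT x|lborel. grad \<xi> x \<bullet> V n x)"
      using 0 id ig by simp
    also have "(LINT x|lborel. grad \<xi> x \<bullet> V n x) \<le> (LINT x|lborel. M * norm (grad \<xi> x))"
    proof (intro integral_mono ig integrable_mult_right iB)
      fix x
      show "grad \<xi> x \<bullet> V n x \<le> M * norm (grad \<xi> x)"
      proof (cases "norm x \<le> R")
        case True
        have "grad \<xi> x \<bullet> V n x \<le> norm (grad \<xi> x) * norm (V n x)" by (rule norm_cauchy_schwarz)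
        also have "\<dots> \<le> norm (grad \<xi> x) * M" using VM[OF True] by (intro mult_left_mono) auto
        finally show ?thesis by (simp add: mult.commute)
      next
        case False then show ?thesis using gR[of x] by simp
      qed
    qed
    finally show ?thesis by (simp add: C0_def B_def)
  qed
  have est2: "(LINT x|lborel. \<xi> x * (norm (V n x - V m x))\<^sup>2) \<le> (\<tau> n + \<tau> m) * M * (2 * C0 + 2 * M * B)" for n m
  proof -
    define Z where "Z x = V n x - V m x" for x
    have C1Z: "C1 Z" unfolding Z_def by (intro C1_diff C1_V)
    have cZ: "continuous_on UNIV Z" by (rule C1_continuous[OF C1Z])
    define H where "H x = ((D n x)\<^sup>2 - (D m x)\<^sup>2) / 2" for x
    have dD2: "((\<lambda>x. (D n x)\<^sup>2) has_derivative (\<lambda>h. (2 *\<^sub>R V n x) \<bullet> h)) (at x)" for n x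
    proof -
      have "((\<lambda>t. t\<^sup>2) has_real_derivative 2 * D n x) (at (D n x))"
        by (auto intro!: derivative_eq_intros)
      from has_derivative_compose_gradient[OF D_deriv this] show ?thesis
        using D_pos[of n x] by simp
    qed
    have dH: "(H has_derivative (\<lambda>h. Z x \<bullet> h)) (at x)" for x
    proof -
      have "(H has_derivative (\<lambda>h. ((2 *\<^sub>R V n x) \<bullet> h - (2 *\<^sub>R V m x) \<bullet> h) / 2)) (at x)"
        unfolding H_def[abs_def] by (rule bounded_linear.has_derivative[OF bounded_linear_divide has_derivative_diff[OF dD2 dD2]])
      then show ?thesis by (simp add: Z_def inner_diff_left diff_divide_distrib)
    qed
    have C1cZ: "C1c (\<lambda>x. \<xi> x *\<^sub>R Z x)" by (rule C1c_scaleR[OF \<xi>(1) C1Z])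
    have divZ: "divergence (\<lambda>x. \<xi> x *\<^sub>R Z x) x = \<xi> x * (divergence (V n) x - divergence (V m) x) + grad \<xi> x \<bullet> Z x" for x
      unfolding divergence_scaleR[OF has_derivative_grad[OF C1\<xi>] C1_has_derivative[OF C1Z]]
      unfolding Z_def by (simp add: divergence_diff[OF C1_V C1_V])
    have cH: "continuous_on UNIV H" unfolding H_def by (intro continuous_intros D_cont) auto
    \<comment> \<open>Both D n and D m lie above the distance by at most \<tau> n and \<tau> m; the
      other factor of the difference of squares is a mean of two numbers below M.\<close>
    have HB: "\<bar>H x\<bar> \<le> (\<tau> n + \<tau> m) * M" if "norm x \<le> R" for x
    proof -
      have "\<bar>H x\<bar> = \<bar>D n x - D m x\<bar> * ((D n x + D m x) / 2)"
        using D_pos[of n x] D_pos[of m x] by (simp add: H_def power2_eq_square abs_mult square_diff_square_factored)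
      also have "\<dots> \<le> (\<tau> n + \<tau> m) * M"
        using D_le[of n x] D_le[of m x] D_ge[of x n] D_ge[of x m] DM[OF that, of n] DM[OF that, of m] \<tau>(1)[of n] \<tau>(1)[of m] D_pos[of n x] D_pos[of m x]
        by (intro mult_mono) auto
      finally show ?thesis .
    qed
    have "(LINT x|lborel. \<xi> x * (norm (Z x))\<^sup>2) = (LINT x|lborel. Z x \<bullet> (\<xi> x *\<^sub>R Z x))"
      by (simp add: power2_norm_eq_inner)
    also have "\<dots> = (LINT x|lborel. - (H x * divergence (\<lambda>x. \<xi> x *\<^sub>R Z x) x))"
      using integral_mult_divergence[OF C1cZ dH cZ] by simp
    also have "\<dots> \<le> (LINT x|lborel. ((\<tau> n + \<tau> m) * M) * (\<xi> x * (DIM('a) - divergence (V n) x)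
        + \<xi> x * (DIM('a) - divergence (V m) x) + 2 * M * norm (grad \<xi> x)))"
    proof (rule integral_mono)
      show "integrable lborel (\<lambda>x. - (H x * divergence (\<lambda>x. \<xi> x *\<^sub>R Z x) x))"
        using bounded_support_divergence[OF C1cZ] C1cZ
        by (intro integrable_continuous_bounded_support continuous_intros cH continuous_divergence)
         (auto simp: C1c_iff intro: bounded_subset)
      show "integrable lborel (\<lambda>x. ((\<tau> n + \<tau> m) * M) * (\<xi> x * (DIM('a) - divergence (V n) x)
        + \<xi> x * (DIM('a) - divergence (V m) x) + 2 * M * norm (grad \<xi> x)))"
        by (intro integrable_mult_right Bochner_Integration.integrable_add idiv iB)
      fix x
      show "- (H x * divergence (\<lambda>x. \<xi> x *\<^sub>R Z x) x) \<le> ((\<tau> n + \<tau> m) * M) * (\<xi> x * (DIM('a) - divergence (V n) x)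
        + \<xi> x * (DIM('a) - divergence (V m) x) + 2 * M * norm (grad \<xi> x))"
      proof (cases "norm x \<le> R")
        case True
        have "\<bar>divergence (\<lambda>x. \<xi> x *\<^sub>R Z x) x\<bar> \<le> \<xi> x * (DIM('a) - divergence (V n) x)
        + \<xi> x * (DIM('a) - divergence (V m) x) + 2 * M * norm (grad \<xi> x)" (is "_ \<le> ?r")
        proof -
          have "\<bar>grad \<xi> x \<bullet> Z x\<bar> \<le> norm (grad \<xi> x) * norm (Z x)" by (rule Cauchy_Schwarz_ineq2)
          also have "\<dots> \<le> norm (grad \<xi> x) * (2 * M)"
            unfolding Z_def using norm_triangle_ineq4[of "V n x" "V m x"] VM[OF True, of n] VM[OF True, of m]
            by (intro mult_left_mono) auto
          finally have 1: "\<bar>grad \<xi> x \<bullet> Z x\<bar> \<le> 2 * M * norm (grad \<xi> x)" by (simp add: mult_ac)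
          \<comment> \<open>Both divergences are at most d, so |p - q| <= (d - p) + (d - q). The
            absolute value is thus controlled by the one-sided quantities of
            \<open>est1\<close>.\<close>
          have "\<bar>\<xi> x * (divergence (V n) x - divergence (V m) x)\<bar>
              \<le> \<xi> x * ((DIM('a) - divergence (V n) x) + (DIM('a) - divergence (V m) x))"
            using \<xi>(2)[of x] div_V[of n x] div_V[of m x] by (simp add: abs_mult mult_left_mono)
          then have 2: "\<bar>\<xi> x * (divergence (V n) x - divergence (V m) x)\<bar>
              \<le> \<xi> x * (DIM('a) - divergence (V n) x) + \<xi> x * (DIM('a) - divergence (V m) x)"
            by (simp only: distrib_left)
          show ?thesis unfolding divZ using 1 2 abs_triangle_ineq[of "\<xi> x * (divergence (V n) x - divergence (V m) x)" "grad \<xi> x \<bullet> Z x"]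
            by linarith
        qed
        then have "\<bar>H x\<bar> * \<bar>divergence (\<lambda>x. \<xi> x *\<^sub>R Z x) x\<bar> \<le> ((\<tau> n + \<tau> m) * M) * ?r"
          using HB[OF True] \<tau>(1)[of n] \<tau>(1)[of m] M by (intro mult_mono) auto
        then show ?thesis by (simp only: abs_mult[symmetric])
      next
        case False
        then have "divergence (\<lambda>x. \<xi> x *\<^sub>R Z x) x = 0" unfolding divZ by (simp add: \<xi>R gR)
        then show ?thesis using False by (simp add: \<xi>R gR)
      qed
    qed
    also have "\<dots> = (\<tau> n + \<tau> m) * M * ((LINT x|lborel. \<xi> x * (DIM('a) - divergence (V n) x))
        + (LINT x|lborel. \<xi> x * (DIM('a) - divergence (V m) x)) + 2 * M * B)"
      using idiv iB by (simp add: B_def)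
    also have "\<dots> \<le> (\<tau> n + \<tau> m) * M * (2 * C0 + 2 * M * B)"
      using est1[of n] est1[of m] \<tau>(1)[of n] \<tau>(1)[of m] M by (intro mult_left_mono) auto
    finally show ?thesis by (simp add: Z_def)
  qed
  define C where "C = max C0 (M * (2 * C0 + 2 * M * B))"
  show ?thesis
  proof (rule that[of C])
    show "C \<ge> 0" using C0_0 by (simp add: C_def)
    show "(LINT x|lborel. \<xi> x * (DIM('a) - divergence (V n) x)) \<le> C" for n
      using est1[of n] by (simp add: C_def)
    show "(LINT x|lborel. \<xi> x * (norm (V n x - V m x))\<^sup>2) \<le> C * (\<tau> n + \<tau> m)" for n m
    proof -
      have "(\<tau> n + \<tau> m) * (M * (2 * C0 + 2 * M * B)) \<le> (\<tau> n + \<tau> m) * C"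
        using \<tau>(1)[of n] \<tau>(1)[of m] by (intro mult_left_mono) (auto simp: C_def)
      then show ?thesis using est2[of n m] by (simp add: mult_ac)
    qed
  qed
qed

end

lemma bounded_infdist_le:
  fixes A :: "'a::euclidean_space set"
  assumes "bounded A" "A \<noteq> {}"
  shows "bounded {x. infdist x A \<le> b}"
proof -
  obtain R where R: "A \<subseteq> cball 0 R" using assms(1) bounded_subset_cballD by blast
  have "norm x \<le> R + \<bar>b\<bar> + 1" if x: "infdist x A \<le> b" for x
  proof -
    have "infdist x A < \<bar>b\<bar> + 1" using x by linarith
    then obtain a where a: "a \<in> A" "dist x a < \<bar>b\<bar> + 1"
      using assms(2) by (auto simp: infdist_def cINF_less_iff)
    have "norm x \<le> norm a + dist x a" by (metis dist_norm norm_triangle_sub)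
    then show ?thesis using a R by auto
  qed
  then have "{x. infdist x A \<le> b} \<subseteq> cball 0 (R + \<bar>b\<bar> + 1)" by auto
  then show ?thesis by (meson bounded_cball bounded_subset)
qed

context smooth_dist_approx
begin

lemma bounded_sublevel: "bounded {x. infdist x A \<le> b}"
  by (rule bounded_infdist_le[OF compact_imp_bounded[OF A(1)] A(2)])

definition field :: "('a \<Rightarrow> real) \<Rightarrow> nat \<Rightarrow> 'a \<Rightarrow> 'a" where
  "field \<xi> n x = (\<xi> x / D n x) *\<^sub>R V n x"

lemma C1c_field: "C1c \<xi> \<Longrightarrow> C1c (field \<xi> n)"
proof -
  assume \<xi>: "C1c \<xi>"
  have "C1 (\<lambda>x. inverse (D n x))"
  proof (rule C1_compose_real[OF C1_D, of inverse "\<lambda>t. - (inverse t ^ 2)"])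
    show "(inverse has_real_derivative - (inverse (D n x) ^ 2)) (at (D n x))" for x
      using DERIV_inverse[of "D n x"] D_pos[of n x] by (simp add: numeral_2_eq_2)
    show "continuous_on (range (D n)) (\<lambda>t. - (inverse t ^ 2))"
      using D_pos[of n] by (intro continuous_intros) (metis imageE less_irrefl)
  qed
  from C1c_scaleR[OF C1c_mult[OF \<xi> this] C1_V, of n] show ?thesis
    by (simp add: field_def[abs_def] divide_inverse)
qed

lemma norm_field_le: 
  assumes "0 \<le> \<xi> x" "\<xi> x \<le> 1" shows "norm (field \<xi> n x) \<le> 1"
proof -
  have "norm (field \<xi> n x) = \<xi> x * (norm (V n x) / D n x)"
    using assms D_pos[of n x] by (simp add: field_def)
  also have "\<dots> \<le> 1 * 1"
    using assms D_pos[of n x] norm_V[of n x] by (intro mult_mono) auto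
  finally show ?thesis by simp
qed

text \<open>This inequality takes the place of the coarea formula.\<close>

lemma integral_shell_le_flux:
  fixes \<xi> :: "'a \<Rightarrow> real"
  assumes \<xi>: "C1c \<xi>" "\<And>x. 0 \<le> \<xi> x" "\<And>x. \<xi> x \<le> 1" and ab: "0 < a" "a < b"
    and \<xi>1: "\<And>x. infdist x A \<le> b \<Longrightarrow> \<xi> x = 1"
  obtains C where "C \<ge> 0"
    "\<And>n w W. continuous_on UNIV w \<Longrightarrow> (\<And>t. t \<notin> {a<..<b} \<Longrightarrow> w t = 0) \<Longrightarrow> (\<And>t. 0 \<le> w t) \<Longrightarrow> (\<And>t. w t \<le> W) \<Longrightarrow>
      (LINT x|lborel. w (infdist x A)) \<le> (LINT x|lborel. tail_integral w (infdist x A) * divergence (field \<xi> n) x) + C * \<tau> n * W"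
proof -
  obtain C where C: "C \<ge> 0" "\<And>n. (LINT x|lborel. \<xi> x * (DIM('a) - divergence (V n) x)) \<le> C"
    "\<And>n m. (LINT x|lborel. \<xi> x * (norm (V n x - V m x))\<^sup>2) \<le> C * (\<tau> n + \<tau> m)"
    by (rule energy_estimates[OF \<xi>(1,2)]) blast
  have C1\<xi>: "C1 \<xi>" using \<xi>(1) by (simp add: C1c_iff)
  have c\<xi>: "continuous_on UNIV \<xi>" by (rule C1_continuous[OF C1\<xi>])
  have supp: "bounded {x. \<xi> x * f x \<noteq> 0}" for f
    using \<xi>(1) by (auto simp: C1c_iff intro: bounded_subset)
  have i\<xi>: "integrable lborel \<xi>"
    using \<xi>(1) by (intro integrable_continuous_bounded_support c\<xi>) (simp add: C1c_iff)
  \<comment> \<open>The first part collects the defects and |V n - V m|^2, divided by a^2; the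
    second pays for replacing D n by the distance in a denominator.\<close>
  define C' where "C' = 2 * C / a\<^sup>2 + (LINT x|lborel. \<xi> x) / a"
  have I\<xi>: "(LINT x|lborel. \<xi> x) \<ge> 0" using \<xi>(2) by simp
  have "C' \<ge> 0" using C(1) ab I\<xi> by (simp add: C'_def)
  moreover have "(LINT x|lborel. w (infdist x A)) \<le> (LINT x|lborel. tail_integral w (infdist x A) * divergence (field \<xi> n) x) + C' * \<tau> n * W"
    if w: "continuous_on UNIV w" "\<And>t. t \<notin> {a<..<b} \<Longrightarrow> w t = 0" "\<And>t. 0 \<le> w t" "\<And>t. w t \<le> W" for n w W
  proof -
    have W0: "W \<ge> 0" using w(3)[of 0] w(4)[of 0] by linarith
    note T' = DERIV_tail_integral[OF w(1) ab(2) w(2)]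
    note cT = continuous_tail_integral[OF w(1) ab(2) w(2)]
    note TB = tail_integral_bounds[OF w(1) ab(2) w(2) w(3)]
    note C1cf = C1c_field[OF \<xi>(1), of n]
    have C1f: "C1 (field \<xi> n)" using C1cf by (simp add: C1c_iff)
    have cdiv: "continuous_on UNIV (divergence (field \<xi> n))" by (rule continuous_divergence[OF C1f])
    have idiv: "integrable lborel (divergence (field \<xi> n))"
      by (rule integrable_continuous_bounded_support[OF cdiv bounded_support_divergence[OF C1cf]])
    have cwD: "continuous_on UNIV (\<lambda>x. w (D m x))" for m
      by (rule continuous_on_compose2[OF w(1) D_cont]) auto
    have cTD: "continuous_on UNIV (\<lambda>x. tail_integral w (D m x))" for m
      by (rule continuous_on_compose2[OF cT D_cont]) auto
    have cdist: "continuous_on UNIV (\<lambda>x::'a. infdist x A)" by (intro continuous_intros)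
    have cwd: "continuous_on UNIV (\<lambda>x::'a. w (infdist x A))"
      by (rule continuous_on_compose2[OF w(1) cdist]) auto
    have cTd: "continuous_on UNIV (\<lambda>x::'a. tail_integral w (infdist x A))"
      by (rule continuous_on_compose2[OF cT cdist]) auto
    have Dne: "D m x \<noteq> 0" for m x using D_pos[of m x] by simp
    \<comment> \<open>Integrating by parts against \<open>tail_integral w (D m x)\<close>, the
      smooth stand-in for its value at the distance, turns the flux into an integral of V n . V m
      with this density.\<close>
    define q where "q m x = \<xi> x * w (D m x) / (D n x * D m x)" for m x
    have q0: "q m x \<ge> 0" for m x using \<xi>(2) w(3) D_pos[of n x] D_pos[of m x] by (simp add: q_def)
    have cq: "continuous_on UNIV (q m)" for m
      unfolding q_def by (intro continuous_intros c\<xi> cwD D_cont) (simp add: Dne)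
    have qsupp: "bounded {x. q m x * f x \<noteq> 0}" for m f
      by (rule bounded_subset[OF supp[of "\<lambda>_. 1"]]) (auto simp: q_def)
    define Q where "Q m x = \<xi> x * (\<tau> n * (DIM('a) - divergence (V n) x) + \<tau> m * (DIM('a) - divergence (V m) x) + (norm (V n x - V m x))\<^sup>2)" for m x
    have flux: "(LINT x|lborel. tail_integral w (D m x) * divergence (field \<xi> n) x) = (LINT x|lborel. q m x * (V n x \<bullet> V m x))" for m
    proof -
      have d: "((\<lambda>x. tail_integral w (D m x)) has_derivative (\<lambda>h. ((- w (D m x)) *\<^sub>R ((1 / D m x) *\<^sub>R V m x)) \<bullet> h)) (at x)" for x
        by (rule has_derivative_compose_gradient[OF D_deriv T'])
      have "(LINT x|lborel. tail_integral w (D m x) * divergence (field \<xi> n) x)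
          = - (LINT x|lborel. ((- w (D m x)) *\<^sub>R ((1 / D m x) *\<^sub>R V m x)) \<bullet> field \<xi> n x)"
        by (rule integral_mult_divergence[OF C1cf d]) (intro continuous_intros cwD D_cont V_cont, simp add: Dne)
      also have "\<dots> = (LINT x|lborel. q m x * (V n x \<bullet> V m x))"
        by (simp add: q_def field_def inner_commute mult_ac flip: integral_minus)
      finally show ?thesis .
    qed
    have ptw: "q m x * (V n x \<bullet> V m x) \<ge> q m x * (infdist x A)\<^sup>2 - (W / a\<^sup>2) * Q m x" if m: "\<tau> m \<le> a / 2" for m x
    proof -
      have Q': "0 \<le> \<tau> n * (DIM('a) - divergence (V n) x) + \<tau> m * (DIM('a) - divergence (V m) x) + (norm (V n x - V m x))\<^sup>2" (is "0 \<le> ?Q")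
        using div_V[of n x] div_V[of m x] \<tau>(1)[of n] \<tau>(1)[of m] by simp
      \<comment> \<open>Polarisation: the two defects bound the squared norms from below, and |V n -
        V m|^2 is the third term of Q.\<close>
      have VV_eq: "V n x \<bullet> V m x = ((norm (V n x))\<^sup>2 + (norm (V m x))\<^sup>2 - (norm (V n x - V m x))\<^sup>2) / 2"
        by (simp add: power2_norm_eq_inner inner_diff_left inner_diff_right inner_commute)
      have VV: "V n x \<bullet> V m x \<ge> (infdist x A)\<^sup>2 - ?Q / 2"
      proof -
        have "d - (p + r + z) / 2 \<le> (s + t - z) / 2" if "d - s \<le> p" "d - t \<le> r" for d p r s t z :: real
          using that by (simp add: field_simps)
        from this[OF defect defect] show ?thesis
          unfolding VV_eq .
      qed
      \<comment> \<open>Where w (D m x) is nonzero, D m > a; hence \<delta> >= a - \<tau> m >= a /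
        2, and D n >= a / 2 as well.\<close>
      have qle: "q m x \<le> 2 * W / a\<^sup>2 * \<xi> x"
      proof (cases "D m x \<in> {a<..<b}")
        case True
        have "D m x * D n x \<ge> a * (a / 2)"
          using True D_le[of m x] D_ge[of x n] m ab(1) by (intro mult_mono) auto
        then have "a\<^sup>2 / 2 \<le> D n x * D m x" by (simp add: power2_eq_square mult.commute)
        then have "\<xi> x * w (D m x) / (D n x * D m x) \<le> \<xi> x * W / (a\<^sup>2 / 2)"
          using \<xi>(2)[of x] w(3,4) ab(1) W0 by (intro frac_le mult_left_mono mult_nonneg_nonneg) auto
        then show ?thesis by (simp add: q_def mult_ac)
      next
        case False
        then show ?thesis using w(2) W0 \<xi>(2)[of x] by (simp add: q_def)
      qed
      have "q m x * (?Q / 2) \<le> 2 * W / a\<^sup>2 * \<xi> x * (?Q / 2)"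
        using qle Q' by (intro mult_right_mono) auto
      also have "\<dots> = (W / a\<^sup>2) * Q m x" by (simp add: Q_def)
      finally have "q m x * (?Q / 2) \<le> (W / a\<^sup>2) * Q m x" .
      moreover have "q m x * (V n x \<bullet> V m x) \<ge> q m x * ((infdist x A)\<^sup>2 - ?Q / 2)"
        using VV q0 by (intro mult_left_mono)
      ultimately show ?thesis by (simp add: right_diff_distrib)
    qed
    have iQ: "integrable lborel (Q m)" and Qle: "(LINT x|lborel. Q m x) \<le> 2 * C * (\<tau> n + \<tau> m)" for m
    proof -
      have i1: "integrable lborel (\<lambda>x. \<xi> x * (DIM('a) - divergence (V k) x))" for k
        by (intro integrable_continuous_bounded_support continuous_intros c\<xi> continuous_divergence C1_V supp)
      have i2: "integrable lborel (\<lambda>x. \<xi> x * (norm (V n x - V m x))\<^sup>2)"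
        by (intro integrable_continuous_bounded_support continuous_intros c\<xi> V_cont supp)
      have Qeq: "Q m = (\<lambda>x. \<tau> n * (\<xi> x * (DIM('a) - divergence (V n) x)) + \<tau> m * (\<xi> x * (DIM('a) - divergence (V m) x)) + \<xi> x * (norm (V n x - V m x))\<^sup>2)"
        by (auto simp: Q_def fun_eq_iff algebra_simps)
      show "integrable lborel (Q m)" unfolding Qeq
        by (intro Bochner_Integration.integrable_add integrable_mult_right i1 i2)
      have "(LINT x|lborel. Q m x) = \<tau> n * (LINT x|lborel. \<xi> x * (DIM('a) - divergence (V n) x))
        + \<tau> m * (LINT x|lborel. \<xi> x * (DIM('a) - divergence (V m) x)) + (LINT x|lborel. \<xi> x * (norm (V n x - V m x))\<^sup>2)"
        unfolding Qeq using i1[of n] i1[of m] i2 by simp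
      also have "\<dots> \<le> \<tau> n * C + \<tau> m * C + C * (\<tau> n + \<tau> m)"
        using \<tau>(1)[of n] \<tau>(1)[of m] C(2)[of n] C(2)[of m] C(3)[of n m] by (intro add_mono mult_left_mono) auto
      finally show "(LINT x|lborel. Q m x) \<le> 2 * C * (\<tau> n + \<tau> m)" by (simp add: algebra_simps)
    qed
    have ineq: "(LINT x|lborel. q m x * (infdist x A)\<^sup>2) \<le> (LINT x|lborel. tail_integral w (D m x) * divergence (field \<xi> n) x) + W / a\<^sup>2 * (2 * C * (\<tau> n + \<tau> m))"
      if m: "\<tau> m \<le> a / 2" for m
    proof -
      have iq: "integrable lborel (\<lambda>x. q m x * (infdist x A)\<^sup>2)"
        by (intro integrable_continuous_bounded_support continuous_intros cq qsupp)
      have iqV: "integrable lborel (\<lambda>x. q m x * (V n x \<bullet> V m x))"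
        by (intro integrable_continuous_bounded_support continuous_intros cq qsupp V_cont)
      have "(LINT x|lborel. q m x * (infdist x A)\<^sup>2 - (W / a\<^sup>2) * Q m x) \<le> (LINT x|lborel. q m x * (V n x \<bullet> V m x))"
        by (intro integral_mono Bochner_Integration.integrable_diff integrable_mult_right iq iQ iqV ptw[OF m])
      moreover have "(LINT x|lborel. q m x * (infdist x A)\<^sup>2 - (W / a\<^sup>2) * Q m x) = (LINT x|lborel. q m x * (infdist x A)\<^sup>2) - W / a\<^sup>2 * (LINT x|lborel. Q m x)"
        using iq iQ[of m] by simp
      moreover have "W / a\<^sup>2 * (LINT x|lborel. Q m x) \<le> W / a\<^sup>2 * (2 * C * (\<tau> n + \<tau> m))"
        using W0 Qle[of m] by (intro mult_left_mono) auto
      ultimately show ?thesis unfolding flux by linarith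
    qed
    have wlim: "(\<lambda>m. w (D m x)) \<longlonglongrightarrow> w (infdist x A)" for x
      using continuous_on_tendsto_compose[OF w(1) D_tendsto] by simp
    have Tlim: "(\<lambda>m. tail_integral w (D m x)) \<longlonglongrightarrow> tail_integral w (infdist x A)" for x
      using continuous_on_tendsto_compose[OF cT D_tendsto] by simp
    \<comment> \<open>The limit is in m alone: the competitor of index n stays fixed while D m tends
      to the distance, so the surviving error contains only \<open>\<tau> n\<close>.\<close>
    have lim1: "(\<lambda>m. LINT x|lborel. q m x * (infdist x A)\<^sup>2) \<longlonglongrightarrow> (LINT x|lborel. \<xi> x * w (infdist x A) * (infdist x A / D n x))"
    proof (rule integral_dominated_convergence[where w="\<lambda>x. W * \<xi> x"])
      show "(\<lambda>x. \<xi> x * w (infdist x A) * (infdist x A / D n x)) \<in> borel_measurable lborel"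
        by (auto intro!: borel_measurable_continuous_onI continuous_intros c\<xi> cwd D_cont simp: Dne)
      show "(\<lambda>x. q m x * (infdist x A)\<^sup>2) \<in> borel_measurable lborel" for m
        by (auto intro!: borel_measurable_continuous_onI continuous_intros cq)
      show "integrable lborel (\<lambda>x. W * \<xi> x)" using i\<xi> by simp
      show "AE x in lborel. (\<lambda>m. q m x * (infdist x A)\<^sup>2) \<longlonglongrightarrow> \<xi> x * w (infdist x A) * (infdist x A / D n x)"
      proof (rule AE_I2)
        fix x
        show "(\<lambda>m. q m x * (infdist x A)\<^sup>2) \<longlonglongrightarrow> \<xi> x * w (infdist x A) * (infdist x A / D n x)"
        proof (cases "infdist x A = 0")
          case True then show ?thesis by simp
        next
          case False
          have "(\<lambda>m. \<xi> x * w (D m x) / (D n x * D m x) * (infdist x A)\<^sup>2) \<longlonglongrightarrow> \<xi> x * w (infdist x A) / (D n x * infdist x A) * (infdist x A)\<^sup>2"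
            by (intro tendsto_intros wlim D_tendsto) (simp add: Dne False)
          then show ?thesis using False by (simp add: q_def power2_eq_square mult.assoc)
        qed
      qed
      show "AE x in lborel. norm (q m x * (infdist x A)\<^sup>2) \<le> W * \<xi> x" for m
      proof (rule AE_I2)
        fix x
        have "(infdist x A)\<^sup>2 \<le> D n x * D m x"
          unfolding power2_eq_square using D_ge[of x n] D_ge[of x m] by (intro mult_mono) (auto simp: infdist_nonneg D_pos less_imp_le)
        then have "(infdist x A)\<^sup>2 / (D n x * D m x) \<le> 1" using D_pos[of n x] D_pos[of m x] by simp
        then have "\<xi> x * w (D m x) * ((infdist x A)\<^sup>2 / (D n x * D m x)) \<le> \<xi> x * W * 1"
          using \<xi>(2)[of x] w(3,4) W0 D_pos[of n x] D_pos[of m x] by (intro mult_mono) auto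
        moreover have "norm (q m x * (infdist x A)\<^sup>2) = \<xi> x * w (D m x) * ((infdist x A)\<^sup>2 / (D n x * D m x))"
          using \<xi>(2)[of x] w(3) D_pos[of n x] D_pos[of m x] by (simp add: q_def abs_mult)
        ultimately show "norm (q m x * (infdist x A)\<^sup>2) \<le> W * \<xi> x" by (simp add: mult.commute)
      qed
    qed
    have lim2: "(\<lambda>m. LINT x|lborel. tail_integral w (D m x) * divergence (field \<xi> n) x) \<longlonglongrightarrow> (LINT x|lborel. tail_integral w (infdist x A) * divergence (field \<xi> n) x)"
    proof (rule integral_dominated_convergence[where w="\<lambda>x. (LINT s|lborel. w s) * \<bar>divergence (field \<xi> n) x\<bar>"])
      show "(\<lambda>x. tail_integral w (infdist x A) * divergence (field \<xi> n) x) \<in> borel_measurable lborel"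
        "(\<lambda>x. tail_integral w (D m x) * divergence (field \<xi> n) x) \<in> borel_measurable lborel" for m
        by (auto intro!: borel_measurable_continuous_onI continuous_intros cdiv cTD cTd)
      show "integrable lborel (\<lambda>x. (LINT s|lborel. w s) * \<bar>divergence (field \<xi> n) x\<bar>)"
        using idiv by simp
      show "AE x in lborel. (\<lambda>m. tail_integral w (D m x) * divergence (field \<xi> n) x) \<longlonglongrightarrow> tail_integral w (infdist x A) * divergence (field \<xi> n) x"
        by (intro AE_I2 tendsto_intros Tlim)
      show "AE x in lborel. norm (tail_integral w (D m x) * divergence (field \<xi> n) x) \<le> (LINT s|lborel. w s) * \<bar>divergence (field \<xi> n) x\<bar>" for m
        using TB by (intro AE_I2) (auto simp: abs_mult intro!: mult_right_mono)
    qed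
    have "(LINT x|lborel. \<xi> x * w (infdist x A) * (infdist x A / D n x)) \<le>
       (LINT x|lborel. tail_integral w (infdist x A) * divergence (field \<xi> n) x) + W / a\<^sup>2 * (2 * C * (\<tau> n + 0))"
    proof (rule LIMSEQ_le[OF lim1])
      show "(\<lambda>m. (LINT x|lborel. tail_integral w (D m x) * divergence (field \<xi> n) x) + W / a\<^sup>2 * (2 * C * (\<tau> n + \<tau> m)))
         \<longlonglongrightarrow> (LINT x|lborel. tail_integral w (infdist x A) * divergence (field \<xi> n) x) + W / a\<^sup>2 * (2 * C * (\<tau> n + 0))"
        by (intro tendsto_intros lim2 \<tau>(3))
      have "\<forall>\<^sub>F m in sequentially. \<tau> m < a / 2" by (rule order_tendstoD(2)[OF \<tau>(3)]) (use ab(1) in simp)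
      then have "\<forall>\<^sub>F m in sequentially. \<tau> m \<le> a / 2" by eventually_elim simp
      then show "\<exists>N. \<forall>m\<ge>N. (LINT x|lborel. q m x * (infdist x A)\<^sup>2) \<le> (LINT x|lborel. tail_integral w (D m x) * divergence (field \<xi> n) x) + W / a\<^sup>2 * (2 * C * (\<tau> n + \<tau> m))"
        unfolding eventually_sequentially using ineq by blast
    qed
    \<comment> \<open>Now D n is exchanged for the distance: \<delta> / D n >= 1 - \<tau> n / a on
      the support of w(\<delta>), where \<xi> = 1.\<close>
    moreover have "(LINT x|lborel. w (infdist x A) - W * \<tau> n / a * \<xi> x) \<le> (LINT x|lborel. \<xi> x * w (infdist x A) * (infdist x A / D n x))"
    proof (rule integral_mono)
      have sub: "{x. w (infdist x A) \<noteq> 0} \<subseteq> {x. infdist x A \<le> b}" using w(2) by (metis (mono_tags, lifting) Collect_mono greaterThanLessThan_iff less_imp_le)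
      show "integrable lborel (\<lambda>x. w (infdist x A) - W * \<tau> n / a * \<xi> x)"
        by (intro Bochner_Integration.integrable_diff integrable_mult_right i\<xi> integrable_continuous_bounded_support cwd bounded_subset[OF bounded_sublevel sub])
      show "integrable lborel (\<lambda>x. \<xi> x * w (infdist x A) * (infdist x A / D n x))"
        using supp[of "\<lambda>x. w (infdist x A) * (infdist x A / D n x)"]
        by (intro integrable_continuous_bounded_support continuous_intros c\<xi> cwd D_cont) (auto simp: Dne mult.assoc)
      fix x
      show "w (infdist x A) - W * \<tau> n / a * \<xi> x \<le> \<xi> x * w (infdist x A) * (infdist x A / D n x)"
      proof (cases "infdist x A \<in> {a<..<b}")
        case False
        then show ?thesis using w(2) W0 \<tau>(1)[of n] ab(1) \<xi>(2)[of x] by (simp add: less_imp_le)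
      next
        case True
        then have \<xi>x: "\<xi> x = 1" by (intro \<xi>1) auto
        have "infdist x A / D n x \<ge> 1 - \<tau> n / a"
        proof -
          have "D n x \<ge> a" using True D_ge[of x n] by auto
          then have "\<tau> n / D n x \<le> \<tau> n / a" using ab(1) \<tau>(1)[of n] by (intro divide_left_mono) (auto intro!: mult_pos_pos D_pos)
          moreover have "infdist x A / D n x \<ge> (D n x - \<tau> n) / D n x"
            using D_le[of n x] D_pos[of n x] by (intro divide_right_mono) auto
          ultimately show ?thesis using D_pos[of n x] by (simp add: diff_divide_distrib)
        qed
        then have "w (infdist x A) * (infdist x A / D n x) \<ge> w (infdist x A) * (1 - \<tau> n / a)"
          using w(3) by (intro mult_left_mono)
        moreover have "w (infdist x A) * (\<tau> n / a) \<le> W * (\<tau> n / a)"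
          using w(4) \<tau>(1)[of n] ab(1) by (intro mult_right_mono) auto
        ultimately show ?thesis by (simp add: \<xi>x right_diff_distrib)
      qed
    qed
    moreover have "(LINT x|lborel. w (infdist x A) - W * \<tau> n / a * \<xi> x) = (LINT x|lborel. w (infdist x A)) - W * \<tau> n / a * (LINT x|lborel. \<xi> x)"
    proof -
      have sub: "{x. w (infdist x A) \<noteq> 0} \<subseteq> {x. infdist x A \<le> b}" using w(2) by (metis (mono_tags, lifting) Collect_mono greaterThanLessThan_iff less_imp_le)
      have "integrable lborel (\<lambda>x. w (infdist x A))"
        by (intro integrable_continuous_bounded_support cwd bounded_subset[OF bounded_sublevel sub])
      then show ?thesis using i\<xi> by simp
    qed
    ultimately show ?thesis by (simp add: C'_def algebra_simps)
  qed
  ultimately show ?thesis by (rule that)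
qed

end

section \<open>Upper bound for the capacity\<close>

lemma ennreal_inverse_antimono:
  fixes x y :: ennreal
  assumes "x \<le> y" shows "inverse y \<le> inverse x"
proof (cases "x = 0 \<or> y = top")
  case True then show ?thesis by auto
next
  case False
  then have "x \<noteq> top" using assms by (auto simp: top_unique)
  with False obtain r s where "x = ennreal r" "y = ennreal s" "0 \<le> r" "0 \<le> s"
    by (metis ennreal_cases)
  then show ?thesis using False assms by (auto simp: inverse_ennreal le_imp_inverse_le)
qed

lemma ennreal_inverse_inverse: "inverse (inverse (x::ennreal)) = x"
proof (cases "x = 0 \<or> x = top")
  case True then show ?thesis by auto
next
  case False
  then obtain r where "x = ennreal r" "0 < r"
    by (metis ennreal_cases ennreal_0 order_le_less)
  then show ?thesis by (simp add: inverse_ennreal)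
qed

text \<open>Turns a bound for the capacity into an upper bound for the integral, the form in which
  exhaustion by intervals and approximation from below apply.\<close>

lemma ennreal_le_inverse_iff: "(x::ennreal) \<le> inverse y \<longleftrightarrow> y \<le> inverse x"
  using ennreal_inverse_antimono ennreal_inverse_inverse by metis

section \<open>Perimeter of parallel sets and fluxes through them\<close>

lemma perimeter_ge:
  fixes E :: "'a::euclidean_space set"
  assumes "C1c \<phi>" "\<And>x. norm (\<phi> x) \<le> 1" "E \<in> sets borel"
  shows "ennreal (LINT x|lborel. divergence \<phi> x * indicator E x) \<le> perimeter E"
proof -
  have m: "(\<lambda>x. indicator E x *\<^sub>R divergence \<phi> x) \<in> borel_measurable lborel"
    using assms by (intro borel_measurable_scaleR borel_measurable_indicator)
      (auto simp: C1c_iff intro!: borel_measurable_continuous_onI continuous_divergence)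
  have "(LINT x:E|lebesgue. divergence \<phi> x) = (LINT x|lborel. divergence \<phi> x * indicator E x)"
    unfolding set_lebesgue_integral_def using integral_completion[OF m] by (simp add: mult.commute)
  then show ?thesis unfolding perimeter_def using assms(1,2)
    by (intro SUP_upper2[of \<phi>]) auto
qed

lemma parallel_set_borel: "parallel_set A t \<in> sets borel"
  unfolding parallel_set_def by (intro borel_closed closed_Collect_le continuous_intros)

text \<open>A cut-off multiple of the identity field has constant divergence on the parallel sets,
  so the perimeter is at least a multiple of the volume, and each of these sets contains a ball of
  radius a. The uniform c keeps the later weights 1 / max h c bounded.\<close>

lemma perimeter_parallel_set_pos:
  fixes A :: "'a::euclidean_space set"
  assumes "bounded A" "A \<noteq> {}" "0 < a"
  obtains c :: real where "c > 0" "\<And>t. t \<in> {a..b} \<Longrightarrow> ennreal c \<le> perimeter (parallel_set A t)"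
proof -
  obtain R where R: "R > 0" "{x. infdist x A \<le> b} \<subseteq> ball 0 R"
    using bounded_subset_ballD[OF bounded_infdist_le[OF assms(1,2)]] by metis
  obtain \<xi> :: "'a \<Rightarrow> real" where \<xi>: "C1c \<xi>" "\<And>x. 0 \<le> \<xi> x" "\<And>x. \<xi> x \<le> 1"
    "\<And>x. norm x \<le> R \<Longrightarrow> \<xi> x = 1" "\<And>x. norm x \<ge> \<bar>R\<bar> + 1 \<Longrightarrow> \<xi> x = 0"
    using smooth_cutoff[of R] by metis
  \<comment> \<open>The cutoff lives in the ball of radius R + 1; dividing by that radius makes the
    norm at most 1.\<close>
  define \<phi> :: "'a \<Rightarrow> 'a" where "\<phi> x = \<xi> x *\<^sub>R ((1 / (R + 1)) *\<^sub>R (x - 0))" for x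
  have bl: "bounded_linear (\<lambda>x::'a. (1 / (R + 1)) *\<^sub>R (x - 0))"
    by (simp add: bounded_linear_scaleR_right)
  have C1c\<phi>: "C1c \<phi>" unfolding \<phi>_def
    by (intro C1c_scaleR[OF \<xi>(1)] C1_bounded_linear bl)
  have n\<phi>: "norm (\<phi> x) \<le> 1" for x
  proof (cases "norm x \<le> R + 1")
    case True
    have "norm (\<phi> x) = \<xi> x * (norm x / (R + 1))" using R(1) \<xi>(2)[of x] by (simp add: \<phi>_def)
    also have "\<dots> \<le> 1 * 1" using True R(1) \<xi>(2,3)[of x] by (intro mult_mono) auto
    finally show ?thesis by simp
  next
    case False then show ?thesis using \<xi>(5)[of x] R(1) by (simp add: \<phi>_def)
  qed
  have div: "divergence \<phi> x = DIM('a) / (R + 1)" if "x \<in> ball 0 R" for x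
  proof -
    have "((\<lambda>x. (1 / (R + 1)) *\<^sub>R x) has_derivative (\<lambda>h. (1 / (R + 1)) *\<^sub>R h)) (at x)"
      by (auto intro!: derivative_eq_intros)
    then have "(\<phi> has_derivative (\<lambda>h. (1 / (R + 1)) *\<^sub>R h)) (at x)"
      by (rule has_derivative_transform_within_open[OF _ open_ball that]) (simp add: \<phi>_def \<xi>(4))
    then have "frechet_derivative \<phi> (at x) = (\<lambda>h. (1 / (R + 1)) *\<^sub>R h)"
      using frechet_derivative_at by metis
    then show ?thesis by (simp add: divergence_def)
  qed
  obtain y where y: "y \<in> A" using assms(2) by auto
  define c where "c = DIM('a) / (R + 1) * measure lborel (cball y a)"
  have c0: "c > 0" unfolding c_def using R(1) content_cball_pos[OF assms(3), of y] by simp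
  moreover have "ennreal c \<le> perimeter (parallel_set A t)" if t: "t \<in> {a..b}" for t
  proof -
    have sub: "parallel_set A t \<subseteq> ball 0 R" using t R(2) by (auto simp: parallel_set_def)
    have "cball y a \<subseteq> parallel_set A t"
      using infdist_le[OF y] t by (fastforce simp: parallel_set_def dist_commute intro: order_trans)
    moreover have bdd: "bounded (parallel_set A t)" using sub bounded_ball bounded_subset by blast
    ultimately have "measure lborel (cball y a) \<le> measure lborel (parallel_set A t)"
      using emeasure_bounded_finite[OF bdd] parallel_set_borel[of A t] by (intro measure_mono_fmeasurable) (auto simp: fmeasurable_def)
    then have "c \<le> DIM('a) / (R + 1) * measure lborel (parallel_set A t)"
      unfolding c_def using R(1) by (intro mult_left_mono) auto
    also have "\<dots> = (LINT x|lborel. DIM('a) / (R + 1) * indicator (parallel_set A t) x)"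
      by simp
    also have "\<dots> = (LINT x|lborel. divergence \<phi> x * indicator (parallel_set A t) x)"
      using div sub by (intro Bochner_Integration.integral_cong) (auto simp: indicator_def)
    finally have "ennreal c \<le> ennreal (LINT x|lborel. divergence \<phi> x * indicator (parallel_set A t) x)"
      by (rule ennreal_leI)
    also have "\<dots> \<le> perimeter (parallel_set A t)"
      by (rule perimeter_ge[OF C1c\<phi> n\<phi> parallel_set_borel])
    finally show ?thesis .
  qed
  ultimately show ?thesis by (rule that)
qed

text \<open>Fubini: the tail integral at \<open>infdist x A\<close> integrates w t over those t for
  which x lies in \<open>parallel_set A t\<close>. With f the divergence of a competitor, the inner
  integrals are fluxes and hence bounded by perimeters.\<close>

lemma integral_tail_integral_infdist:
  fixes f :: "'a::euclidean_space \<Rightarrow> real"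
  assumes f: "continuous_on UNIV f" "integrable lborel f"
    and w: "continuous_on UNIV w" "integrable lborel w"
  shows "(LINT x|lborel. tail_integral w (infdist x A) * f x)
    = (LINT t|lborel. w t * (LINT x|lborel. f x * indicator (parallel_set A t) x))"
proof -
  have [measurable]: "w \<in> borel_measurable borel" "f \<in> borel_measurable borel" "(\<lambda>x::'a. infdist x A) \<in> borel_measurable borel"
    using f w by (auto intro!: borel_measurable_continuous_onI continuous_intros)
  let ?g = "\<lambda>(t::real, x::'a). w t * f x * (if infdist x A \<le> t then 1 else 0)"
  have m: "?g \<in> borel_measurable (lborel \<Otimes>\<^sub>M lborel)" by measurable
  have 1: "integrable lborel (\<lambda>x. w t * f x * (if infdist x A \<le> t then 1 else 0))" for t
    by (rule Bochner_Integration.integrable_bound[of _ "\<lambda>x. w t * f x"]) (use f in \<open>auto simp: abs_mult\<close>)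
  have int: "integrable (lborel \<Otimes>\<^sub>M lborel) ?g"
  proof (rule lborel_pair.Fubini_integrable[OF m])
    show "integrable lborel (\<lambda>t. LINT x|lborel. norm (?g (t, x)))"
    proof (rule Bochner_Integration.integrable_bound[of _ "\<lambda>t. (LINT x|lborel. \<bar>f x\<bar>) * w t"])
      show "integrable lborel (\<lambda>t. (LINT x|lborel. \<bar>f x\<bar>) * w t)" using w by simp
      show "(\<lambda>t. LINT x|lborel. norm (?g (t, x))) \<in> borel_measurable lborel"
        by measurable
      show "AE t in lborel. norm (LINT x|lborel. norm (?g (t, x))) \<le> norm ((LINT x|lborel. \<bar>f x\<bar>) * w t)"
      proof (rule AE_I2)
        fix t
        have "norm (LINT x|lborel. norm (?g (t, x))) = (LINT x|lborel. norm (?g (t, x)))" by simp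
        also have "\<dots> \<le> (LINT x|lborel. \<bar>f x\<bar> * \<bar>w t\<bar>)"
          by (rule integral_mono) (use integrable_norm[OF 1[of t]] f in \<open>auto simp: abs_mult\<close>)
        also have "\<dots> = norm ((LINT x|lborel. \<bar>f x\<bar>) * w t)" by (simp add: abs_mult)
        finally show "norm (LINT x|lborel. norm (?g (t, x))) \<le> norm ((LINT x|lborel. \<bar>f x\<bar>) * w t)" .
      qed
    qed
    show "AE t in lborel. integrable lborel (\<lambda>x. ?g (t, x))" using 1 by simp
  qed
  from lborel_pair.Fubini_integral[OF int]
  have "(LINT x|lborel. LINT t|lborel. w t * f x * (if infdist x A \<le> t then 1 else 0))
      = (LINT t|lborel. LINT x|lborel. w t * f x * (if infdist x A \<le> t then 1 else 0))"
    by simp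
  moreover have "(LINT t|lborel. w t * f x * (if infdist x A \<le> t then 1 else 0)) = tail_integral w (infdist x A) * f x" for x
  proof -
    have "(\<lambda>t. w t * f x * (if infdist x A \<le> t then 1 else 0)) = (\<lambda>t. f x * (w t * indicator {infdist x A..} t))"
      by (auto simp: fun_eq_iff indicator_def)
    then show ?thesis by (simp add: tail_integral_def mult.commute)
  qed
  moreover have "(LINT x|lborel. w t * f x * (if infdist x A \<le> t then 1 else 0)) = w t * (LINT x|lborel. f x * indicator (parallel_set A t) x)" for t
  proof -
    have "(\<lambda>x. w t * f x * (if infdist x A \<le> t then 1 else 0)) = (\<lambda>x. w t * (f x * indicator (parallel_set A t) x))"
      by (auto simp: fun_eq_iff indicator_def parallel_set_def)
    then show ?thesis by simp
  qed
  ultimately show ?thesis by simp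
qed

text \<open>Off the level set at t, the indicator of the parallel set is constant for radii near t,
  so dominated convergence applies with majorant |f|.\<close>

lemma isCont_integral_parallel_set:
  fixes f :: "'a::euclidean_space \<Rightarrow> real"
  assumes f: "integrable lborel f" and null: "emeasure lborel {x::'a. infdist x A = t} = 0"
  shows "isCont (\<lambda>t. LINT x|lborel. f x * indicator (parallel_set A t) x) t"
proof (rule continuous_at_sequentiallyI)
  fix u assume u: "u \<longlonglongrightarrow> t"
  have mf: "f \<in> borel_measurable lborel" using f by simp
  show "(\<lambda>n. LINT x|lborel. f x * indicator (parallel_set A (u n)) x) \<longlonglongrightarrow> (LINT x|lborel. f x * indicator (parallel_set A t) x)"
  proof (rule integral_dominated_convergence[where w="\<lambda>x. \<bar>f x\<bar>"])
    show "(\<lambda>x. f x * indicator (parallel_set A t) x) \<in> borel_measurable lborel"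
      "(\<lambda>x. f x * indicator (parallel_set A (u n)) x) \<in> borel_measurable lborel" for n
      using mf parallel_set_borel by (auto intro!: borel_measurable_times borel_measurable_indicator)
    show "integrable lborel (\<lambda>x. \<bar>f x\<bar>)" using f by simp
    show "AE x in lborel. norm (f x * indicator (parallel_set A (u n)) x) \<le> \<bar>f x\<bar>" for n
      by (auto simp: indicator_def)
    have "AE x in lborel. x \<notin> {x. infdist x A = t}"
    proof (rule AE_not_in)
      have "{x::'a. infdist x A = t} \<in> sets borel" by (intro borel_closed closed_Collect_eq continuous_intros)
      then show "{x. infdist x A = t} \<in> null_sets lborel" using null by (simp add: null_sets_def)
    qed
    then show "AE x in lborel. (\<lambda>n. f x * indicator (parallel_set A (u n)) x) \<longlonglongrightarrow> f x * indicator (parallel_set A t) x"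
    proof eventually_elim
      case (elim x)
      have "\<forall>\<^sub>F n in sequentially. indicator (parallel_set A (u n)) x = (indicator (parallel_set A t) x :: real)"
      proof (cases "infdist x A < t")
        case True
        from order_tendstoD(1)[OF u True] show ?thesis
          by eventually_elim (use True in \<open>auto simp: parallel_set_def\<close>)
      next
        case False
        then have *: "t < infdist x A" using elim by simp
        from order_tendstoD(2)[OF u *] show ?thesis
          by eventually_elim (use * in \<open>auto simp: parallel_set_def indicator_def\<close>)
      qed
      then have "(\<lambda>n. indicator (parallel_set A (u n)) x) \<longlonglongrightarrow> (indicator (parallel_set A t) x :: real)"
        by (rule tendsto_eventually)
      then show ?case by (intro tendsto_intros)
    qed
  qed
qed

context smooth_dist_approx
begin

lemma cutoff_sublevel:
  obtains \<xi> :: "'a \<Rightarrow> real" where "C1c \<xi>" "\<And>x. 0 \<le> \<xi> x" "\<And>x. \<xi> x \<le> 1"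
    "\<And>x. infdist x A \<le> b \<Longrightarrow> \<xi> x = 1"
proof -
  obtain R where R: "R > 0" "{x. infdist x A \<le> b} \<subseteq> cball 0 R"
    using bounded_subset_cballD[OF bounded_sublevel] by metis
  obtain \<xi> :: "'a \<Rightarrow> real" where "C1c \<xi>" "\<And>x. 0 \<le> \<xi> x" "\<And>x. \<xi> x \<le> 1"
    "\<And>x. norm x \<le> R \<Longrightarrow> \<xi> x = 1" "\<And>x. norm x \<ge> \<bar>R\<bar> + 1 \<Longrightarrow> \<xi> x = 0"
    using smooth_cutoff[of R] by metis
  then show ?thesis using R by (intro that[of \<xi>]) auto
qed

text \<open>A tent of height 1 and half-width \<epsilon> around t dominates the indicator of the
  level set, while its tail integral is at most 2 \<epsilon>. The flux side of the shell inequality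
  is therefore of order \<epsilon>, up to the error C \<tau> n.\<close>

lemma level_set_null:
  assumes t: "t > 0"
  shows "emeasure lborel {x. infdist x A = t} = 0"
proof -
  let ?L = "{x. infdist x A = t}"
  have L: "?L \<in> sets borel" by (intro borel_closed closed_Collect_eq continuous_intros)
  have bL: "bounded ?L" by (rule bounded_subset[OF bounded_sublevel[of t]]) auto
  obtain \<xi> :: "'a \<Rightarrow> real" where \<xi>: "C1c \<xi>" "\<And>x. 0 \<le> \<xi> x" "\<And>x. \<xi> x \<le> 1" "\<And>x. infdist x A \<le> 2 * t \<Longrightarrow> \<xi> x = 1"
    by (rule cutoff_sublevel[of "2 * t"]) blast
  obtain C where C: "C \<ge> 0"
    "\<And>n w W. continuous_on UNIV w \<Longrightarrow> (\<And>s. s \<notin> {t/2<..<2*t} \<Longrightarrow> w s = 0) \<Longrightarrow> (\<And>t. 0 \<le> w t) \<Longrightarrow> (\<And>t. w t \<le> W) \<Longrightarrow>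
      (LINT x|lborel. w (infdist x A)) \<le> (LINT x|lborel. tail_integral w (infdist x A) * divergence (field \<xi> n) x) + C * \<tau> n * W"
    by (rule integral_shell_le_flux[OF \<xi>(1,2,3), of "t/2" "2*t"]) (use t \<xi>(4) in \<open>auto\<close>)
  have main: "measure lborel ?L \<le> 2 * \<epsilon> * (LINT x|lborel. \<bar>divergence (field \<xi> n) x\<bar>) + C * \<tau> n" if \<epsilon>: "0 < \<epsilon>" "\<epsilon> < t / 2" for \<epsilon> n
  proof -
    define w where "w s = max 0 (1 - \<bar>s - t\<bar> / \<epsilon>)" for s
    have w: "continuous_on UNIV w" "\<And>s. s \<notin> {t/2<..<2*t} \<Longrightarrow> w s = 0" "\<And>s. 0 \<le> w s" "\<And>s. w s \<le> 1"
      unfolding w_def using \<epsilon> t by (auto intro!: continuous_intros simp: field_simps)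
    have ab: "t / 2 < 2 * t" using t by simp
    have C1cf: "C1c (field \<xi> n)" by (rule C1c_field[OF \<xi>(1)])
    have C1f: "C1 (field \<xi> n)" using C1cf by (simp add: C1c_iff)
    have cdiv: "continuous_on UNIV (divergence (field \<xi> n))" by (rule continuous_divergence[OF C1f])
    have idiv: "integrable lborel (divergence (field \<xi> n))"
      by (rule integrable_continuous_bounded_support[OF cdiv bounded_support_divergence[OF C1cf]])
    have Iw: "(LINT s|lborel. w s) \<le> 2 * \<epsilon>"
    proof -
      have "(LINT s|lborel. w s) \<le> (LINT s|lborel. indicator {t-\<epsilon>..t+\<epsilon>} s)"
      proof (rule integral_mono[OF integrable_bump[OF w(1) ab w(2)]])
        show "integrable lborel (indicator {t-\<epsilon>..t+\<epsilon>} :: real \<Rightarrow> real)"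
          using \<epsilon> by (intro integrable_real_indicator) auto
        show "w s \<le> indicator {t-\<epsilon>..t+\<epsilon>} s" for s
          using \<epsilon> by (auto simp: indicator_def w_def field_simps)
      qed
      then show ?thesis using \<epsilon> by simp
    qed
    have cd: "continuous_on UNIV (\<lambda>x::'a. infdist x A)" by (intro continuous_intros)
    have cwd: "continuous_on UNIV (\<lambda>x::'a. w (infdist x A))"
      by (rule continuous_on_compose2[OF w(1) cd]) auto
    have cTd: "continuous_on UNIV (\<lambda>x::'a. tail_integral w (infdist x A))"
      by (rule continuous_on_compose2[OF continuous_tail_integral[OF w(1) ab w(2)] cd]) auto
    have sub: "{x. w (infdist x A) \<noteq> 0} \<subseteq> {x. infdist x A \<le> 2 * t}"
      using w(2) by (metis (mono_tags, lifting) Collect_mono greaterThanLessThan_iff less_imp_le)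
    have "measure lborel ?L = (LINT x|lborel. indicator ?L x)" by simp
    also have "\<dots> \<le> (LINT x|lborel. w (infdist x A))"
    proof (rule integral_mono)
      show "integrable lborel (\<lambda>x. w (infdist x A))"
        by (intro integrable_continuous_bounded_support cwd bounded_subset[OF bounded_sublevel sub])
      show "integrable lborel (\<lambda>x. indicator ?L x :: real)"
        using emeasure_bounded_finite[OF bL] L by (intro integrable_real_indicator) auto
      show "indicator ?L x \<le> w (infdist x A)" for x by (auto simp: indicator_def w_def)
    qed
    also have "\<dots> \<le> (LINT x|lborel. tail_integral w (infdist x A) * divergence (field \<xi> n) x) + C * \<tau> n * 1"
      by (rule C(2)[OF w])
    also have "(LINT x|lborel. tail_integral w (infdist x A) * divergence (field \<xi> n) x) \<le> (LINT x|lborel. 2 * \<epsilon> * \<bar>divergence (field \<xi> n) x\<bar>)"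
    proof (rule integral_mono)
      show "integrable lborel (\<lambda>x. tail_integral w (infdist x A) * divergence (field \<xi> n) x)"
        using bounded_support_divergence[OF C1cf]
        by (intro integrable_continuous_bounded_support continuous_intros cTd cdiv) (auto intro: bounded_subset)
      show "integrable lborel (\<lambda>x. 2 * \<epsilon> * \<bar>divergence (field \<xi> n) x\<bar>)" using idiv by simp
      fix x
      have T: "0 \<le> tail_integral w (infdist x A)" "tail_integral w (infdist x A) \<le> 2 * \<epsilon>"
        using tail_integral_bounds[OF w(1) ab w(2) w(3), of "infdist x A"] Iw by auto
      have "tail_integral w (infdist x A) * divergence (field \<xi> n) x \<le> tail_integral w (infdist x A) * \<bar>divergence (field \<xi> n) x\<bar>"
        using T by (intro mult_left_mono) auto
      also have "\<dots> \<le> 2 * \<epsilon> * \<bar>divergence (field \<xi> n) x\<bar>" using T by (intro mult_right_mono) auto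
      finally show "tail_integral w (infdist x A) * divergence (field \<xi> n) x \<le> 2 * \<epsilon> * \<bar>divergence (field \<xi> n) x\<bar>" .
    qed
    finally show ?thesis by simp
  qed
  \<comment> \<open>The order of limits matters: \<epsilon> tends to 0 for fixed n, because the
    integral of |div (field \<xi> n)| may grow with n.\<close>
  have n: "measure lborel ?L \<le> C * \<tau> n" for n
  proof (rule tendsto_lowerbound)
    show "((\<lambda>\<epsilon>. 2 * \<epsilon> * (LINT x|lborel. \<bar>divergence (field \<xi> n) x\<bar>) + C * \<tau> n) \<longlongrightarrow> C * \<tau> n) (at_right 0)"
      by (auto intro!: tendsto_eq_intros)
    show "\<forall>\<^sub>F \<epsilon> in at_right 0. measure lborel ?L \<le> 2 * \<epsilon> * (LINT x|lborel. \<bar>divergence (field \<xi> n) x\<bar>) + C * \<tau> n"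
      unfolding eventually_at_right_field using t main by (intro exI[of _ "t/2"]) auto
  qed auto
  have "measure lborel ?L \<le> C * 0"
    by (rule LIMSEQ_le_const[OF tendsto_mult[OF tendsto_const \<tau>(3)]]) (use n in auto)
  then have "measure lborel ?L = 0" by (simp add: measure_le_0_iff)
  then show ?thesis using emeasure_bounded_finite[OF bL] by (auto simp: measure_def enn2real_eq_0_iff)
qed

text \<open>The competitor is a tail integral of w at D m, divided by the mass of w. It is 1 on K,
  where D m <= \<tau> m <= a, and its gradient is at most w (D m) divided by that mass, because |V
  m| <= D m. Letting m grow replaces D m by the distance.\<close>

lemma newton_cap_le_integral_shell:
  assumes K: "K \<subseteq> A" and ab: "0 < a" "a < b"
    and w: "continuous_on UNIV w" "\<And>t. t \<notin> {a<..<b} \<Longrightarrow> w t = 0" "\<And>t. 0 \<le> w t" "\<And>t. w t \<le> W"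
    and I: "(LINT t|lborel. w t) > 0"
  shows "newton_cap K \<le> ennreal ((LINT x|lborel. (w (infdist x A))\<^sup>2) / (LINT t|lborel. w t)\<^sup>2)"
proof -
  define I where "I = (LINT t|lborel. w t)"
  have I0: "I > 0" using I by (simp add: I_def)
  note T' = DERIV_tail_integral[OF w(1) ab(2) w(2)]
  note cT = continuous_tail_integral[OF w(1) ab(2) w(2)]
  note TB = tail_integral_bounds[OF w(1) ab(2) w(2) w(3)]
  have Dne: "D m x \<noteq> 0" for m x using D_pos[of m x] by simp
  have cwD: "continuous_on UNIV (\<lambda>x. w (D m x))" for m
    by (rule continuous_on_compose2[OF w(1) D_cont]) auto
  have suppD: "bounded {x. w (D m x) \<noteq> 0}" for m
  proof (rule bounded_subset[OF bounded_sublevel[of b]])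
    show "{x. w (D m x) \<noteq> 0} \<subseteq> {x. infdist x A \<le> b}"
    proof safe
      fix x assume "w (D m x) \<noteq> 0"
      then have "D m x \<in> {a<..<b}" using w(2) by blast
      then show "infdist x A \<le> b" using D_ge[of x m] by auto
    qed
  qed
  have capm: "newton_cap K \<le> ennreal ((LINT x|lborel. (w (D m x))\<^sup>2) / I\<^sup>2)" if m: "\<tau> m \<le> a" for m
  proof -
    define u where "u x = tail_integral w (D m x) / I" for x
    define g where "g x = (- w (D m x) / I) *\<^sub>R ((1 / D m x) *\<^sub>R V m x)" for x
    have du: "(u has_derivative (\<lambda>h. g x \<bullet> h)) (at x)" for x
    proof -
      have "((\<lambda>t. tail_integral w t / I) has_real_derivative - w (D m x) / I) (at (D m x))"
        by (rule DERIV_cdivide[OF T'])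
      from has_derivative_compose_gradient[OF D_deriv this] show ?thesis
        by (simp add: u_def[abs_def] g_def)
    qed
    have cg: "continuous_on UNIV g"
      unfolding g_def by (intro continuous_intros cwD D_cont V_cont) (use I0 in \<open>auto simp: Dne\<close>)
    have cu: "continuous_on UNIV u"
      unfolding u_def by (intro continuous_intros continuous_on_compose2[OF cT D_cont]) (use I0 in auto)
    have ng: "(norm (g x))\<^sup>2 \<le> (w (D m x))\<^sup>2 / I\<^sup>2" for x
    proof -
      have "norm (g x) = w (D m x) / I * (norm (V m x) / D m x)"
        using w(3) I0 D_pos[of m x] by (simp add: g_def abs_mult)
      also have "\<dots> \<le> w (D m x) / I * 1"
        using w(3) I0 D_pos[of m x] norm_V[of m x] by (intro mult_left_mono) auto
      finally have "(norm (g x))\<^sup>2 \<le> (w (D m x) / I * 1)\<^sup>2" by (intro power_mono) auto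
      then show ?thesis by (simp add: power_divide)
    qed
    have iw: "integrable lborel (\<lambda>x. (w (D m x))\<^sup>2 / I\<^sup>2)"
      using suppD[of m] by (intro integrable_continuous_bounded_support continuous_intros cwD) (use I0 in auto)
    have "(\<integral>\<^sup>+ x. ennreal ((norm (g x))\<^sup>2) \<partial>lebesgue) \<le> (\<integral>\<^sup>+ x. ennreal ((w (D m x))\<^sup>2 / I\<^sup>2) \<partial>lborel)"
      unfolding nn_integral_completion using ng by (intro nn_integral_mono ennreal_leI)
    also have "\<dots> = ennreal (LINT x|lborel. (w (D m x))\<^sup>2 / I\<^sup>2)"
      by (rule nn_integral_eq_integral[OF iw]) auto
    finally have energy: "(\<integral>\<^sup>+ x. ennreal ((norm (g x))\<^sup>2) \<partial>lebesgue) \<le> ennreal ((LINT x|lborel. (w (D m x))\<^sup>2) / I\<^sup>2)"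
      by simp
    have "cap_admissible K u g"
      unfolding cap_admissible_def
    proof (intro conjI allI impI)
      show "continuous_on UNIV u" by (rule cu)
      show "indicator K x \<le> u x" for x
      proof (cases "x \<in> K")
        case True
        then have "infdist x A = 0" using K by (auto intro: infdist_zero)
        then have "D m x \<le> a" using D_le[of m x] m by simp
        then have "tail_integral w (D m x) = I"
          unfolding I_def using tail_integral_eq_integral[OF w(1) ab(2) w(2)] by simp
        then show ?thesis using I0 by (simp add: u_def indicator_def)
      next
        case False then show ?thesis using TB(1) I0 by (simp add: u_def)
      qed
      show "set_integrable lebesgue S u" if "compact S" for S
      proof -
        have "integrable lborel (\<lambda>x. indicator S x *\<^sub>R u x)"
          by (rule borel_integrable_compact[OF that]) (rule continuous_on_subset[OF cu], auto)
        then show ?thesis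
          unfolding set_integrable_def using integrable_completion borel_measurable_integrable by blast
      qed
      show "weak_gradient u g" by (rule weak_gradient_C1[OF du cg])
      show "(\<integral>\<^sup>+ x. ennreal ((norm (g x))\<^sup>2) \<partial>lebesgue) < \<infinity>"
        using energy by (simp add: order_le_less_trans)
      fix \<epsilon> :: real assume "\<epsilon> > 0"
      have "{x. \<epsilon> < \<bar>u x\<bar>} \<subseteq> {x. infdist x A \<le> b}"
      proof safe
        fix x assume *: "\<epsilon> < \<bar>u x\<bar>"
        have "D m x < b"
        proof (rule ccontr)
          assume "\<not> D m x < b"
          then have "tail_integral w (D m x) = 0" by (intro tail_integral_eq_0[OF w(1) ab(2) w(2)]) auto
          then show False using * \<open>\<epsilon> > 0\<close> by (simp add: u_def)
        qed
        then show "infdist x A \<le> b" using D_ge[of x m] by simp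
      qed
      then have bdd: "bounded {x. \<epsilon> < \<bar>u x\<bar>}" by (rule bounded_subset[OF bounded_sublevel])
      have "{x. \<epsilon> < \<bar>u x\<bar>} \<in> sets borel"
        by (intro borel_open open_Collect_less continuous_intros cu)
      then show "emeasure lebesgue {x. \<epsilon> < \<bar>u x\<bar>} < \<infinity>"
        using emeasure_bounded_finite[OF bdd] by simp
    qed
    then have "newton_cap K \<le> (\<integral>\<^sup>+ x. ennreal ((norm (g x))\<^sup>2) \<partial>lebesgue)"
      unfolding newton_cap_def by (intro INF_lower2[of "(u, g)"]) auto
    with energy show ?thesis by (rule order_trans[rotated])
  qed
  have W0: "W \<ge> 0" using w(3)[of 0] w(4)[of 0] by linarith
  have lim: "(\<lambda>m. LINT x|lborel. (w (D m x))\<^sup>2) \<longlonglongrightarrow> (LINT x|lborel. (w (infdist x A))\<^sup>2)"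
  proof (rule integral_dominated_convergence[where w="\<lambda>x. W\<^sup>2 * indicator {x. infdist x A \<le> b} x"])
    have "continuous_on UNIV (\<lambda>x::'a. w (infdist x A))"
      by (rule continuous_on_compose2[OF w(1)]) (auto intro!: continuous_intros)
    then show "(\<lambda>x. (w (infdist x A))\<^sup>2) \<in> borel_measurable lborel"
      "(\<lambda>x. (w (D m x))\<^sup>2) \<in> borel_measurable lborel" for m
      by (auto intro!: borel_measurable_continuous_onI continuous_intros cwD)
    have "{x. infdist x A \<le> b} \<in> sets borel" using parallel_set_borel[of A b] by (simp add: parallel_set_def)
    then show "integrable lborel (\<lambda>x. W\<^sup>2 * indicator {x. infdist x A \<le> b} x)"
      by (intro integrable_continuous_mult_indicator bounded_sublevel continuous_intros)
    show "AE x in lborel. (\<lambda>m. (w (D m x))\<^sup>2) \<longlonglongrightarrow> (w (infdist x A))\<^sup>2"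
      using continuous_on_tendsto_compose[OF w(1) D_tendsto] by (intro AE_I2 tendsto_intros) simp
    show "AE x in lborel. norm ((w (D m x))\<^sup>2) \<le> W\<^sup>2 * indicator {x. infdist x A \<le> b} x" for m
    proof (rule AE_I2)
      fix x
      show "norm ((w (D m x))\<^sup>2) \<le> W\<^sup>2 * indicator {x. infdist x A \<le> b} x"
      proof (cases "D m x \<in> {a<..<b}")
        case True
        then have "infdist x A \<le> b" using D_ge[of x m] by auto
        then show ?thesis using w(3,4) by (simp add: power_mono)
      next
        case False then show ?thesis using w(2) by simp
      qed
    qed
  qed
  have "(\<lambda>m. ennreal ((LINT x|lborel. (w (D m x))\<^sup>2) / I\<^sup>2)) \<longlonglongrightarrow> ennreal ((LINT x|lborel. (w (infdist x A))\<^sup>2) / I\<^sup>2)"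
    by (intro tendsto_ennrealI tendsto_intros lim) (use I0 in auto)
  moreover have "\<forall>\<^sub>F m in sequentially. \<tau> m < a" by (rule order_tendstoD(2)[OF \<tau>(3) ab(1)])
  then have "\<forall>\<^sub>F m in sequentially. newton_cap K \<le> ennreal ((LINT x|lborel. (w (D m x))\<^sup>2) / I\<^sup>2)"
    by eventually_elim (simp add: capm)
  ultimately show ?thesis unfolding I_def[symmetric] by (rule tendsto_lowerbound) simp
qed

end

context smooth_dist_approx
begin

text \<open>The weight is chosen here. With h the flux for fixed n, the shell inequality for w^2
  bounds the energy by (I + C \<tau> n / c^2) / I^2, and the integral J of 1 / P is at most I.
  Letting n grow leaves 1 / J.\<close>

lemma newton_cap_le_inverse_integral_Icc:
  assumes K: "K \<subseteq> A" and a: "0 < a'" "a' < b'"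
  shows "newton_cap K \<le> inverse (\<integral>\<^sup>+t\<in>{a'..b'}. inverse (perimeter (parallel_set A t)) \<partial>lborel)"
proof -
  \<comment> \<open>A margin around the given interval, needed to bring the weight continuously down
    to 0.\<close>
  define a b where "a = a' / 2" and "b = b' + 1"
  have ab: "0 < a" "a < b" "a < a'" "b' < b" using a by (auto simp: a_def b_def)
  obtain c :: real where c: "c > 0" "\<And>t. t \<in> {a..b} \<Longrightarrow> ennreal c \<le> perimeter (parallel_set A t)"
    by (rule perimeter_parallel_set_pos[OF compact_imp_bounded[OF A(1)] A(2) ab(1), of b]) blast
  obtain \<xi> :: "'a \<Rightarrow> real" where \<xi>: "C1c \<xi>" "\<And>x. 0 \<le> \<xi> x" "\<And>x. \<xi> x \<le> 1" "\<And>x. infdist x A \<le> b \<Longrightarrow> \<xi> x = 1"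
    by (rule cutoff_sublevel[of b]) blast
  obtain C where C: "C \<ge> 0"
    "\<And>n w W. continuous_on UNIV w \<Longrightarrow> (\<And>s. s \<notin> {a<..<b} \<Longrightarrow> w s = 0) \<Longrightarrow> (\<And>t. 0 \<le> w t) \<Longrightarrow> (\<And>t. w t \<le> W) \<Longrightarrow>
      (LINT x|lborel. w (infdist x A)) \<le> (LINT x|lborel. tail_integral w (infdist x A) * divergence (field \<xi> n) x) + C * \<tau> n * W"
    by (rule integral_shell_le_flux[OF \<xi>(1,2,3) ab(1,2) \<xi>(4)]) blast+
  define J where "J = (\<integral>\<^sup>+t\<in>{a'..b'}. inverse (perimeter (parallel_set A t)) \<partial>lborel)"
  define \<zeta> where "\<zeta> t = max 0 (min 1 (min ((t - a) / (a' - a)) ((b - t) / (b - b'))))" for t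
  have \<zeta>: "continuous_on UNIV \<zeta>" "\<And>t. 0 \<le> \<zeta> t" "\<And>t. \<zeta> t \<le> 1"
    unfolding \<zeta>_def using ab by (auto intro!: continuous_intros)
  have \<zeta>0: "\<zeta> t = 0" if "t \<notin> {a<..<b}" for t
  proof -
    have "(t - a) / (a' - a) \<le> 0 \<or> (b - t) / (b - b') \<le> 0"
      using that ab by (auto simp: divide_le_0_iff)
    then show ?thesis unfolding \<zeta>_def by linarith
  qed
  have \<zeta>1: "\<zeta> t = 1" if "t \<in> {a'..b'}" for t
  proof -
    have "(t - a) / (a' - a) \<ge> 1" "(b - t) / (b - b') \<ge> 1" using that ab by auto
    then show ?thesis unfolding \<zeta>_def by linarith
  qed
  \<comment> \<open>The \<open>ennreal\<close> J enters only through positive real lower bounds j,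
    so that the estimate stays within real arithmetic.\<close>
  have step: "newton_cap K \<le> ennreal (1 / j + C * \<tau> n / c\<^sup>2 / j\<^sup>2)" if j: "j > 0" "ennreal j \<le> J" for j n
  proof -
    have C1cf: "C1c (field \<xi> n)" by (rule C1c_field[OF \<xi>(1)])
    have C1f: "C1 (field \<xi> n)" using C1cf by (simp add: C1c_iff)
    have cdiv: "continuous_on UNIV (divergence (field \<xi> n))" by (rule continuous_divergence[OF C1f])
    have idiv: "integrable lborel (divergence (field \<xi> n))"
      by (rule integrable_continuous_bounded_support[OF cdiv bounded_support_divergence[OF C1cf]])
    define h where "h t = (LINT x|lborel. divergence (field \<xi> n) x * indicator (parallel_set A t) x)" for t
    have hP: "ennreal (h t) \<le> perimeter (parallel_set A t)" for t
      unfolding h_def by (intro perimeter_ge[OF C1cf norm_field_le parallel_set_borel] \<xi>)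
    have hcont: "isCont h t" if "t > 0" for t
      unfolding h_def by (rule isCont_integral_parallel_set[OF idiv level_set_null[OF that]])
    \<comment> \<open>Imitates 1 / P on the given interval. The maximum with c keeps the denominator
      positive, since the flux h may be small or negative.\<close>
    define w where "w t = \<zeta> t / max (h t) c" for t
    have mpos: "max (h t) c > 0" for t using c(1) by auto
    have w0: "w t = 0" if "t \<notin> {a<..<b}" for t using \<zeta>0[OF that] by (simp add: w_def)
    have wnn: "0 \<le> w t" for t using \<zeta>(2)[of t] mpos[of t] by (simp add: w_def)
    have wle: "w t \<le> 1 / c" for t
      unfolding w_def using \<zeta>(2,3)[of t] c(1) by (intro frac_le) auto
    have wc: "continuous_on UNIV w"
    proof (rule continuous_at_imp_continuous_on, safe)
      fix t :: real
      show "isCont w t"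
      proof (cases "t > 0")
        case True
        have "isCont \<zeta> t" using \<zeta>(1) by (simp add: continuous_on_eq_continuous_at)
        then show ?thesis unfolding w_def
          by (intro continuous_intros hcont[OF True]) (use mpos[of t] in auto)
      next
        case False
        have "\<forall>\<^sub>F s in nhds t. s \<in> {..<a}" using False ab(1)
            by (intro eventually_nhds_in_open) auto
        then have "\<forall>\<^sub>F s in nhds t. w s = 0" by eventually_elim (simp add: w0)
        then show ?thesis using isCont_cong[of w "\<lambda>_. 0" t] by simp
      qed
    qed
    define I where "I = (LINT t|lborel. w t)"
    have iw: "integrable lborel w" by (rule integrable_bump[OF wc ab(2) w0])
    \<comment> \<open>Both h and c are at most P, so w >= 1 / P wherever \<zeta> = 1.\<close>
    have JI: "J \<le> ennreal I"
    proof -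
      have "J \<le> (\<integral>\<^sup>+t. ennreal (w t) \<partial>lborel)"
        unfolding J_def
      proof (rule nn_integral_mono)
        fix t
        show "inverse (perimeter (parallel_set A t)) * indicator {a'..b'} t \<le> ennreal (w t)"
        proof (cases "t \<in> {a'..b'}")
          case True
          have "ennreal c \<le> perimeter (parallel_set A t)" using True ab by (intro c(2)) auto
          then have "ennreal (max (h t) c) \<le> perimeter (parallel_set A t)"
            using hP[of t] by (auto simp: max_def)
          then have "inverse (perimeter (parallel_set A t)) \<le> inverse (ennreal (max (h t) c))"
            by (rule ennreal_inverse_antimono)
          also have "\<dots> = ennreal (w t)" using \<zeta>1[OF True] mpos[of t] by (simp add: w_def inverse_ennreal inverse_eq_divide)
          finally show ?thesis using True by simp
        next
          case False then show ?thesis by simp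
        qed
      qed
      also have "\<dots> = ennreal I" unfolding I_def using wnn by (intro nn_integral_eq_integral iw) auto
      finally show ?thesis .
    qed
    have jI: "j \<le> I"
    proof -
      have "ennreal j \<le> ennreal I" using j(2) JI by (rule order_trans)
      then show ?thesis using j(1) by (metis ennreal_le_iff2 not_le order_less_imp_le)
    qed
    have I0: "I > 0" using jI j(1) by linarith
    define v where "v t = (w t)\<^sup>2" for t
    have v: "continuous_on UNIV v" "\<And>t. t \<notin> {a<..<b} \<Longrightarrow> v t = 0" "\<And>t. 0 \<le> v t" "\<And>t. v t \<le> (1 / c)\<^sup>2"
      unfolding v_def using w0 wnn wle wc by (auto intro!: continuous_intros power_mono)
    have iv: "integrable lborel v" by (rule integrable_bump[OF v(1) ab(2) v(2)])
    have "(LINT x|lborel. v (infdist x A)) \<le> (LINT x|lborel. tail_integral v (infdist x A) * divergence (field \<xi> n) x) + C * \<tau> n * (1 / c)\<^sup>2"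
      by (rule C(2)[OF v])
    also have "(LINT x|lborel. tail_integral v (infdist x A) * divergence (field \<xi> n) x) = (LINT t|lborel. v t * h t)"
      unfolding h_def by (rule integral_tail_integral_infdist[OF cdiv idiv v(1) iv])
    also have "\<dots> \<le> I"
      unfolding I_def
    proof (rule integral_mono[OF _ iw])
      have vh_le: "\<bar>v t * h t\<bar> \<le> (LINT x|lborel. \<bar>divergence (field \<xi> n) x\<bar>) * v t" for t
      proof -
        have "\<bar>h t\<bar> \<le> (LINT x|lborel. \<bar>divergence (field \<xi> n) x * indicator (parallel_set A t) x\<bar>)"
          unfolding h_def by (rule integral_abs_bound)
        also have "\<dots> \<le> (LINT x|lborel. \<bar>divergence (field \<xi> n) x\<bar>)"
        proof (rule integral_mono)
          have "integrable lborel (\<lambda>x. indicator (parallel_set A t) x *\<^sub>R divergence (field \<xi> n) x)"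
            using parallel_set_borel[of A t] idiv by (intro integrable_mult_indicator) auto
          then show "integrable lborel (\<lambda>x. \<bar>divergence (field \<xi> n) x * indicator (parallel_set A t) x\<bar>)"
            by (simp add: mult.commute)
        qed (use idiv in \<open>auto simp: indicator_def\<close>)
        finally show ?thesis using v(3)[of t] by (simp add: abs_mult mult.commute mult_left_mono)
      qed
      have "continuous_on UNIV (\<lambda>t. v t * h t)"
      proof (rule continuous_at_imp_continuous_on, safe)
        fix t :: real
        show "isCont (\<lambda>t. v t * h t) t"
        proof (cases "t > 0")
          case True
          have "isCont v t" using v(1) by (simp add: continuous_on_eq_continuous_at)
          then show ?thesis by (intro continuous_intros hcont[OF True])
        next
          case False
          have "\<forall>\<^sub>F s in nhds t. s \<in> {..<a}" using False ab(1)
            by (intro eventually_nhds_in_open) auto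
          then have "\<forall>\<^sub>F s in nhds t. v s * h s = 0" by eventually_elim (simp add: v(2))
          then show ?thesis using isCont_cong[of "\<lambda>t. v t * h t" "\<lambda>_. 0" t] by simp
        qed
      qed
      then have m: "(\<lambda>t. v t * h t) \<in> borel_measurable lborel"
        using borel_measurable_continuous_onI by simp
      have "norm (v t * h t) \<le> norm ((LINT x|lborel. \<bar>divergence (field \<xi> n) x\<bar>) * v t)" for t
        unfolding real_norm_def using vh_le[of t] abs_ge_self by (rule order_trans)
      then show "integrable lborel (\<lambda>t. v t * h t)"
        by (intro Bochner_Integration.integrable_bound[OF integrable_mult_right[OF iv] m] AE_I2)
      fix t
      \<comment> \<open>The gain from dividing by the flux itself: w h <= 1, hence w^2 h <= w, and
        the integral of w^2 h is at most I.\<close>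
      have "w t * h t \<le> 1"
      proof (cases "h t \<le> 0")
        case True then show ?thesis using wnn[of t] by (smt (verit) mult_nonneg_nonpos)
      next
        case False
        have "\<zeta> t * (h t / max (h t) c) \<le> 1 * 1"
          using \<zeta>(2,3)[of t] False mpos[of t] by (intro mult_mono) auto
        then show ?thesis by (simp add: w_def)
      qed
      then have "w t * (w t * h t) \<le> w t * 1" using wnn by (intro mult_left_mono)
      then show "v t * h t \<le> w t" by (simp add: v_def power2_eq_square mult.assoc)
    qed
    finally have shell: "(LINT x|lborel. (w (infdist x A))\<^sup>2) \<le> I + C * \<tau> n / c\<^sup>2"
      by (simp add: v_def power_divide)
    have "newton_cap K \<le> ennreal ((LINT x|lborel. (w (infdist x A))\<^sup>2) / I\<^sup>2)"
      unfolding I_def by (rule newton_cap_le_integral_shell[OF K ab(1,2) wc w0 wnn wle]) (use I0 in \<open>auto simp: I_def\<close>)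
    also have "\<dots> \<le> ennreal (1 / j + C * \<tau> n / c\<^sup>2 / j\<^sup>2)"
    proof (rule ennreal_leI)
      have e: "C * \<tau> n / c\<^sup>2 \<ge> 0" using C(1) \<tau>(1)[of n] by simp
      have "(LINT x|lborel. (w (infdist x A))\<^sup>2) / I\<^sup>2 \<le> (I + C * \<tau> n / c\<^sup>2) / I\<^sup>2"
        using shell by (intro divide_right_mono) auto
      also have "\<dots> = 1 / I + (C * \<tau> n / c\<^sup>2) / I\<^sup>2" using I0 by (simp add: add_divide_distrib power2_eq_square)
      also have "\<dots> \<le> 1 / j + C * \<tau> n / c\<^sup>2 / j\<^sup>2"
        using jI j(1) e by (intro add_mono frac_le[OF _ order_refl] frac_le[of 1 1] power_mono) auto
      finally show "(LINT x|lborel. (w (infdist x A))\<^sup>2) / I\<^sup>2 \<le> 1 / j + C * \<tau> n / c\<^sup>2 / j\<^sup>2" .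
    qed
    finally show ?thesis .
  qed
  have "newton_cap K \<le> inverse (ennreal j)" if j: "j > 0" "ennreal j \<le> J" for j
  proof -
    have "(\<lambda>n. ennreal (1 / j + C * \<tau> n / c\<^sup>2 / j\<^sup>2)) \<longlonglongrightarrow> ennreal (1 / j + C * 0 / c\<^sup>2 / j\<^sup>2)"
      by (intro tendsto_ennrealI tendsto_intros \<tau>(3)) (use j c in auto)
    then have "newton_cap K \<le> ennreal (1 / j + C * 0 / c\<^sup>2 / j\<^sup>2)"
      by (rule tendsto_lowerbound) (use step[OF j] in auto)
    then show ?thesis using j by (simp add: inverse_ennreal inverse_eq_divide)
  qed
  \<comment> \<open>For j <= 0 the left side is 0 by the convention of \<open>ennreal\<close>, so
    the sign condition disappears.\<close>
  then have le: "ennreal j \<le> inverse (newton_cap K)" if "ennreal j \<le> J" for j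
    using that by (cases "j > 0") (auto simp: ennreal_le_inverse_iff[of "ennreal j"] ennreal_neg)
  have "J \<le> inverse (newton_cap K)"
  proof (rule dense_le)
    fix x assume x: "x < J"
    then obtain r where "x = ennreal r" by (metis ennreal_cases not_top_less)
    then show "x \<le> inverse (newton_cap K)" using le[of r] x by simp
  qed
  then show ?thesis unfolding J_def[symmetric] by (simp add: ennreal_le_inverse_iff)
qed

end

section \<open>From compact intervals of radii to the half-line\<close>

lemma ex_smooth_dist_approx:
  fixes A :: "'a::euclidean_space set"
  assumes "compact A" "A \<noteq> {}"
  obtains D :: "nat \<Rightarrow> 'a \<Rightarrow> real" and V \<tau> where "smooth_dist_approx A D V \<tau>"
proof -
  define \<tau> where "\<tau> n = inverse (real (Suc n))" for n
  have "\<forall>n. \<exists>D V. (\<forall>x. D x > 0) \<and> (\<forall>x. (D has_derivative (\<lambda>h. ((1 / D x) *\<^sub>R V x) \<bullet> h)) (at x)) \<and> C1 V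
    \<and> (\<forall>x. divergence V x \<le> DIM('a)) \<and> (\<forall>x. norm (V x) \<le> D x) \<and> (\<forall>x. infdist x A \<le> D x)
    \<and> (\<forall>x. D x \<le> infdist x A + \<tau> n) \<and> (\<forall>x. (infdist x A)\<^sup>2 - (norm (V x))\<^sup>2 \<le> \<tau> n * (DIM('a) - divergence V x))"
  proof
    fix n
    have "\<tau> n > 0" by (simp add: \<tau>_def)
    then show "\<exists>D V. (\<forall>x. D x > 0) \<and> (\<forall>x. (D has_derivative (\<lambda>h. ((1 / D x) *\<^sub>R V x) \<bullet> h)) (at x)) \<and> C1 V
      \<and> (\<forall>x. divergence V x \<le> DIM('a)) \<and> (\<forall>x. norm (V x) \<le> D x) \<and> (\<forall>x. infdist x A \<le> D x)
      \<and> (\<forall>x. D x \<le> infdist x A + \<tau> n) \<and> (\<forall>x. (infdist x A)\<^sup>2 - (norm (V x))\<^sup>2 \<le> \<tau> n * (DIM('a) - divergence V x))"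
      by (rule smooth_dist[OF assms]) blast
  qed
  then obtain D V where DV: "\<forall>n. (\<forall>x. D n x > 0) \<and> (\<forall>x. (D n has_derivative (\<lambda>h. ((1 / D n x) *\<^sub>R V n x) \<bullet> h)) (at x)) \<and> C1 (V n)
    \<and> (\<forall>x. divergence (V n) x \<le> DIM('a)) \<and> (\<forall>x. norm (V n x) \<le> D n x) \<and> (\<forall>x. infdist x A \<le> D n x)
    \<and> (\<forall>x. D n x \<le> infdist x A + \<tau> n) \<and> (\<forall>x. (infdist x A)\<^sup>2 - (norm (V n x))\<^sup>2 \<le> \<tau> n * (DIM('a) - divergence (V n) x))"
    by metis
  have "smooth_dist_approx A D V \<tau>"
  proof
    show "\<tau> \<longlonglongrightarrow> 0" unfolding \<tau>_def by (rule LIMSEQ_inverse_real_of_nat)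
  qed (use assms DV in \<open>auto simp: \<tau>_def inverse_le_1_iff\<close>)
  then show ?thesis by (rule that)
qed

text \<open>No measurability of \<^term>\<open>f\<close> is needed, because \<^const>\<open>nn_integral\<close> is a lower integral.\<close>

lemma nn_integral_greaterThan_0_le:
  fixes f :: "real \<Rightarrow> ennreal"
  assumes "\<And>a b. 0 < a \<Longrightarrow> a < b \<Longrightarrow> (\<integral>\<^sup>+t\<in>{a..b}. f t \<partial>lborel) \<le> X"
  shows "(\<integral>\<^sup>+t\<in>{0<..}. f t \<partial>lborel) \<le> X"
  unfolding nn_integral_def
proof (rule SUP_least, safe)
  fix g :: "real \<Rightarrow> ennreal" assume g: "simple_function lborel g" "g \<le> (\<lambda>t. f t * indicator {0<..} t)"
  have mg: "g \<in> borel_measurable lborel" using g(1) by (rule borel_measurable_simple_function)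
  \<comment> \<open>Compact intervals exhausting the positive half-line; n + 2 makes each of them
    nondegenerate, as the hypothesis a < b requires.\<close>
  define S where "S n = {1 / (real n + 2)..real n + 2}" for n
  have incS: "incseq S"
  proof (rule incseq_SucI)
    fix n show "S n \<subseteq> S (Suc n)"
      unfolding S_def by (auto simp: divide_simps)
  qed
  have SUP: "(SUP n. g t * indicator (S n) t) = g t" for t
  proof (cases "t > 0")
    case True
    obtain n where n: "t \<in> S n"
    proof -
      obtain n :: nat where "max t (1 / t) \<le> real n" using real_arch_simple by blast
      then have "t \<in> S n" unfolding S_def using True by (auto simp: field_simps)
      then show ?thesis by (rule that)
    qed
    show ?thesis
    proof (rule antisym)
      show "(SUP n. g t * indicator (S n) t) \<le> g t" by (rule SUP_least) (auto simp: indicator_def)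
      show "g t \<le> (SUP n. g t * indicator (S n) t)" by (rule SUP_upper2[of n]) (use n in auto)
    qed
  next
    case False
    then have "g t = 0" using g(2) by (auto simp: le_fun_def dest: spec[of _ t])
    then show ?thesis by simp
  qed
  have "integral\<^sup>S lborel g = (\<integral>\<^sup>+t. g t \<partial>lborel)"
    by (rule nn_integral_eq_simple_integral[OF g(1), symmetric])
  also have "\<dots> = (\<integral>\<^sup>+t. (SUP n. g t * indicator (S n) t) \<partial>lborel)" by (simp add: SUP)
  also have "\<dots> = (SUP n. \<integral>\<^sup>+t. g t * indicator (S n) t \<partial>lborel)"
  proof (rule nn_integral_monotone_convergence_SUP)
    show "incseq (\<lambda>n t. g t * indicator (S n) t)"
      using incS by (auto simp: incseq_def le_fun_def indicator_def)
    show "(\<lambda>t. g t * indicator (S n) t) \<in> borel_measurable lborel" for n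
      using mg by (auto simp: S_def)
  qed
  also have "\<dots> \<le> X"
  proof (rule SUP_least)
    fix n
    have "(\<integral>\<^sup>+t. g t * indicator (S n) t \<partial>lborel) \<le> (\<integral>\<^sup>+t\<in>S n. f t \<partial>lborel)"
    proof (rule nn_integral_mono)
      fix t
      show "g t * indicator (S n) t \<le> f t * indicator (S n) t"
        using g(2)[THEN le_funD, of t] by (cases "t > 0") (auto simp: indicator_def)
    qed
    also have "\<dots> \<le> X" unfolding S_def
    proof (rule assms)
      have "1 / (real n + 2) < 1" "real n + 2 > 1" by auto
      then show "1 / (real n + 2) < real n + 2" by linarith
    qed auto
    finally show "(\<integral>\<^sup>+t. g t * indicator (S n) t \<partial>lborel) \<le> X" .
  qed
  finally show "integral\<^sup>S lborel g \<le> X" .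
qed

lemma newton_cap_le_inverse_integral:
  fixes A :: "'a::euclidean_space set"
  assumes "compact A" "A \<noteq> {}" "K \<subseteq> A"
  shows "newton_cap K \<le> inverse (\<integral>\<^sup>+ t\<in>{0<..}. inverse (perimeter (parallel_set A t)) \<partial>lborel)"
proof -
  obtain D V \<tau> where "smooth_dist_approx A D V \<tau>"
    using ex_smooth_dist_approx[OF assms(1,2)] by metis
  then interpret smooth_dist_approx A D V \<tau> .
  have "(\<integral>\<^sup>+ t\<in>{0<..}. inverse (perimeter (parallel_set A t)) \<partial>lborel) \<le> inverse (newton_cap K)"
    by (rule nn_integral_greaterThan_0_le)
      (subst ennreal_le_inverse_iff, rule newton_cap_le_inverse_integral_Icc[OF assms(3)])
  then show ?thesis by (simp add: ennreal_le_inverse_iff)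
qed

text \<open>Filling adds only \<open>inside K\<close>, which stays bounded, while
  \<open>outside K\<close> is open.\<close>

lemma compact_fill_holes:
  fixes K :: "'a::euclidean_space set"
  assumes "compact K"
  shows "compact (fill_holes K)" "K \<subseteq> fill_holes K"
proof -
  have eq: "fill_holes K = K \<union> inside K"
    unfolding fill_holes_def using union_with_inside[of K] by (simp add: Un_commute)
  show "K \<subseteq> fill_holes K" by (simp add: eq)
  have "closed (fill_holes K)"
    unfolding fill_holes_def using open_outside[OF compact_imp_closed[OF assms]] by (simp add: closed_def)
  moreover have "bounded (fill_holes K)"
    unfolding eq using assms by (simp add: compact_imp_bounded bounded_inside)
  ultimately show "compact (fill_holes K)" by (simp add: compact_eq_bounded_closed)
qed

section \<open>The perimeter of a ball\<close>

text \<open>The surface area of the unit sphere, encoded as the derivative at radius 1 of the volume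
  of balls, so that no Hausdorff measure enters.\<close>

definition sphere_area :: "'a::euclidean_space itself \<Rightarrow> real" where
  "sphere_area _ = DIM('a) * unit_ball_vol (DIM('a))"

lemma sphere_area_pos: "sphere_area TYPE('a::euclidean_space) > 0"
  by (simp add: sphere_area_def)

text \<open>Polar coordinates. The distribution of |x - c| and the stated density agree on
  half-lines, where one gives the volume of a ball and the other the integral of its derivative in
  the radius.\<close>

lemma nn_integral_radial:
  fixes c :: "'a::euclidean_space" and f :: "real \<Rightarrow> ennreal"
  assumes f: "f \<in> borel_measurable borel"
  shows "(\<integral>\<^sup>+x. f (norm (x - c)) \<partial>lborel)
    = (\<integral>\<^sup>+t\<in>{0..}. ennreal (sphere_area TYPE('a) * t ^ (DIM('a) - 1)) * f t \<partial>lborel)"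
proof -
  define \<omega> where "\<omega> = unit_ball_vol (DIM('a))"
  have \<omega>: "\<omega> > 0" by (simp add: \<omega>_def)
  define \<rho> where "\<rho> t = ennreal (sphere_area TYPE('a) * t ^ (DIM('a) - 1)) * indicator {0..} t" for t :: real
  have [measurable]: "\<rho> \<in> borel_measurable borel" unfolding \<rho>_def by measurable
  have [measurable]: "(\<lambda>x::'a. norm (x - c)) \<in> borel_measurable borel"
    by (intro borel_measurable_continuous_onI continuous_intros)
  have "distr lborel borel (\<lambda>x. norm (x - c)) = density lborel \<rho>"
  proof (rule measure_eqI_generator_eq)
    show "Int_stable (range (\<lambda>a::real. {..a}))"
      by (auto simp: Int_stable_def)
    show "range (\<lambda>a::real. {..a}) \<subseteq> Pow UNIV" by simp
    show "sets (distr lborel borel (\<lambda>x. norm (x - c))) = sigma_sets UNIV (range (\<lambda>a::real. {..a}))"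
      "sets (density lborel \<rho>) = sigma_sets UNIV (range (\<lambda>a::real. {..a}))"
      by (simp_all, simp_all add: borel_eq_atMost)
    show "range (\<lambda>n. {..real n}) \<subseteq> range (\<lambda>a::real. {..a})" by auto
    show "(\<Union>n. {..real n}) = UNIV" using real_arch_simple by auto
    \<comment> \<open>The maximum with 0 covers half-lines ending below 0, whose preimage is an
      empty ball.\<close>
    have val: "emeasure (distr lborel borel (\<lambda>x. norm (x - c))) {..a} = ennreal (\<omega> * (max 0 a) ^ DIM('a))" for a :: real
    proof -
      have "emeasure (distr lborel borel (\<lambda>x. norm (x - c))) {..a} = emeasure lborel (cball c a)"
        by (subst emeasure_distr) (auto simp: cball_def vimage_def dist_norm norm_minus_commute)
      also have "\<dots> = ennreal (\<omega> * (max 0 a) ^ DIM('a))"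
        by (cases "a \<ge> 0") (auto simp: emeasure_cball \<omega>_def max_def)
      finally show ?thesis .
    qed
    then show "emeasure (distr lborel borel (\<lambda>x. norm (x - c))) {..real n} \<noteq> \<infinity>" for n by simp
    fix X :: "real set" assume "X \<in> range (\<lambda>a. {..a})"
    then obtain a where X: "X = {..a}" by auto
    have "emeasure (density lborel \<rho>) X = (\<integral>\<^sup>+t. ennreal (sphere_area TYPE('a) * t ^ (DIM('a) - 1)) * indicator {0..a} t \<partial>lborel)"
      unfolding X by (subst emeasure_density) (auto simp: \<rho>_def indicator_def intro!: nn_integral_cong)
    also have "\<dots> = ennreal (\<omega> * (max 0 a) ^ DIM('a))"
    proof (cases "a \<ge> 0")
      case True
      have "(\<integral>\<^sup>+t. ennreal (sphere_area TYPE('a) * t ^ (DIM('a) - 1)) * indicator {0..a} t \<partial>lborel) = ennreal (\<omega> * a ^ DIM('a) - \<omega> * 0 ^ DIM('a))"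
      proof (rule nn_integral_FTC_Icc[where F="\<lambda>t. \<omega> * t ^ DIM('a)"])
        show "((\<lambda>t. \<omega> * t ^ DIM('a)) has_real_derivative sphere_area TYPE('a) * t ^ (DIM('a) - 1)) (at t)" for t
          by (auto intro!: derivative_eq_intros simp: sphere_area_def \<omega>_def)
      qed (use True in \<open>auto simp: sphere_area_def\<close>)
      then show ?thesis using True by (simp add: max_def zero_power)
    next
      case False then show ?thesis by (simp add: max_def zero_power)
    qed
    finally show "emeasure (distr lborel borel (\<lambda>x. norm (x - c))) X = emeasure (density lborel \<rho>) X"
      using val[of a] X by simp
  qed
  then have "(\<integral>\<^sup>+t. f t \<partial>distr lborel borel (\<lambda>x. norm (x - c))) = (\<integral>\<^sup>+t. f t \<partial>density lborel \<rho>)" by simp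
  then show ?thesis using f
    by (simp add: nn_integral_distr nn_integral_density \<rho>_def mult_ac)
qed

lemma C1_sq_dist: "C1 (\<lambda>x::'a::euclidean_space. (x - c) \<bullet> (x - c))"
  by (intro C1_inner C1_diff_const)

lemma has_derivative_sq_dist:
  "((\<lambda>x::'a::euclidean_space. (x - c) \<bullet> (x - c)) has_derivative (\<lambda>h. (2 *\<^sub>R (x - c)) \<bullet> h)) (at x)"
  by (auto intro!: derivative_eq_intros simp: inner_commute)

text \<open>Bumps are placed in the squared radius; 2 t w(t^2) is minus the derivative of
  \<eta>(t^2), so the total mass in the radius is the drop of \<eta> from 1 to 0.\<close>

lemma nn_integral_bump_sq:
  fixes \<eta> w :: "real \<Rightarrow> real"
  assumes \<eta>: "\<And>t. (\<eta> has_real_derivative - w t) (at t)" "continuous_on UNIV w" "\<And>t. w t \<ge> 0"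
    "\<And>t. t \<le> a \<Longrightarrow> \<eta> t = 1" "\<And>t. t \<ge> b \<Longrightarrow> \<eta> t = 0" and "0 \<le> a"
  shows "(\<integral>\<^sup>+t\<in>{0..}. ennreal (2 * t * w (t\<^sup>2)) \<partial>lborel) = 1"
proof -
  have "(\<integral>\<^sup>+t. ennreal (2 * t * w (t\<^sup>2)) * indicator {0..} t \<partial>lborel) = ennreal (0 - (- \<eta> (0\<^sup>2)))"
  proof (rule nn_integral_FTC_atLeast[where F="\<lambda>t. - \<eta> (t\<^sup>2)"])
    have "continuous_on UNIV (\<lambda>t. 2 * t * w (t\<^sup>2))"
      by (intro continuous_intros continuous_on_compose2[OF \<eta>(2)]) auto
    then show "(\<lambda>t. 2 * t * w (t\<^sup>2)) \<in> borel_measurable borel"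
      by (rule borel_measurable_continuous_onI)
    show "((\<lambda>t. - \<eta> (t\<^sup>2)) has_real_derivative 2 * t * w (t\<^sup>2)) (at t)" for t
    proof -
      have "((\<lambda>t. t\<^sup>2) has_real_derivative 2 * t) (at t)" by (auto intro!: derivative_eq_intros)
      from DERIV_minus[OF DERIV_chain2[OF \<eta>(1) this]] show ?thesis by (simp add: mult.commute)
    qed
    show "((\<lambda>t. - \<eta> (t\<^sup>2)) \<longlongrightarrow> 0) at_top"
    proof (rule tendsto_eventually)
      have "\<forall>\<^sub>F t in at_top. t \<ge> \<bar>b\<bar> + 1" by (rule eventually_ge_at_top)
      then show "\<forall>\<^sub>F t in at_top. - \<eta> (t\<^sup>2) = 0"
      proof eventually_elim
        case (elim t)
        have "t * 1 \<le> t * t" using elim by (intro mult_left_mono) auto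
        then have "t\<^sup>2 \<ge> b" using elim by (simp add: power2_eq_square)
        then show ?case by (simp add: \<eta>(5))
      qed
    qed
  qed (use \<eta>(3) in auto)
  then show ?thesis using \<eta>(4)[of 0] assms(6) by simp
qed

text \<open>U drops from 1 to 0 across a shell of width e. Integrating by parts and using |\<phi>|
  <= 1 leaves the integral of |grad U|, which in polar coordinates is at most the area of the outer
  sphere.\<close>

lemma integral_divergence_cball_le:
  fixes c :: "'a::euclidean_space"
  assumes \<phi>: "C1c \<phi>" "\<And>x. norm (\<phi> x) \<le> 1" and \<rho>: "\<rho> > 0" and e: "e > 0"
  obtains U where "(LINT x|lborel. U x * divergence \<phi> x) \<le> sphere_area TYPE('a) * (\<rho> + e) ^ (DIM('a) - 1)"
    "continuous_on UNIV U" "\<And>x. 0 \<le> U x" "\<And>x. U x \<le> 1" "\<And>x. x \<in> cball c \<rho> \<Longrightarrow> U x = 1" "\<And>x. dist c x \<ge> \<rho> + e \<Longrightarrow> U x = 0"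
proof -
  have "\<rho>\<^sup>2 < (\<rho> + e)\<^sup>2" using \<rho> e by (intro power_strict_mono) auto
  then obtain \<eta> w :: "real \<Rightarrow> real" where \<eta>:
    "\<And>t. (\<eta> has_real_derivative - w t) (at t)" "continuous_on UNIV w" "\<And>t. w t \<ge> 0"
    "\<And>t. t \<notin> {\<rho>\<^sup>2<..<(\<rho> + e)\<^sup>2} \<Longrightarrow> w t = 0" "(LINT t|lborel. w t) = 1"
    "\<And>t. t \<le> \<rho>\<^sup>2 \<Longrightarrow> \<eta> t = 1" "\<And>t. t \<ge> (\<rho> + e)\<^sup>2 \<Longrightarrow> \<eta> t = 0" "\<And>t. 0 \<le> \<eta> t" "\<And>t. \<eta> t \<le> 1"
    by (rule smooth_step) blast
  define U :: "'a \<Rightarrow> real" where "U x = \<eta> ((x - c) \<bullet> (x - c))" for x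
  define G :: "'a \<Rightarrow> 'a" where "G x = (- w ((x - c) \<bullet> (x - c))) *\<^sub>R (2 *\<^sub>R (x - c))" for x
  have dU: "(U has_derivative (\<lambda>h. G x \<bullet> h)) (at x)" for x
    unfolding U_def G_def by (rule has_derivative_compose_gradient[OF has_derivative_sq_dist \<eta>(1)])
  have cws: "continuous_on UNIV (\<lambda>x. w ((x - c) \<bullet> (x - c)))"
    by (intro continuous_on_compose2[OF \<eta>(2)] continuous_intros) auto
  have cG: "continuous_on UNIV G" unfolding G_def by (intro continuous_intros cws)
  have cU: "continuous_on UNIV U" by (meson dU continuous_at_imp_continuous_on has_derivative_continuous)
  have C1\<phi>: "C1 \<phi>" using \<phi>(1) by (simp add: C1c_iff)
  have eq: "(LINT x|lborel. U x * divergence \<phi> x) = - (LINT x|lborel. G x \<bullet> \<phi> x)"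
    by (rule integral_mult_divergence[OF \<phi>(1) dU cG])
  have cf: "continuous_on UNIV (\<lambda>x. 2 * norm (x - c) * w ((norm (x - c))\<^sup>2))"
    unfolding power2_norm_eq_inner by (intro continuous_intros cws)
  \<comment> \<open>The bump vanishes for radii beyond \<rho> + e, so the area factor may be
    replaced by its value there.\<close>
  have *: "2 * t * w (t\<^sup>2) * (sphere_area TYPE('a) * t ^ (DIM('a) - 1)) \<le> sphere_area TYPE('a) * (\<rho> + e) ^ (DIM('a) - 1) * (2 * t * w (t\<^sup>2))" if "t \<ge> 0" for t
  proof (cases "w (t\<^sup>2) = 0")
    case False
    then have "t\<^sup>2 < (\<rho> + e)\<^sup>2" using \<eta>(4)[of "t\<^sup>2"] by force
    then have "t \<le> \<rho> + e" using \<rho> e by (meson less_imp_le power_less_imp_less_base add_nonneg_nonneg)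
    then have "sphere_area TYPE('a) * t ^ (DIM('a) - 1) \<le> sphere_area TYPE('a) * (\<rho> + e) ^ (DIM('a) - 1)"
      using that sphere_area_pos[where ?'a='a] by (intro mult_left_mono power_mono) auto
    from mult_left_mono[OF this, of "2 * t * w (t\<^sup>2)"] show ?thesis
      using that \<eta>(3)[of "t\<^sup>2"] by (simp add: mult_ac)
  qed simp
  have "(\<integral>\<^sup>+x. ennreal (2 * norm (x - c) * w ((norm (x - c))\<^sup>2)) \<partial>lborel)
     = (\<integral>\<^sup>+t\<in>{0..}. ennreal (sphere_area TYPE('a) * t ^ (DIM('a) - 1)) * ennreal (2 * t * w (t\<^sup>2)) \<partial>lborel)"
    by (rule nn_integral_radial[where f="\<lambda>t. ennreal (2 * t * w (t\<^sup>2))"])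
      (intro measurable_compose[OF borel_measurable_continuous_onI measurable_ennreal] continuous_intros continuous_on_compose2[OF \<eta>(2)], auto)
  also have "\<dots> \<le> (\<integral>\<^sup>+t. ennreal (sphere_area TYPE('a) * (\<rho> + e) ^ (DIM('a) - 1)) * (ennreal (2 * t * w (t\<^sup>2)) * indicator {0..} t) \<partial>lborel)"
  proof (rule nn_integral_mono)
    fix t :: real
    show "ennreal (sphere_area TYPE('a) * t ^ (DIM('a) - 1)) * ennreal (2 * t * w (t\<^sup>2)) * indicator {0..} t
      \<le> ennreal (sphere_area TYPE('a) * (\<rho> + e) ^ (DIM('a) - 1)) * (ennreal (2 * t * w (t\<^sup>2)) * indicator {0..} t)"
      using *[of t] \<eta>(3)[of "t\<^sup>2"] sphere_area_pos[where ?'a='a] \<rho> e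
      by (auto simp: indicator_def ennreal_mult'[symmetric] mult_ac intro!: ennreal_leI)
  qed
  also have "\<dots> = ennreal (sphere_area TYPE('a) * (\<rho> + e) ^ (DIM('a) - 1)) * (\<integral>\<^sup>+t\<in>{0..}. ennreal (2 * t * w (t\<^sup>2)) \<partial>lborel)"
  proof (rule nn_integral_cmult)
    have "continuous_on UNIV (\<lambda>t. 2 * t * w (t\<^sup>2))"
      by (intro continuous_intros continuous_on_compose2[OF \<eta>(2)]) auto
    from borel_measurable_continuous_onI[OF this]
    show "(\<lambda>t. ennreal (2 * t * w (t\<^sup>2)) * indicator {0..} t) \<in> borel_measurable lborel" by measurable
  qed
  also have "\<dots> = ennreal (sphere_area TYPE('a) * (\<rho> + e) ^ (DIM('a) - 1))"
    using nn_integral_bump_sq[OF \<eta>(1,2,3,6,7)] by simp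
  finally have nn: "(\<integral>\<^sup>+x. ennreal (2 * norm (x - c) * w ((norm (x - c))\<^sup>2)) \<partial>lborel) \<le> ennreal (sphere_area TYPE('a) * (\<rho> + e) ^ (DIM('a) - 1))" .
  have int: "integrable lborel (\<lambda>x. 2 * norm (x - c) * w ((norm (x - c))\<^sup>2))"
    using nn \<eta>(3) by (intro integrableI_nonneg) (auto intro!: borel_measurable_continuous_onI cf simp: order_le_less_trans)
  have real: "(LINT x|lborel. 2 * norm (x - c) * w ((norm (x - c))\<^sup>2)) \<le> sphere_area TYPE('a) * (\<rho> + e) ^ (DIM('a) - 1)"
  proof -
    have "ennreal (LINT x|lborel. 2 * norm (x - c) * w ((norm (x - c))\<^sup>2)) \<le> ennreal (sphere_area TYPE('a) * (\<rho> + e) ^ (DIM('a) - 1))"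
      using nn nn_integral_eq_integral[OF int] \<eta>(3) by simp
    then show ?thesis using sphere_area_pos[where ?'a='a] \<rho> e by (subst (asm) ennreal_le_iff) auto
  qed
  have "- (LINT x|lborel. G x \<bullet> \<phi> x) = (LINT x|lborel. - (G x \<bullet> \<phi> x))" by simp
  also have "\<dots> \<le> (LINT x|lborel. 2 * norm (x - c) * w ((norm (x - c))\<^sup>2))"
  proof (rule integral_mono[OF _ int])
    show "integrable lborel (\<lambda>x. - (G x \<bullet> \<phi> x))"
      using \<phi>(1) by (intro integrable_continuous_bounded_support continuous_intros cG C1_continuous[OF C1\<phi>])
        (auto simp: C1c_iff intro: bounded_subset[of "{x. \<phi> x \<noteq> 0}"])
    fix x
    have "- (G x \<bullet> \<phi> x) = w ((norm (x - c))\<^sup>2) * 2 * ((x - c) \<bullet> \<phi> x)"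
      by (simp add: G_def power2_norm_eq_inner)
    also have "\<dots> \<le> w ((norm (x - c))\<^sup>2) * 2 * norm (x - c)"
    proof (intro mult_left_mono)
      have "(x - c) \<bullet> \<phi> x \<le> norm (x - c) * norm (\<phi> x)" by (rule norm_cauchy_schwarz)
      also have "\<dots> \<le> norm (x - c) * 1" using \<phi>(2) by (intro mult_left_mono) auto
      finally show "(x - c) \<bullet> \<phi> x \<le> norm (x - c)" by simp
    qed (use \<eta>(3) in auto)
    finally show "- (G x \<bullet> \<phi> x) \<le> 2 * norm (x - c) * w ((norm (x - c))\<^sup>2)" by (simp add: mult_ac)
  qed
  finally have main: "(LINT x|lborel. U x * divergence \<phi> x) \<le> sphere_area TYPE('a) * (\<rho> + e) ^ (DIM('a) - 1)"
    using real eq by linarith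
  have sq: "(x - c) \<bullet> (x - c) = (dist c x)\<^sup>2" for x by (simp add: dist_norm norm_minus_commute power2_norm_eq_inner[symmetric])
  show ?thesis
  proof (rule that[OF main cU])
    show "0 \<le> U x" "U x \<le> 1" for x using \<eta>(8,9) by (auto simp: U_def)
    show "U x = 1" if "x \<in> cball c \<rho>" for x
      unfolding U_def sq using that by (intro \<eta>(6) power_mono) auto
    show "U x = 0" if "dist c x \<ge> \<rho> + e" for x
      unfolding U_def sq using that \<rho> e by (intro \<eta>(7) power_mono) auto
  qed
qed

text \<open>For each competitor separately, the continuous cutoffs with transition width e n
  converge to the indicator of the ball, and dominated convergence passes the bound on.\<close>

lemma perimeter_cball_le:
  fixes c :: "'a::euclidean_space"
  assumes \<rho>: "\<rho> > 0"
  shows "perimeter (cball c \<rho>) \<le> ennreal (sphere_area TYPE('a) * \<rho> ^ (DIM('a) - 1))"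
  unfolding perimeter_def
proof (rule SUP_least, safe)
  fix \<phi> :: "'a \<Rightarrow> 'a" assume \<phi>: "C1c \<phi>" "\<forall>x. norm (\<phi> x) \<le> 1"
  have C1\<phi>: "C1 \<phi>" using \<phi>(1) by (simp add: C1c_iff)
  have cdiv: "continuous_on UNIV (divergence \<phi>)" by (rule continuous_divergence[OF C1\<phi>])
  have idiv: "integrable lborel (divergence \<phi>)"
    by (rule integrable_continuous_bounded_support[OF cdiv bounded_support_divergence[OF \<phi>(1)]])
  have m: "(\<lambda>x. indicator (cball c \<rho>) x *\<^sub>R divergence \<phi> x) \<in> borel_measurable lborel"
    using cdiv by (intro borel_measurable_scaleR borel_measurable_indicator) (auto intro!: borel_measurable_continuous_onI)
  have eq: "(LINT x:cball c \<rho>|lebesgue. divergence \<phi> x) = (LINT x|lborel. indicator (cball c \<rho>) x * divergence \<phi> x)"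
    unfolding set_lebesgue_integral_def using integral_completion[OF m] by simp
  define e where "e n = inverse (real (Suc n))" for n
  have e: "e n > 0" for n by (simp add: e_def)
  have elim: "e \<longlonglongrightarrow> 0" unfolding e_def by (rule LIMSEQ_inverse_real_of_nat)
  have "\<forall>n. \<exists>U. (LINT x|lborel. U x * divergence \<phi> x) \<le> sphere_area TYPE('a) * (\<rho> + e n) ^ (DIM('a) - 1)
    \<and> continuous_on UNIV U \<and> (\<forall>x. 0 \<le> U x) \<and> (\<forall>x. U x \<le> 1) \<and> (\<forall>x. x \<in> cball c \<rho> \<longrightarrow> U x = 1) \<and> (\<forall>x. dist c x \<ge> \<rho> + e n \<longrightarrow> U x = 0)"
    by (intro allI, rule integral_divergence_cball_le[where c=c, OF \<phi>(1) _ \<rho> e], use \<phi>(2) in blast, blast)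
  from choice[OF this] obtain U where "\<forall>n. (LINT x|lborel. U n x * divergence \<phi> x) \<le> sphere_area TYPE('a) * (\<rho> + e n) ^ (DIM('a) - 1)
    \<and> continuous_on UNIV (U n) \<and> (\<forall>x. 0 \<le> U n x) \<and> (\<forall>x. U n x \<le> 1) \<and> (\<forall>x. x \<in> cball c \<rho> \<longrightarrow> U n x = 1) \<and> (\<forall>x. dist c x \<ge> \<rho> + e n \<longrightarrow> U n x = 0)"
    by blast
  then have U: "\<And>n. (LINT x|lborel. U n x * divergence \<phi> x) \<le> sphere_area TYPE('a) * (\<rho> + e n) ^ (DIM('a) - 1)"
    "\<And>n. continuous_on UNIV (U n)" "\<And>n x. 0 \<le> U n x" "\<And>n x. U n x \<le> 1" "\<And>n x. x \<in> cball c \<rho> \<Longrightarrow> U n x = 1"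
    "\<And>n x. dist c x \<ge> \<rho> + e n \<Longrightarrow> U n x = 0"
    by blast+
  have lim: "(\<lambda>n. LINT x|lborel. U n x * divergence \<phi> x) \<longlonglongrightarrow> (LINT x|lborel. indicator (cball c \<rho>) x * divergence \<phi> x)"
  proof (rule integral_dominated_convergence[where w="\<lambda>x. \<bar>divergence \<phi> x\<bar>"])
    show "(\<lambda>x. indicator (cball c \<rho>) x * divergence \<phi> x) \<in> borel_measurable lborel" using m by simp
    show "(\<lambda>x. U n x * divergence \<phi> x) \<in> borel_measurable lborel" for n
      by (auto intro!: borel_measurable_continuous_onI continuous_intros U cdiv)
    show "integrable lborel (\<lambda>x. \<bar>divergence \<phi> x\<bar>)" using idiv by simp
    show "AE x in lborel. norm (U n x * divergence \<phi> x) \<le> \<bar>divergence \<phi> x\<bar>" for n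
      using U(3,4) by (intro AE_I2) (simp add: abs_mult mult_left_le_one_le)
    show "AE x in lborel. (\<lambda>n. U n x * divergence \<phi> x) \<longlonglongrightarrow> indicator (cball c \<rho>) x * divergence \<phi> x"
    proof (intro AE_I2 tendsto_intros tendsto_eventually)
      fix x
      show "\<forall>\<^sub>F n in sequentially. U n x = indicator (cball c \<rho>) x"
      proof (cases "x \<in> cball c \<rho>")
        case True then show ?thesis using U(5) by simp
      next
        case False
        then have "dist c x - \<rho> > 0" by simp
        from order_tendstoD(2)[OF elim this] show ?thesis
          by eventually_elim (use False U(6) in auto)
      qed
    qed
  qed
  have "(\<lambda>n. sphere_area TYPE('a) * (\<rho> + e n) ^ (DIM('a) - 1)) \<longlonglongrightarrow> sphere_area TYPE('a) * (\<rho> + 0) ^ (DIM('a) - 1)"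
    by (intro tendsto_intros elim)
  from LIMSEQ_le[OF lim this] U(1)
  show "ennreal (LINT x:cball c \<rho>|lebesgue. divergence \<phi> x) \<le> ennreal (sphere_area TYPE('a) * \<rho> ^ (DIM('a) - 1))"
    unfolding eq by (intro ennreal_leI) auto
qed

text \<open>Serves twice: for 1 / P of concentric balls, and with 1 / A in place of A for the
  squared norm of the flux field.\<close>

lemma nn_integral_inverse_power:
  fixes r A :: real
  assumes "r > 0" "A > 0" "k \<ge> 1"
  shows "(\<integral>\<^sup>+t\<in>{r..}. ennreal (1 / (A * t ^ (k + 1))) \<partial>lborel) = ennreal (1 / (A * k * r ^ k))"
proof -
  have "(\<integral>\<^sup>+t. ennreal (1 / (A * t ^ (k + 1))) * indicator {r..} t \<partial>lborel) = ennreal (0 - (- (1 / (A * k * r ^ k))))"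
  proof (rule nn_integral_FTC_atLeast[where F="\<lambda>t. - (1 / (A * k * t ^ k))"])
    show "((\<lambda>t. - (1 / (A * k * t ^ k))) has_real_derivative 1 / (A * t ^ (k + 1))) (at t)" if "r \<le> t" for t
    proof -
      have t: "t > 0" using that assms by simp
      obtain j where j: "k = Suc j" using assms(3) by (cases k) auto
      have "((\<lambda>t. t ^ k) has_real_derivative real k * t ^ j) (at t)"
        using DERIV_pow[of k t UNIV] by (simp add: j)
      from DERIV_cmult[OF DERIV_inverse_fun[OF this], of "- (1 / (A * k))"] t
      have "((\<lambda>t. - (1 / (A * k)) * inverse (t ^ k)) has_real_derivative
          - (1 / (A * k)) * - (real k * t ^ j * inverse ((t ^ k) ^ 2))) (at t)"
        by (simp add: numeral_2_eq_2)
      moreover have "- (1 / (A * k)) * - (real k * t ^ j * inverse ((t ^ k) ^ 2)) = 1 / (A * t ^ (k + 1))"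
        using t assms by (simp add: j power2_eq_square divide_simps del: of_nat_Suc)
      moreover have "(\<lambda>t. - (1 / (A * k)) * inverse (t ^ k)) = (\<lambda>t. - (1 / (A * k * t ^ k)))"
        by (simp add: divide_inverse)
      ultimately show ?thesis by simp
    qed
    show "((\<lambda>t. - (1 / (A * k * t ^ k))) \<longlongrightarrow> 0) at_top"
    proof -
      have "filterlim (\<lambda>t. A * real k * t ^ k) at_top at_top"
        using assms by (intro filterlim_tendsto_pos_mult_at_top[OF tendsto_const] filterlim_pow_at_top filterlim_ident) auto
      from tendsto_minus[OF tendsto_divide_0[OF tendsto_const filterlim_at_top_imp_at_infinity[OF this], of 1]]
      show ?thesis by simp
    qed
  qed (use assms in auto)
  then show ?thesis by simp
qed

text \<open>The second radius s decouples the bound from r: s = r serves proper balls, while r = 0,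
  a single point, is reached by letting s tend to 0. Since P is at most A (s + t)^(d - 1), the
  substitution s + t leads to a power integral over \<open>{s..}\<close>.\<close>

lemma inverse_integral_cball_le:
  fixes c :: "'a::euclidean_space"
  assumes d: "DIM('a) \<ge> 3" and r: "0 \<le> r" "r \<le> s" "0 < s"
  shows "inverse (\<integral>\<^sup>+ t\<in>{0<..}. inverse (perimeter (cball c (r + t))) \<partial>lborel)
    \<le> ennreal (sphere_area TYPE('a) * (real (DIM('a)) - 2) * s ^ (DIM('a) - 2))"
proof -
  define A where "A = sphere_area TYPE('a)"
  define k where "k = DIM('a) - 2"
  have k: "k \<ge> 1" "DIM('a) - 1 = k + 1" "real (DIM('a)) - 2 = real k" using d by (auto simp: k_def)
  have A: "A > 0" unfolding A_def by (rule sphere_area_pos)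
  have "ennreal (1 / (A * k * s ^ k)) = (\<integral>\<^sup>+t\<in>{s..}. ennreal (1 / (A * t ^ (k + 1))) \<partial>lborel)"
    by (rule nn_integral_inverse_power[OF r(3) A k(1), symmetric])
  also have "\<dots> = (\<integral>\<^sup>+t. ennreal (1 / (A * (s + t) ^ (k + 1))) * indicator {s..} (s + t) \<partial>lborel)"
    by (subst nn_integral_real_affine[where c=1 and t=s]) auto
  also have "\<dots> \<le> (\<integral>\<^sup>+ t\<in>{0<..}. inverse (perimeter (cball c (r + t))) \<partial>lborel)"
  proof -
    \<comment> \<open>The shifted domain contains t = 0; this point is dropped as a null
      set.\<close>
    have "(\<integral>\<^sup>+t. ennreal (1 / (A * (s + t) ^ (k + 1))) * indicator {s..} (s + t) \<partial>lborel)
        = (\<integral>\<^sup>+t. ennreal (1 / (A * (s + t) ^ (k + 1))) * indicator {0<..} t \<partial>lborel)"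
    proof (rule nn_integral_cong_AE)
      show "AE t in lborel. ennreal (1 / (A * (s + t) ^ (k + 1))) * indicator {s..} (s + t) = ennreal (1 / (A * (s + t) ^ (k + 1))) * indicator {0<..} t"
        using AE_lborel_singleton[of 0] by eventually_elim (auto simp: indicator_def)
    qed
    also have "\<dots> \<le> (\<integral>\<^sup>+ t\<in>{0<..}. inverse (perimeter (cball c (r + t))) \<partial>lborel)"
    proof (rule nn_integral_mono)
      fix t :: real
      show "ennreal (1 / (A * (s + t) ^ (k + 1))) * indicator {0<..} t \<le> inverse (perimeter (cball c (r + t))) * indicator {0<..} t"
      proof (cases "t > 0")
        case True
        have "perimeter (cball c (r + t)) \<le> ennreal (A * (r + t) ^ (k + 1))"
          unfolding A_def k(2)[symmetric] using True r by (intro perimeter_cball_le) auto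
        also have "\<dots> \<le> ennreal (A * (s + t) ^ (k + 1))"
          using r True A by (intro ennreal_leI mult_left_mono power_mono) auto
        finally have "inverse (ennreal (A * (s + t) ^ (k + 1))) \<le> inverse (perimeter (cball c (r + t)))"
          by (rule ennreal_inverse_antimono)
        then show ?thesis using True A r by (subst (asm) inverse_ennreal) (auto simp: inverse_eq_divide)
      qed simp
    qed
    finally show ?thesis .
  qed
  finally have "inverse (\<integral>\<^sup>+ t\<in>{0<..}. inverse (perimeter (cball c (r + t))) \<partial>lborel) \<le> inverse (ennreal (1 / (A * k * s ^ k)))"
    by (rule ennreal_inverse_antimono)
  also have "\<dots> = ennreal (A * k * s ^ k)" using A k(1) r(3) by (subst inverse_ennreal) auto
  finally show ?thesis by (simp add: A_def k(3) k_def[symmetric])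
qed

section \<open>Lower bound for the capacity of a ball\<close>

lemma Cauchy_Schwarz_integral:
  fixes f g :: "'a \<Rightarrow> real"
  assumes [measurable]: "f \<in> borel_measurable M" "g \<in> borel_measurable M"
    and f: "integrable M (\<lambda>x. (f x)\<^sup>2)" and g: "integrable M (\<lambda>x. (g x)\<^sup>2)"
  shows "integrable M (\<lambda>x. f x * g x)"
    and "\<bar>LINT x|M. f x * g x\<bar> \<le> sqrt (LINT x|M. (f x)\<^sup>2) * sqrt (LINT x|M. (g x)\<^sup>2)"
proof -
  have "\<bar>f x * g x\<bar> \<le> (f x)\<^sup>2 + (g x)\<^sup>2" for x
  proof -
    have "\<bar>f x\<bar> * \<bar>g x\<bar> \<le> 2 * \<bar>f x\<bar> * \<bar>g x\<bar>" by simp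
    also have "\<dots> \<le> \<bar>f x\<bar>\<^sup>2 + \<bar>g x\<bar>\<^sup>2" by (rule sum_squares_bound)
    finally show ?thesis by (simp add: abs_mult)
  qed
  then show int: "integrable M (\<lambda>x. f x * g x)"
    by (intro Bochner_Integration.integrable_bound[OF Bochner_Integration.integrable_add[OF f g]]) auto
  have "ennreal ((LINT x|M. \<bar>f x * g x\<bar>)\<^sup>2) = (\<integral>\<^sup>+x. ennreal \<bar>f x * g x\<bar> \<partial>M)\<^sup>2"
    using nn_integral_eq_integral[OF integrable_abs[OF int]] by (simp add: ennreal_power)
  also have "\<dots> = (\<integral>\<^sup>+x. ennreal \<bar>f x\<bar> * ennreal \<bar>g x\<bar> \<partial>M)\<^sup>2"
    by (simp add: abs_mult ennreal_mult)
  also have "\<dots> \<le> (\<integral>\<^sup>+x. ennreal \<bar>f x\<bar> ^ 2 \<partial>M) * (\<integral>\<^sup>+x. ennreal \<bar>g x\<bar> ^ 2 \<partial>M)"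
    by (rule Cauchy_Schwarz_nn_integral) auto
  also have "\<dots> = ennreal ((LINT x|M. (f x)\<^sup>2) * (LINT x|M. (g x)\<^sup>2))"
    using nn_integral_eq_integral[OF f] nn_integral_eq_integral[OF g]
    by (simp add: ennreal_power ennreal_mult)
  finally have "(LINT x|M. \<bar>f x * g x\<bar>)\<^sup>2 \<le> (LINT x|M. (f x)\<^sup>2) * (LINT x|M. (g x)\<^sup>2)"
    by (subst (asm) ennreal_le_iff) auto
  then have "(LINT x|M. \<bar>f x * g x\<bar>) \<le> sqrt ((LINT x|M. (f x)\<^sup>2) * (LINT x|M. (g x)\<^sup>2))"
    by (rule real_le_rsqrt)
  moreover have "\<bar>LINT x|M. f x * g x\<bar> \<le> (LINT x|M. \<bar>f x * g x\<bar>)" by (rule integral_abs_bound)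
  ultimately show "\<bar>LINT x|M. f x * g x\<bar> \<le> sqrt (LINT x|M. (f x)\<^sup>2) * sqrt (LINT x|M. (g x)\<^sup>2)"
    unfolding real_sqrt_mult by (rule order_trans[rotated])
qed

lemma sum_inner_Basis_sq: "(\<Sum>b\<in>Basis. (y \<bullet> b)\<^sup>2) = (norm (y::'a::euclidean_space))\<^sup>2"
  unfolding power2_norm_eq_inner euclidean_inner[of y y] by (simp add: power2_eq_square)

text \<open>The root of a Bochner integral, hence 0 when f^2 is not integrable; the bounds below
  concern square-integrable functions only.\<close>

definition L2norm :: "'a measure \<Rightarrow> ('a \<Rightarrow> real) \<Rightarrow> real" where
  "L2norm M f = sqrt (LINT x|M. (f x)\<^sup>2)"

lemma L2norm_nonneg: "0 \<le> L2norm M f"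
  by (simp add: L2norm_def)

section \<open>Difference quotients of a continuous function with square-integrable weak
  gradient\<close>

context
  fixes u :: "'a::euclidean_space \<Rightarrow> real" and g :: "'a \<Rightarrow> 'a"
  assumes u: "continuous_on UNIV u" and wg: "weak_gradient u g"
    and fin: "(\<integral>\<^sup>+ x. ennreal ((norm (g x))\<^sup>2) \<partial>lebesgue) < \<infinity>"
begin

lemma g_measurable: "g \<in> borel_measurable lebesgue"
  using wg by (simp add: weak_gradient_def)

lemma integrable_norm_g: "integrable lebesgue (\<lambda>x. (norm (g x))\<^sup>2)"
  using g_measurable fin by (intro integrableI_nonneg) auto

lemma integrable_g_Basis:
  assumes "b \<in> Basis" shows "integrable lebesgue (\<lambda>x. (g x \<bullet> b)\<^sup>2)"
proof (rule Bochner_Integration.integrable_bound[OF integrable_norm_g])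
  show "(\<lambda>x. (g x \<bullet> b)\<^sup>2) \<in> borel_measurable lebesgue" using g_measurable by measurable
  show "AE x in lebesgue. norm ((g x \<bullet> b)\<^sup>2) \<le> norm ((norm (g x))\<^sup>2)"
  proof (rule AE_I2)
    fix x
    have "\<bar>g x \<bullet> b\<bar> \<le> norm (g x)" using assms by (rule Basis_le_norm)
    then have "\<bar>g x \<bullet> b\<bar>\<^sup>2 \<le> (norm (g x))\<^sup>2" by (intro power_mono) auto
    then show "norm ((g x \<bullet> b)\<^sup>2) \<le> norm ((norm (g x))\<^sup>2)" by simp
  qed
qed

text \<open>Along the translation the derivative is minus the integral of g . b against the
  translated \<psi>. Translation preserves the L2 norm of \<psi>, so this derivative is bounded
  uniformly and the mean value theorem applies.\<close>

lemma translate_test_bound: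
  assumes b: "b \<in> Basis" and \<psi>: "C1c \<psi>"
  shows "\<bar>(LINT x|lborel. u x * \<psi> (x + s *\<^sub>R b)) - (LINT x|lborel. u x * \<psi> x)\<bar>
    \<le> L2norm lebesgue (\<lambda>x. g x \<bullet> b) * L2norm lborel \<psi> * \<bar>s\<bar>"
proof -
  define J where "J t = (LINT x|lborel. u x * \<psi> (x + t *\<^sub>R b))" for t
  define J' where "J' t = (LINT x|lborel. u x * frechet_derivative \<psi> (at (x + t *\<^sub>R b)) b)" for t
  have dJ: "(J has_real_derivative J' t) (at t)" for t
    unfolding J_def J'_def by (rule has_real_derivative_integral_translate[OF u \<psi>])
  have C1\<psi>: "C1 \<psi>" using \<psi> by (simp add: C1c_iff)
  have J'_le: "\<bar>J' t\<bar> \<le> L2norm lebesgue (\<lambda>x. g x \<bullet> b) * L2norm lborel \<psi>" for t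
  proof -
    define \<psi>t where "\<psi>t x = \<psi> (x + t *\<^sub>R b)" for x
    have \<psi>t: "C1c \<psi>t" unfolding \<psi>t_def by (rule C1c_translate[OF \<psi>])
    have C1t: "C1 \<psi>t" using \<psi>t by (simp add: C1c_iff)
    have ct: "continuous_on UNIV \<psi>t" by (rule C1_continuous[OF C1t])
    have m: "(\<lambda>x. u x * frechet_derivative \<psi>t (at x) b) \<in> borel_measurable lborel"
      by (auto intro!: borel_measurable_continuous_onI continuous_intros u C1_continuous_derivative C1t)
    have "J' t = (LINT x|lborel. u x * frechet_derivative \<psi>t (at x) b)"
      unfolding J'_def \<psi>t_def C1_translate(2)[OF C1\<psi>] by simp
    also have "\<dots> = (LINT x|lebesgue. u x * frechet_derivative \<psi>t (at x) b)"
      by (rule integral_completion[OF m, symmetric])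
    also have "\<dots> = - (LINT x|lebesgue. (g x \<bullet> b) * \<psi>t x)"
      using wg \<psi>t b by (simp add: weak_gradient_def)
    finally have "\<bar>J' t\<bar> = \<bar>LINT x|lebesgue. (g x \<bullet> b) * \<psi>t x\<bar>" by simp
    also have "\<dots> \<le> sqrt (LINT x|lebesgue. (g x \<bullet> b)\<^sup>2) * sqrt (LINT x|lebesgue. (\<psi>t x)\<^sup>2)"
    proof (rule Cauchy_Schwarz_integral(2))
      show "(\<lambda>x. g x \<bullet> b) \<in> borel_measurable lebesgue" using g_measurable by measurable
      have mt: "\<psi>t \<in> borel_measurable lborel" using borel_measurable_continuous_onI[OF ct] by simp
      then show "\<psi>t \<in> borel_measurable lebesgue" by (rule measurable_completion)
      show "integrable lebesgue (\<lambda>x. (g x \<bullet> b)\<^sup>2)" by (rule integrable_g_Basis[OF b])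
      have "integrable lborel (\<lambda>x. (\<psi>t x)\<^sup>2)"
        using \<psi>t by (intro integrable_continuous_bounded_support continuous_intros ct) (simp add: C1c_iff)
      then show "integrable lebesgue (\<lambda>x. (\<psi>t x)\<^sup>2)"
        using integrable_completion borel_measurable_integrable by blast
    qed
    also have "(LINT x|lebesgue. (\<psi>t x)\<^sup>2) = (LINT x|lborel. (\<psi>t x)\<^sup>2)"
      by (rule integral_completion) (auto intro!: borel_measurable_continuous_onI continuous_intros ct)
    also have "\<dots> = (LINT x|lborel. (\<psi> x)\<^sup>2)"
      unfolding \<psi>t_def
      by (rule integral_lborel_translate[of "\<lambda>x. (\<psi> x)\<^sup>2"]) (auto intro!: borel_measurable_continuous_onI continuous_intros C1_continuous[OF C1\<psi>])
    finally show ?thesis by (simp add: L2norm_def)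
  qed
  have "norm (J s - J 0) \<le> (L2norm lebesgue (\<lambda>x. g x \<bullet> b) * L2norm lborel \<psi>) * norm (s - 0)"
    by (rule field_differentiable_bound[of UNIV J J']) (use dJ J'_le in \<open>auto simp: has_field_derivative_at_within\<close>)
  then show ?thesis by (simp add: J_def)
qed

text \<open>The test functions are \<open>\<xi> p\<close> with polynomials \<open>p\<close> approximating the difference itself (Stone-Weierstrass).\<close>

lemma translate_diff_L2_bound:
  assumes b: "b \<in> Basis" and \<xi>: "C1c \<xi>" "\<And>x. 0 \<le> \<xi> x" "\<And>x. \<xi> x \<le> 1"
  shows "(LINT x|lborel. \<xi> x * (u (x + s *\<^sub>R b) - u x)\<^sup>2) \<le> (L2norm lebesgue (\<lambda>x. g x \<bullet> b) * \<bar>s\<bar>)\<^sup>2"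
proof -
  define f where "f x = u (x + s *\<^sub>R b) - u x" for x
  have cus: "continuous_on UNIV (\<lambda>x. u (x + s *\<^sub>R b))"
    by (rule continuous_on_compose2[OF u]) (auto intro!: continuous_intros)
  have cf: "continuous_on UNIV f" unfolding f_def by (intro continuous_intros cus u)
  have C1\<xi>: "C1 \<xi>" using \<xi>(1) by (simp add: C1c_iff)
  have c\<xi>: "continuous_on UNIV \<xi>" by (rule C1_continuous[OF C1\<xi>])
  have supp: "bounded {x. \<xi> x * F x \<noteq> 0}" for F
    using \<xi>(1) by (auto simp: C1c_iff intro: bounded_subset)
  obtain R where R: "{x. \<xi> x \<noteq> 0} \<subseteq> cball 0 R" using \<xi>(1) by (metis C1c_iff bounded_subset_cballD)
  define e where "e n = inverse (real (Suc n))" for n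
  have e: "e n > 0" "e n \<le> 1" for n by (auto simp: e_def inverse_le_1_iff)
  have elim: "e \<longlonglongrightarrow> 0" unfolding e_def by (rule LIMSEQ_inverse_real_of_nat)
  have "\<forall>n. \<exists>p. real_polynomial_function p \<and> (\<forall>x\<in>cball 0 R. \<bar>f x - p x\<bar> < e n)"
  proof
    fix n
    have "compact (cball (0::'a) R)" "continuous_on (cball 0 R) f" using cf continuous_on_subset by auto
    from Stone_Weierstrass_real_polynomial_function[OF this e(1)[of n]]
    show "\<exists>p. real_polynomial_function p \<and> (\<forall>x\<in>cball 0 R. \<bar>f x - p x\<bar> < e n)" by metis
  qed
  then obtain p where p: "\<And>n. real_polynomial_function (p n)" "\<And>n x. x \<in> cball 0 R \<Longrightarrow> \<bar>f x - p n x\<bar> < e n"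
    by metis
  have C1p: "C1 (p n)" for n by (rule C1_real_polynomial_function[OF p(1)])
  have cp: "continuous_on UNIV (p n)" for n by (rule C1_continuous[OF C1p])
  have plim: "(\<lambda>n. p n x) \<longlonglongrightarrow> f x" if "x \<in> cball 0 R" for x
  proof (rule LIMSEQ_I)
    fix r :: real assume "r > 0"
    from order_tendstoD(2)[OF elim this] obtain N where "\<And>n. n \<ge> N \<Longrightarrow> e n < r"
      unfolding eventually_sequentially by blast
    then show "\<exists>N. \<forall>n\<ge>N. norm (p n x - f x) < r"
      using p(2)[OF that] by (metis abs_minus_commute order_less_trans real_norm_def)
  qed
  have pB: "\<bar>p n x\<bar> \<le> \<bar>f x\<bar> + 1" if "x \<in> cball 0 R" for n x
    using p(2)[OF that, of n] e(2)[of n] by linarith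
  define Q where "Q = (LINT x|lborel. \<xi> x * (f x)\<^sup>2)"
  define N where "N = L2norm lebesgue (\<lambda>x. g x \<bullet> b) * \<bar>s\<bar>"
  have N0: "N \<ge> 0" by (simp add: N_def L2norm_nonneg)
  have ineq: "(LINT x|lborel. \<xi> x * (f x * p n x)) \<le> N * sqrt (LINT x|lborel. (\<xi> x * p n x)\<^sup>2)" for n
  proof -
    define \<psi> where "\<psi> x = \<xi> x * p n x" for x
    have \<psi>: "C1c \<psi>" unfolding \<psi>_def by (rule C1c_mult[OF \<xi>(1) C1p])
    have c\<psi>: "continuous_on UNIV \<psi>" using \<psi> by (simp add: C1c_iff C1_continuous)
    have i: "integrable lborel (\<lambda>x. F x * \<psi> x)" if "continuous_on UNIV F" for F
      using \<psi> that by (intro integrable_continuous_bounded_support continuous_intros c\<psi>) (auto simp: C1c_iff intro: bounded_subset)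
    have c\<psi>s: "continuous_on UNIV (\<lambda>x. \<psi> (x + (- s) *\<^sub>R b))"
      by (rule continuous_on_compose2[OF c\<psi>]) (auto intro!: continuous_intros)
    have "(LINT x|lborel. \<xi> x * (f x * p n x)) = (LINT x|lborel. u (x + s *\<^sub>R b) * \<psi> x - u x * \<psi> x)"
      by (intro Bochner_Integration.integral_cong refl) (simp add: f_def \<psi>_def algebra_simps)
    also have "\<dots> = (LINT x|lborel. u (x + s *\<^sub>R b) * \<psi> x) - (LINT x|lborel. u x * \<psi> x)"
      by (intro Bochner_Integration.integral_diff i cus u)
    \<comment> \<open>Translation invariance moves the shift from u to the test function, where the
      previous bound applies.\<close>
    also have "(LINT x|lborel. u (x + s *\<^sub>R b) * \<psi> x) = (LINT x|lborel. u x * \<psi> (x + (- s) *\<^sub>R b))"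
      using integral_lborel_translate[of "\<lambda>x. u x * \<psi> (x + (- s) *\<^sub>R b)" "s *\<^sub>R b"] c\<psi>s u
      by (simp add: borel_measurable_continuous_onI continuous_on_mult)
    also have "(LINT x|lborel. u x * \<psi> (x + (- s) *\<^sub>R b)) - (LINT x|lborel. u x * \<psi> x) \<le> L2norm lebesgue (\<lambda>x. g x \<bullet> b) * L2norm lborel \<psi> * \<bar>- s\<bar>"
      using translate_test_bound[OF b \<psi>, of "- s"] by linarith
    finally show ?thesis by (simp add: N_def L2norm_def \<psi>_def mult_ac)
  qed
  have \<xi>0: "\<xi> x = 0" if "x \<notin> cball 0 R" for x using R that by auto
  have lim1: "(\<lambda>n. LINT x|lborel. \<xi> x * (f x * p n x)) \<longlonglongrightarrow> (LINT x|lborel. \<xi> x * (f x * f x))"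
  proof (rule integral_dominated_convergence[where w="\<lambda>x. \<xi> x * (\<bar>f x\<bar> * (\<bar>f x\<bar> + 1))"])
    show "(\<lambda>x. \<xi> x * (f x * f x)) \<in> borel_measurable lborel"
      "(\<lambda>x. \<xi> x * (f x * p n x)) \<in> borel_measurable lborel" for n
      by (auto intro!: borel_measurable_continuous_onI continuous_intros c\<xi> cf cp)
    show "integrable lborel (\<lambda>x. \<xi> x * (\<bar>f x\<bar> * (\<bar>f x\<bar> + 1)))"
      by (intro integrable_continuous_bounded_support continuous_intros c\<xi> cf supp)
    show "AE x in lborel. (\<lambda>n. \<xi> x * (f x * p n x)) \<longlonglongrightarrow> \<xi> x * (f x * f x)"
    proof (rule AE_I2)
      fix x
      show "(\<lambda>n. \<xi> x * (f x * p n x)) \<longlonglongrightarrow> \<xi> x * (f x * f x)"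
        by (cases "x \<in> cball 0 R") (auto intro!: tendsto_intros plim simp del: mem_cball simp: \<xi>0)
    qed
    show "AE x in lborel. norm (\<xi> x * (f x * p n x)) \<le> \<xi> x * (\<bar>f x\<bar> * (\<bar>f x\<bar> + 1))" for n
    proof (rule AE_I2)
      fix x
      show "norm (\<xi> x * (f x * p n x)) \<le> \<xi> x * (\<bar>f x\<bar> * (\<bar>f x\<bar> + 1))"
      proof (cases "x \<in> cball 0 R")
        case True
        then show ?thesis using pB[OF True, of n] \<xi>(2)[of x] by (simp add: abs_mult mult_left_mono)
      qed (simp add: \<xi>0)
    qed
  qed
  have lim2: "(\<lambda>n. LINT x|lborel. (\<xi> x * p n x)\<^sup>2) \<longlonglongrightarrow> (LINT x|lborel. (\<xi> x * f x)\<^sup>2)"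
  proof (rule integral_dominated_convergence[where w="\<lambda>x. \<xi> x * (\<xi> x * (\<bar>f x\<bar> + 1)\<^sup>2)"])
    show "(\<lambda>x. (\<xi> x * f x)\<^sup>2) \<in> borel_measurable lborel"
      "(\<lambda>x. (\<xi> x * p n x)\<^sup>2) \<in> borel_measurable lborel" for n
      by (auto intro!: borel_measurable_continuous_onI continuous_intros c\<xi> cf cp)
    show "integrable lborel (\<lambda>x. \<xi> x * (\<xi> x * (\<bar>f x\<bar> + 1)\<^sup>2))"
      by (intro integrable_continuous_bounded_support continuous_intros c\<xi> cf supp)
    show "AE x in lborel. (\<lambda>n. (\<xi> x * p n x)\<^sup>2) \<longlonglongrightarrow> (\<xi> x * f x)\<^sup>2"
    proof (rule AE_I2)
      fix x
      show "(\<lambda>n. (\<xi> x * p n x)\<^sup>2) \<longlonglongrightarrow> (\<xi> x * f x)\<^sup>2"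
        by (cases "x \<in> cball 0 R") (auto intro!: tendsto_intros plim simp del: mem_cball simp: \<xi>0)
    qed
    show "AE x in lborel. norm ((\<xi> x * p n x)\<^sup>2) \<le> \<xi> x * (\<xi> x * (\<bar>f x\<bar> + 1)\<^sup>2)" for n
    proof (rule AE_I2)
      fix x
      show "norm ((\<xi> x * p n x)\<^sup>2) \<le> \<xi> x * (\<xi> x * (\<bar>f x\<bar> + 1)\<^sup>2)"
      proof (cases "x \<in> cball 0 R")
        case True
        have "\<bar>p n x\<bar>\<^sup>2 \<le> (\<bar>f x\<bar> + 1)\<^sup>2" using pB[OF True, of n] by (intro power_mono) auto
        then have "(\<xi> x)\<^sup>2 * \<bar>p n x\<bar>\<^sup>2 \<le> (\<xi> x)\<^sup>2 * (\<bar>f x\<bar> + 1)\<^sup>2" by (intro mult_left_mono) auto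
        then show ?thesis unfolding real_norm_def abs_power2
          by (simp add: power_mult_distrib power2_eq_square[of "\<xi> x"] mult.assoc)
      qed (simp add: \<xi>0)
    qed
  qed
  have "Q \<le> N * sqrt (LINT x|lborel. (\<xi> x * f x)\<^sup>2)"
    unfolding Q_def power2_eq_square[of "f _"]
    by (rule LIMSEQ_le[OF lim1 tendsto_mult[OF tendsto_const tendsto_real_sqrt[OF lim2]]]) (use ineq in auto)
  also have "\<dots> \<le> N * sqrt Q"
  proof -
    have "(LINT x|lborel. (\<xi> x * f x)\<^sup>2) \<le> Q"
      unfolding Q_def
    proof (rule integral_mono)
      show "integrable lborel (\<lambda>x. (\<xi> x * f x)\<^sup>2)"
        using supp[of f] by (intro integrable_continuous_bounded_support continuous_intros c\<xi> cf) auto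
      show "integrable lborel (\<lambda>x. \<xi> x * (f x)\<^sup>2)"
        by (intro integrable_continuous_bounded_support continuous_intros c\<xi> cf supp)
      fix x
      have "\<xi> x * (\<xi> x * (f x)\<^sup>2) \<le> 1 * (\<xi> x * (f x)\<^sup>2)"
        using \<xi>(2,3)[of x] by (intro mult_right_mono) auto
      then show "(\<xi> x * f x)\<^sup>2 \<le> \<xi> x * (f x)\<^sup>2" by (simp add: power_mult_distrib power2_eq_square mult_ac)
    qed
    then show ?thesis using N0 by (intro mult_left_mono) auto
  qed
  finally have QN: "Q \<le> N * sqrt Q" .
  have Q0: "Q \<ge> 0" unfolding Q_def using \<xi>(2) by simp
  \<comment> \<open>The limit inequality has Q on both sides, because the test functions approach
    the difference itself; dividing by sqrt Q closes the estimate.\<close>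
  have "Q \<le> N\<^sup>2"
  proof (cases "Q = 0")
    case False
    then have "sqrt Q * sqrt Q \<le> N * sqrt Q" "sqrt Q > 0" using QN Q0 by auto
    then have "sqrt Q \<le> N" by (rule mult_right_le_imp_le)
    then have "(sqrt Q)\<^sup>2 \<le> N\<^sup>2" using Q0 by (intro power_mono) auto
    then show ?thesis using Q0 by simp
  qed simp
  then show ?thesis by (simp add: Q_def N_def f_def)
qed

text \<open>Difference quotients replace the chain rule for weak derivatives.\<close>

lemma integral_contraction_derivative_le:
  assumes b: "b \<in> Basis" and \<psi>: "C1c \<psi>" and T: "continuous_on UNIV T" "\<And>x y. \<bar>T x - T y\<bar> \<le> \<bar>u x - u y\<bar>"
  shows "(LINT x|lborel. T x * frechet_derivative \<psi> (at x) b) \<le> L2norm lebesgue (\<lambda>x. g x \<bullet> b) * L2norm lborel \<psi>"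
proof -
  define J where "J t = (LINT x|lborel. T x * \<psi> (x + t *\<^sub>R b))" for t
  define B where "B = L2norm lebesgue (\<lambda>x. g x \<bullet> b) * L2norm lborel \<psi>"
  have C1\<psi>: "C1 \<psi>" using \<psi> by (simp add: C1c_iff)
  have c\<psi>: "continuous_on UNIV \<psi>" by (rule C1_continuous[OF C1\<psi>])
  have "(J has_real_derivative (LINT x|lborel. T x * frechet_derivative \<psi> (at (x + 0 *\<^sub>R b)) b)) (at 0)"
    unfolding J_def by (rule has_real_derivative_integral_translate[OF T(1) \<psi>])
  then have lim: "((\<lambda>s. (J s - J 0) / s) \<longlongrightarrow> (LINT x|lborel. T x * frechet_derivative \<psi> (at x) b)) (at 0)"
    by (simp add: has_field_derivative_iff)
  obtain R where R: "{x. \<psi> x \<noteq> 0} \<subseteq> cball 0 R" using \<psi> by (metis C1c_iff bounded_subset_cballD)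
  \<comment> \<open>Equal to 1 on the support of \<psi>, this cutoff localises the difference of T
    without changing its product with \<psi>, which gives integrable squares.\<close>
  obtain \<xi> :: "'a \<Rightarrow> real" where \<xi>: "C1c \<xi>" "\<And>x. 0 \<le> \<xi> x" "\<And>x. \<xi> x \<le> 1"
    "\<And>x. norm x \<le> R \<Longrightarrow> \<xi> x = 1" "\<And>x. norm x \<ge> \<bar>R\<bar> + 1 \<Longrightarrow> \<xi> x = 0"
    by (rule smooth_cutoff[of R]) blast
  have c\<xi>: "continuous_on UNIV \<xi>" using \<xi>(1) by (simp add: C1c_iff C1_continuous)
  have bound: "J s - J 0 \<le> B * \<bar>s\<bar>" "- (J s - J 0) \<le> B * \<bar>s\<bar>" for s
  proof -
    define F where "F x = T (x + (- s) *\<^sub>R b) - T x" for x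
    have cTs: "continuous_on UNIV (\<lambda>x. T (x + (- s) *\<^sub>R b))"
      by (rule continuous_on_compose2[OF T(1)]) (auto intro!: continuous_intros)
    have cF: "continuous_on UNIV F" unfolding F_def by (intro continuous_intros cTs T(1))
    have c\<psi>s: "continuous_on UNIV (\<lambda>x. \<psi> (x + s *\<^sub>R b))"
      by (rule continuous_on_compose2[OF c\<psi>]) (auto intro!: continuous_intros)
    have i: "integrable lborel (\<lambda>x. h x * \<psi> x)" if "continuous_on UNIV h" for h
      using \<psi> that by (intro integrable_continuous_bounded_support continuous_intros c\<psi>) (auto simp: C1c_iff intro: bounded_subset)
    \<comment> \<open>The shift is moved back from \<psi> to T, so that the contraction property
      compares T with u.\<close>
    have "J s = (LINT x|lborel. T (x + (- s) *\<^sub>R b) * \<psi> x)"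
      using integral_lborel_translate[of "\<lambda>x. T x * \<psi> (x + s *\<^sub>R b)" "(- s) *\<^sub>R b"] c\<psi>s T(1)
      unfolding J_def by (simp add: borel_measurable_continuous_onI continuous_on_mult)
    then have "J s - J 0 = (LINT x|lborel. T (x + (- s) *\<^sub>R b) * \<psi> x - T x * \<psi> x)"
      by (subst Bochner_Integration.integral_diff[OF i[OF cTs] i[OF T(1)]]) (simp add: J_def)
    also have "\<dots> = (LINT x|lborel. (\<xi> x * F x) * \<psi> x)"
    proof (intro Bochner_Integration.integral_cong refl)
      fix x
      show "T (x + (- s) *\<^sub>R b) * \<psi> x - T x * \<psi> x = (\<xi> x * F x) * \<psi> x"
      proof (cases "\<psi> x = 0")
        case False
        then have "norm x \<le> R" using R by auto
        then show ?thesis by (simp add: F_def \<xi>(4) left_diff_distrib)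
      qed simp
    qed
    finally have eq: "J s - J 0 = (LINT x|lborel. (\<xi> x * F x) * \<psi> x)" .
    have i1: "integrable lborel (\<lambda>x. (\<xi> x * F x)\<^sup>2)"
      using \<xi>(1) by (intro integrable_continuous_bounded_support continuous_intros c\<xi> cF) (auto simp: C1c_iff intro: bounded_subset)
    have i2: "integrable lborel (\<lambda>x. (\<psi> x)\<^sup>2)"
      using \<psi> by (intro integrable_continuous_bounded_support continuous_intros c\<psi>) (auto simp: C1c_iff)
    have CS: "\<bar>J s - J 0\<bar> \<le> sqrt (LINT x|lborel. (\<xi> x * F x)\<^sup>2) * L2norm lborel \<psi>"
      unfolding eq L2norm_def
      by (rule Cauchy_Schwarz_integral(2)[OF _ _ i1 i2]) (auto intro!: borel_measurable_continuous_onI continuous_intros c\<xi> cF c\<psi>)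
    have "(LINT x|lborel. (\<xi> x * F x)\<^sup>2) \<le> (LINT x|lborel. \<xi> x * (u (x + (- s) *\<^sub>R b) - u x)\<^sup>2)"
    proof (rule integral_mono[OF i1])
      have cus: "continuous_on UNIV (\<lambda>x. u (x + (- s) *\<^sub>R b))"
        by (rule continuous_on_compose2[OF u]) (auto intro!: continuous_intros)
      show "integrable lborel (\<lambda>x. \<xi> x * (u (x + (- s) *\<^sub>R b) - u x)\<^sup>2)"
        using \<xi>(1) by (intro integrable_continuous_bounded_support continuous_intros c\<xi> cus u) (auto simp: C1c_iff intro: bounded_subset)
      fix x
      have "\<bar>F x\<bar>\<^sup>2 \<le> \<bar>u (x + (- s) *\<^sub>R b) - u x\<bar>\<^sup>2"
        unfolding F_def by (intro power_mono T(2)) auto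
      then have "\<xi> x * (F x)\<^sup>2 \<le> \<xi> x * (u (x + (- s) *\<^sub>R b) - u x)\<^sup>2" using \<xi>(2)[of x] by (intro mult_left_mono) auto
      moreover have "(\<xi> x * F x)\<^sup>2 \<le> \<xi> x * (F x)\<^sup>2"
      proof -
        have "\<xi> x * (\<xi> x * (F x)\<^sup>2) \<le> 1 * (\<xi> x * (F x)\<^sup>2)" using \<xi>(2,3)[of x] by (intro mult_right_mono) auto
        then show ?thesis by (simp add: power_mult_distrib power2_eq_square mult_ac)
      qed
      ultimately show "(\<xi> x * F x)\<^sup>2 \<le> \<xi> x * (u (x + (- s) *\<^sub>R b) - u x)\<^sup>2" by linarith
    qed
    also have "\<dots> \<le> (L2norm lebesgue (\<lambda>x. g x \<bullet> b) * \<bar>- s\<bar>)\<^sup>2"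
      by (rule translate_diff_L2_bound[OF b \<xi>(1,2,3)])
    finally have "sqrt (LINT x|lborel. (\<xi> x * F x)\<^sup>2) \<le> L2norm lebesgue (\<lambda>x. g x \<bullet> b) * \<bar>s\<bar>"
      by (intro real_le_lsqrt) (auto simp: L2norm_nonneg)
    then have "sqrt (LINT x|lborel. (\<xi> x * F x)\<^sup>2) * L2norm lborel \<psi> \<le> L2norm lebesgue (\<lambda>x. g x \<bullet> b) * \<bar>s\<bar> * L2norm lborel \<psi>"
      by (intro mult_right_mono L2norm_nonneg)
    then have "\<bar>J s - J 0\<bar> \<le> B * \<bar>s\<bar>" using CS by (simp add: B_def mult_ac)
    then show "J s - J 0 \<le> B * \<bar>s\<bar>" "- (J s - J 0) \<le> B * \<bar>s\<bar>" by linarith+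
  qed
  \<comment> \<open>Both one-sided bounds are needed, since dividing by a negative s reverses the
    inequality.\<close>
  have "(J s - J 0) / s \<le> B" if "s \<noteq> 0" for s
    using bound[of s] that by (cases "s > 0") (auto simp: divide_simps)
  then have "\<forall>\<^sub>F s in at 0. (J s - J 0) / s \<le> B" by (auto simp: eventually_at intro!: exI[of _ 1])
  then show ?thesis unfolding B_def[symmetric] by (intro tendsto_upperbound[OF lim]) auto
qed

text \<open>The directional bounds are summed over \<open>Basis\<close>; Cauchy-Schwarz for finite
  sums rebuilds the full norms of g and X.\<close>

lemma integral_contraction_divergence_le:
  assumes X: "C1c X" and T: "continuous_on UNIV T" "\<And>x y. \<bar>T x - T y\<bar> \<le> \<bar>u x - u y\<bar>"
  shows "(LINT x|lborel. T x * divergence X x)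
    \<le> sqrt (LINT x|lebesgue. (norm (g x))\<^sup>2) * sqrt (LINT x|lborel. (norm (X x))\<^sup>2)"
proof -
  have C1X: "C1 X" using X by (simp add: C1c_iff)
  have cX: "continuous_on UNIV X" by (rule C1_continuous[OF C1X])
  have comp: "frechet_derivative (\<lambda>x. X x \<bullet> b) (at x) b = frechet_derivative X (at x) b \<bullet> b" for b x
  proof -
    have "((\<lambda>x. X x \<bullet> b) has_derivative (\<lambda>h. frechet_derivative X (at x) h \<bullet> b)) (at x)"
      by (rule has_derivative_inner_left[OF C1_has_derivative[OF C1X]])
    from fun_cong[OF frechet_derivative_at[OF this], of b] show ?thesis by simp
  qed
  have i: "integrable lborel (\<lambda>x. T x * (frechet_derivative X (at x) b \<bullet> b))" for b
    using C1c_derivative_bounded_support[OF X, of b]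
    by (intro integrable_continuous_bounded_support continuous_intros T(1) C1_continuous_derivative[OF C1X])
      (auto intro: bounded_subset[of "{x. frechet_derivative X (at x) b \<noteq> 0}"])
  have "(LINT x|lborel. T x * divergence X x) = (LINT x|lborel. (\<Sum>b\<in>Basis. T x * (frechet_derivative X (at x) b \<bullet> b)))"
    by (simp add: divergence_def sum_distrib_left)
  also have "\<dots> = (\<Sum>b\<in>Basis. LINT x|lborel. T x * (frechet_derivative X (at x) b \<bullet> b))"
    using i by (intro Bochner_Integration.integral_sum)
  also have "\<dots> \<le> (\<Sum>b\<in>Basis. L2norm lebesgue (\<lambda>x. g x \<bullet> b) * L2norm lborel (\<lambda>x. X x \<bullet> b))"
  proof (rule sum_mono)
    fix b :: 'a assume "b \<in> Basis"
    from integral_contraction_derivative_le[OF this C1c_inner_const[OF X, of b] T]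
    show "(LINT x|lborel. T x * (frechet_derivative X (at x) b \<bullet> b)) \<le> L2norm lebesgue (\<lambda>x. g x \<bullet> b) * L2norm lborel (\<lambda>x. X x \<bullet> b)"
      by (simp add: comp)
  qed
  also have "\<dots> \<le> sqrt ((\<Sum>b\<in>Basis. (L2norm lebesgue (\<lambda>x. g x \<bullet> b))\<^sup>2) * (\<Sum>b\<in>Basis. (L2norm lborel (\<lambda>x. X x \<bullet> b))\<^sup>2))"
    by (rule real_le_rsqrt[OF Cauchy_Schwarz_ineq_sum])
  also have "(\<Sum>b\<in>Basis. (L2norm lebesgue (\<lambda>x. g x \<bullet> b))\<^sup>2) = (LINT x|lebesgue. (norm (g x))\<^sup>2)"
  proof -
    have "(\<Sum>b\<in>Basis. (L2norm lebesgue (\<lambda>x. g x \<bullet> b))\<^sup>2) = (\<Sum>b\<in>Basis. LINT x|lebesgue. (g x \<bullet> b)\<^sup>2)"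
      by (simp add: L2norm_def)
    also have "\<dots> = (LINT x|lebesgue. (\<Sum>b\<in>Basis. (g x \<bullet> b)\<^sup>2))"
      using integrable_g_Basis by (intro Bochner_Integration.integral_sum[symmetric])
    finally show ?thesis by (simp only: sum_inner_Basis_sq)
  qed
  also have "(\<Sum>b\<in>Basis. (L2norm lborel (\<lambda>x. X x \<bullet> b))\<^sup>2) = (LINT x|lborel. (norm (X x))\<^sup>2)"
  proof -
    have iX: "integrable lborel (\<lambda>x. (X x \<bullet> b)\<^sup>2)" for b
      using X by (intro integrable_continuous_bounded_support continuous_intros cX)
        (auto simp: C1c_iff intro: bounded_subset[of "{x. X x \<noteq> 0}"])
    have "(\<Sum>b\<in>Basis. (L2norm lborel (\<lambda>x. X x \<bullet> b))\<^sup>2) = (\<Sum>b\<in>Basis. LINT x|lborel. (X x \<bullet> b)\<^sup>2)"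
      by (simp add: L2norm_def)
    also have "\<dots> = (LINT x|lborel. (\<Sum>b\<in>Basis. (X x \<bullet> b)\<^sup>2))"
      using iX by (intro Bochner_Integration.integral_sum[symmetric])
    finally show ?thesis by (simp only: sum_inner_Basis_sq)
  qed
  finally show ?thesis by (simp add: real_sqrt_mult)
qed

end

section \<open>Radial fields and the flux estimate\<close>

lemma radial_field:
  fixes c :: "'a::euclidean_space" and \<kappa> \<kappa>' :: "real \<Rightarrow> real"
  assumes \<kappa>: "\<And>s. (\<kappa> has_real_derivative \<kappa>' s) (at s)" "continuous_on UNIV \<kappa>'"
  defines "X \<equiv> \<lambda>x. \<kappa> ((x - c) \<bullet> (x - c)) *\<^sub>R (x - c)"
  shows "C1 X" "divergence X x = DIM('a) * \<kappa> ((norm (x - c))\<^sup>2) + 2 * (norm (x - c))\<^sup>2 * \<kappa>' ((norm (x - c))\<^sup>2)"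
proof -
  have "C1 (\<lambda>x. \<kappa> ((x - c) \<bullet> (x - c)))"
    by (rule C1_compose_real[OF C1_sq_dist \<kappa>(1)]) (rule continuous_on_subset[OF \<kappa>(2)], simp)
  then show "C1 X" unfolding X_def by (intro C1_scaleR C1_diff_const)
  have "divergence X x = \<kappa> ((x - c) \<bullet> (x - c)) * divergence (\<lambda>x. x - c) x + (\<kappa>' ((x - c) \<bullet> (x - c)) *\<^sub>R (2 *\<^sub>R (x - c))) \<bullet> (x - c)"
    unfolding X_def
    by (rule divergence_scaleR[OF has_derivative_compose_gradient[OF has_derivative_sq_dist \<kappa>(1)] C1_has_derivative[OF C1_diff_const]])
  then show "divergence X x = DIM('a) * \<kappa> ((norm (x - c))\<^sup>2) + 2 * (norm (x - c))\<^sup>2 * \<kappa>' ((norm (x - c))\<^sup>2)"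
    by (simp add: divergence_diff_const power2_norm_eq_inner mult_ac)
qed

text \<open>The power |x - c|^(-d) in the variable s = |x - c|^2, in which all radial profiles are
  written.\<close>

lemma DERIV_inverse_sqrt_power:
  assumes "s > 0" "d > 0"
  shows "((\<lambda>s. inverse (sqrt s ^ d)) has_real_derivative - (real d / (2 * s) * inverse (sqrt s ^ d))) (at s)"
proof -
  obtain j where j: "d = Suc j" using assms(2) by (cases d) auto
  define q where "q = sqrt s"
  have q: "q > 0" "s = q\<^sup>2" using assms(1) by (auto simp: q_def)
  have "((\<lambda>s. sqrt s ^ d) has_real_derivative real d * (inverse (sqrt s) / 2 * sqrt s ^ (d - Suc 0))) (at s)"
    by (rule DERIV_power[OF DERIV_real_sqrt[OF assms(1)]])
  from DERIV_inverse_fun[OF this]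
  have "((\<lambda>s. inverse (sqrt s ^ d)) has_real_derivative
      - (real d * (inverse q / 2 * q ^ j) * inverse ((q ^ d) ^ 2))) (at s)"
    using q by (simp add: q_def[symmetric] j numeral_2_eq_2)
  moreover have "real d * (inverse q / 2 * q ^ j) * inverse ((q ^ d) ^ 2) = real d / (2 * s) * inverse (sqrt s ^ d)"
    unfolding q_def[symmetric] using q by (simp add: j power2_eq_square divide_simps del: of_nat_Suc)
  ultimately show ?thesis by (simp only:)
qed

text \<open>The field is \<open>(x - c) / |x - c|\<^sup>d\<close>, the gradient of the capacitary potential up to a constant,
  switched on between the radii \<open>r0\<close> and \<open>r\<close> and switched off between \<open>R\<close> and \<open>2 R\<close>.\<close>

lemma ex_flux_field:
  fixes c :: "'a::euclidean_space"
  assumes \<eta>1: "\<And>t. (\<eta>1 has_real_derivative - w1 t) (at t)" "continuous_on UNIV w1"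
      "\<And>t. t \<notin> {r0\<^sup>2<..<r\<^sup>2} \<Longrightarrow> w1 t = 0" "\<And>t. t \<le> r0\<^sup>2 \<Longrightarrow> \<eta>1 t = 1" "\<And>t. t \<ge> r\<^sup>2 \<Longrightarrow> \<eta>1 t = 0"
      "\<And>t. 0 \<le> \<eta>1 t" "\<And>t. \<eta>1 t \<le> 1"
    and \<eta>2: "\<And>t. (\<eta>2 has_real_derivative - w2 t) (at t)" "continuous_on UNIV w2"
      "\<And>t. t \<notin> {1<..<4} \<Longrightarrow> w2 t = 0" "\<And>t. t \<le> 1 \<Longrightarrow> \<eta>2 t = 1" "\<And>t. t \<ge> 4 \<Longrightarrow> \<eta>2 t = 0"
      "\<And>t. 0 \<le> \<eta>2 t" "\<And>t. \<eta>2 t \<le> 1"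
    and r: "0 < r0" "r0 < r" "r \<le> R"
  obtains X :: "'a \<Rightarrow> 'a" where "C1c X"
    "\<And>x. divergence X x = 2 * ((norm (x - c))\<^sup>2 / norm (x - c) ^ DIM('a)) * (w1 ((norm (x - c))\<^sup>2) - w2 ((norm (x - c))\<^sup>2 / R\<^sup>2) / R\<^sup>2)"
    "\<And>x. norm (X x) \<le> (if r0 \<le> norm (x - c) then norm (x - c) / norm (x - c) ^ DIM('a) else 0)"
proof -
  define d where "d = DIM('a)"
  have d: "d > 0" by (simp add: d_def)
  have R: "R > 0" using r by linarith
  have r2: "r0\<^sup>2 < r\<^sup>2" "r\<^sup>2 \<le> R\<^sup>2" "r0\<^sup>2 > 0" using r by (auto intro!: power_strict_mono power_mono)
  \<comment> \<open>In the squared radius: 0 up to radius r0, 1 between r and R, and 0 beyond 2 R,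
    the 4 in \<eta>2 being the square of 2.\<close>
  define M where "M s = \<eta>2 (s / R\<^sup>2) - \<eta>1 s" for s
  define M' where "M' s = w1 s - w2 (s / R\<^sup>2) / R\<^sup>2" for s
  have dM: "(M has_real_derivative M' s) (at s)" for s
  proof -
    have "((\<lambda>s. s / R\<^sup>2) has_real_derivative 1 / R\<^sup>2) (at s)"
      by (rule DERIV_cdivide[OF DERIV_ident])
    from DERIV_diff[OF DERIV_chain2[OF \<eta>2(1) this] \<eta>1(1)] show ?thesis
      unfolding M_def M'_def by simp
  qed
  have cM': "continuous_on UNIV M'"
    unfolding M'_def using R by (intro continuous_intros \<eta>1(2) continuous_on_compose2[OF \<eta>2(2)]) auto
  have cM: "continuous_on UNIV M" by (meson dM DERIV_isCont continuous_at_imp_continuous_on)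
  have small: "M s = 0" "M' s = 0" if "s \<le> r0\<^sup>2" for s
  proof -
    have "s / R\<^sup>2 \<le> 1" using that r2 R by (simp add: divide_le_eq)
    then show "M s = 0" "M' s = 0" using that \<eta>1(3,4)[of s] \<eta>2(3,4)[of "s / R\<^sup>2"] by (auto simp: M_def M'_def)
  qed
  have large: "M s = 0" if "s \<ge> 4 * R\<^sup>2" for s
  proof -
    have "s / R\<^sup>2 \<ge> 4" using that R by (simp add: le_divide_eq)
    moreover have "s \<ge> r\<^sup>2" using that r2 by linarith
    ultimately show ?thesis using \<eta>1(5) \<eta>2(5) by (simp add: M_def)
  qed
  have M01: "0 \<le> M s" "M s \<le> 1" for s
  proof -
    show "0 \<le> M s"
    proof (cases "s \<le> R\<^sup>2")
      case True then show ?thesis using \<eta>2(4)[of "s / R\<^sup>2"] \<eta>1(7)[of s] R by (simp add: M_def divide_le_eq)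
    next
      case False then show ?thesis using \<eta>1(5)[of s] \<eta>2(6)[of "s / R\<^sup>2"] r2 by (simp add: M_def)
    qed
    show "M s \<le> 1" using \<eta>2(7)[of "s / R\<^sup>2"] \<eta>1(6)[of s] by (simp add: M_def)
  qed
  define \<kappa> where "\<kappa> s = M s * inverse (sqrt s ^ d)" for s
  define \<kappa>' where "\<kappa>' s = M' s * inverse (sqrt s ^ d) - M s * (real d / (2 * s) * inverse (sqrt s ^ d))" for s
  \<comment> \<open>Below r0^2 the profile is locally 0, which avoids the singularity of the power
    at s = 0.\<close>
  have d\<kappa>: "(\<kappa> has_real_derivative \<kappa>' s) (at s)" for s
  proof (cases "s < r0\<^sup>2")
    case True
    have "((\<lambda>s. 0) has_real_derivative 0) (at s)" by simp
    then have "(\<kappa> has_real_derivative 0) (at s)"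
      by (rule has_field_derivative_transform_within_open[of _ _ _ "{..<r0\<^sup>2}"]) (use True small in \<open>auto simp: \<kappa>_def\<close>)
    then show ?thesis using True small[of s] by (simp add: \<kappa>'_def)
  next
    case False
    then have s: "s > 0" using r2 by linarith
    from DERIV_mult[OF dM DERIV_inverse_sqrt_power[OF s d]] show ?thesis
      unfolding \<kappa>_def \<kappa>'_def by (simp add: algebra_simps)
  qed
  have c\<kappa>': "continuous_on UNIV \<kappa>'"
  proof (rule continuous_at_imp_continuous_on, safe)
    fix s :: real
    show "isCont \<kappa>' s"
    proof (cases "s < r0\<^sup>2")
      case True
      have "\<forall>\<^sub>F t in nhds s. t \<in> {..<r0\<^sup>2}" using True by (intro eventually_nhds_in_open) auto
      then have "\<forall>\<^sub>F t in nhds s. \<kappa>' t = 0" by eventually_elim (simp add: \<kappa>'_def small)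
      then show ?thesis using isCont_cong[of \<kappa>' "\<lambda>_. 0" s] by simp
    next
      case False
      then have s: "s > 0" using r2 by linarith
      have "isCont M s" "isCont M' s" using cM cM' by (auto simp: continuous_on_eq_continuous_at)
      then show ?thesis unfolding \<kappa>'_def using s by (intro continuous_intros) auto
    qed
  qed
  define X :: "'a \<Rightarrow> 'a" where "X x = \<kappa> ((x - c) \<bullet> (x - c)) *\<^sub>R (x - c)" for x
  note rf = radial_field[of \<kappa> \<kappa>' c, OF d\<kappa> c\<kappa>', folded X_def]
  have sq: "(x - c) \<bullet> (x - c) = (norm (x - c))\<^sup>2" for x by (simp add: power2_norm_eq_inner)
  have "C1 X" using rf(1) by (simp add: X_def[abs_def])
  moreover have "bounded {x. X x \<noteq> 0}"
  proof -
    have "dist c x \<le> 2 * R" if "X x \<noteq> 0" for x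
    proof (rule ccontr)
      assume "\<not> dist c x \<le> 2 * R"
      then have "(norm (x - c))\<^sup>2 \<ge> (2 * R)\<^sup>2" using R by (intro power_mono) (auto simp: dist_norm norm_minus_commute)
      then have "M ((norm (x - c))\<^sup>2) = 0" by (intro large) (simp add: power_mult_distrib)
      then show False using that by (simp add: X_def \<kappa>_def sq)
    qed
    then have "{x. X x \<noteq> 0} \<subseteq> cball c (2 * R)" by auto
    then show ?thesis by (meson bounded_cball bounded_subset)
  qed
  ultimately have C: "C1c X" by (simp add: C1c_iff)
  show ?thesis
  proof (rule that[OF C])
    fix x
    define n where "n = norm (x - c)"
    have n0: "n \<ge> 0" by (simp add: n_def)
    have sqn: "sqrt (n\<^sup>2) = n" using n0 by simp
    have "divergence X x = d * \<kappa> (n\<^sup>2) + 2 * n\<^sup>2 * \<kappa>' (n\<^sup>2)"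
      using rf(2)[of x] by (simp add: n_def d_def X_def[abs_def])
    \<comment> \<open>The field x / |x|^d is divergence free away from 0, so the terms with M cancel
      and only M' remains.\<close>
    also have "\<dots> = 2 * (n\<^sup>2 / n ^ d) * M' (n\<^sup>2)"
    proof (cases "n = 0")
      case True
      then show ?thesis using small[of 0] r2 by (simp add: \<kappa>_def)
    next
      case False
      then have eq: "2 * n\<^sup>2 * (M (n\<^sup>2) * (real d / (2 * n\<^sup>2) * inverse (n ^ d))) = d * (M (n\<^sup>2) * inverse (n ^ d))"
        by simp
      have "d * \<kappa> (n\<^sup>2) + 2 * n\<^sup>2 * \<kappa>' (n\<^sup>2) = d * (M (n\<^sup>2) * inverse (n ^ d))
          + (2 * n\<^sup>2 * (M' (n\<^sup>2) * inverse (n ^ d)) - 2 * n\<^sup>2 * (M (n\<^sup>2) * (real d / (2 * n\<^sup>2) * inverse (n ^ d))))"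
        by (simp only: \<kappa>_def \<kappa>'_def sqn right_diff_distrib)
      also have "\<dots> = 2 * n\<^sup>2 * (M' (n\<^sup>2) * inverse (n ^ d))" unfolding eq by simp
      also have "\<dots> = 2 * (n\<^sup>2 / n ^ d) * M' (n\<^sup>2)" by (simp only: divide_inverse mult_ac)
      finally show ?thesis .
    qed
    finally show "divergence X x = 2 * ((norm (x - c))\<^sup>2 / norm (x - c) ^ DIM('a)) * (w1 ((norm (x - c))\<^sup>2) - w2 ((norm (x - c))\<^sup>2 / R\<^sup>2) / R\<^sup>2)"
      by (simp add: M'_def n_def d_def)
    have nX: "norm (X x) = M (n\<^sup>2) * (n / n ^ d)"
      using M01(1)[of "n\<^sup>2"] n0 by (simp add: X_def \<kappa>_def sq n_def[symmetric] abs_mult divide_inverse)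
    show "norm (X x) \<le> (if r0 \<le> norm (x - c) then norm (x - c) / norm (x - c) ^ DIM('a) else 0)"
    proof (cases "r0 \<le> n")
      case True
      have "M (n\<^sup>2) * (n / n ^ d) \<le> 1 * (n / n ^ d)" using M01[of "n\<^sup>2"] n0 by (intro mult_right_mono) auto
      then show ?thesis using True by (simp add: nX n_def d_def)
    next
      case False
      then have "n\<^sup>2 \<le> r0\<^sup>2" using n0 by (intro power_mono) auto
      then show ?thesis using False small[of "n\<^sup>2"] nX by (simp add: n_def)
    qed
  qed
qed

text \<open>Let A be the flux of the field and k = d - 2. Where div X > 0 the truncation equals 1,
  which contributes A; where div X < 0 the truncation contributes little. In the limit A <= sqrt E
  times the norm of X, whose square is at most A / (k r0^k); squaring gives A k r0^k <= E. Limits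
  are taken in the order R to infinity, \<delta> to 0, r0 to r.\<close>

lemma newton_cap_cball_ge:
  fixes c :: "'a::euclidean_space"
  assumes d3: "DIM('a) \<ge> 3" and r: "r > 0"
  shows "ennreal (sphere_area TYPE('a) * (real (DIM('a)) - 2) * r ^ (DIM('a) - 2)) \<le> newton_cap (cball c r)"
  unfolding newton_cap_def
proof (rule INF_greatest, clarify)
  fix u :: "'a \<Rightarrow> real" and g :: "'a \<Rightarrow> 'a"
  assume adm: "cap_admissible (cball c r) u g"
  then have u: "continuous_on UNIV u" "\<And>x. indicator (cball c r) x \<le> u x"
    and wg: "weak_gradient u g"
    and fin: "(\<integral>\<^sup>+ x. ennreal ((norm (g x))\<^sup>2) \<partial>lebesgue) < \<infinity>"
    and van: "\<And>\<epsilon>. \<epsilon> > 0 \<Longrightarrow> emeasure lebesgue {x. \<bar>u x\<bar> > \<epsilon>} < \<infinity>"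
    by (auto simp: cap_admissible_def)
  define A where "A = sphere_area TYPE('a)"
  have A: "A > 0" unfolding A_def by (rule sphere_area_pos)
  define d where "d = DIM('a)"
  define k where "k = d - 2"
  have k: "k \<ge> 1" "d - 1 = k + 1" "d = k + 2" "real d - 2 = real k" using d3 by (auto simp: k_def d_def)
  define E where "E = (LINT x|lebesgue. (norm (g x))\<^sup>2)"
  have EE: "(\<integral>\<^sup>+ x. ennreal ((norm (g x))\<^sup>2) \<partial>lebesgue) = ennreal E"
    unfolding E_def by (intro nn_integral_eq_integral integrable_norm_g[OF u(1) wg fin]) auto
  have E0: "E \<ge> 0" by (simp add: E_def)
  define T where "T x = min (u x) 1" for x
  have cT: "continuous_on UNIV T" unfolding T_def by (intro continuous_intros u(1))
  have T_lip: "\<bar>T x - T y\<bar> \<le> \<bar>u x - u y\<bar>" for x y by (auto simp: T_def)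
  have u0: "u x \<ge> 0" for x by (rule order_trans[OF indicator_pos_le u(2)])
  have T0: "0 \<le> T x" "T x \<le> 1" for x using u0 by (auto simp: T_def)
  have T1: "T x = 1" if "norm (x - c) \<le> r" for x
    using that u(2)[of x] by (simp add: T_def dist_norm norm_minus_commute)
  have main: "A * real k * r0 ^ k \<le> E" if r0: "0 < r0" "r0 < r" for r0
  proof -
    have "r0\<^sup>2 < r\<^sup>2" using r0 by (intro power_strict_mono) auto
    then obtain \<eta>1 w1 :: "real \<Rightarrow> real" where \<eta>1:
      "\<And>t. (\<eta>1 has_real_derivative - w1 t) (at t)" "continuous_on UNIV w1" "\<And>t. w1 t \<ge> 0"
      "\<And>t. t \<notin> {r0\<^sup>2<..<r\<^sup>2} \<Longrightarrow> w1 t = 0" "(LINT t|lborel. w1 t) = 1"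
      "\<And>t. t \<le> r0\<^sup>2 \<Longrightarrow> \<eta>1 t = 1" "\<And>t. t \<ge> r\<^sup>2 \<Longrightarrow> \<eta>1 t = 0" "\<And>t. 0 \<le> \<eta>1 t" "\<And>t. \<eta>1 t \<le> 1"
      by (rule smooth_step) blast
    have "(1::real) < 4" by simp
    then obtain \<eta>2 w2 :: "real \<Rightarrow> real" where \<eta>2:
      "\<And>t. (\<eta>2 has_real_derivative - w2 t) (at t)" "continuous_on UNIV w2" "\<And>t. w2 t \<ge> 0"
      "\<And>t. t \<notin> {1<..<4} \<Longrightarrow> w2 t = 0" "(LINT t|lborel. w2 t) = 1"
      "\<And>t. t \<le> 1 \<Longrightarrow> \<eta>2 t = 1" "\<And>t. t \<ge> 4 \<Longrightarrow> \<eta>2 t = 0" "\<And>t. 0 \<le> \<eta>2 t" "\<And>t. \<eta>2 t \<le> 1"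
      by (rule smooth_step) blast
    have "{t. w2 t \<noteq> 0} \<subseteq> {1..4}" 
    proof safe
      fix t assume "w2 t \<noteq> 0"
      then have "t \<in> {1<..<4}" using \<eta>2(4) by blast
      then show "t \<in> {1..4}" by auto
    qed
    then have "bounded {t. w2 t \<noteq> 0}" by (rule bounded_subset[OF bounded_closed_interval])
    then obtain B where B: "B > 0" "\<And>t. \<bar>w2 t\<bar> \<le> B"
      by (rule bounded_continuous_bounded_support[OF \<eta>2(2)]) blast
    have [measurable]: "w1 \<in> borel_measurable borel" "w2 \<in> borel_measurable borel" "T \<in> borel_measurable borel"
      using \<eta>1(2) \<eta>2(2) cT by (auto intro: borel_measurable_continuous_onI)
    have [measurable]: "(\<lambda>x::'a. norm (x - c)) \<in> borel_measurable borel"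
      by (intro borel_measurable_continuous_onI continuous_intros)
    \<comment> \<open>The positive part of div X, supported inside the ball. In polar coordinates
      the powers combine to A times 2 t w1(t^2), so its mass is A for every r0.\<close>
    define F1 where "F1 x = 2 * ((norm (x - c))\<^sup>2 / norm (x - c) ^ d) * w1 ((norm (x - c))\<^sup>2)" for x
    have F1_nn: "(\<integral>\<^sup>+x. ennreal (F1 x) \<partial>lborel) = ennreal A"
    proof -
      have "(\<integral>\<^sup>+x. ennreal (F1 x) \<partial>lborel) = (\<integral>\<^sup>+t\<in>{0..}. ennreal (A * t ^ (d - 1)) * ennreal (2 * (t\<^sup>2 / t ^ d) * w1 (t\<^sup>2)) \<partial>lborel)"
        unfolding F1_def A_def d_def
        by (rule nn_integral_radial[where f="\<lambda>t. ennreal (2 * (t\<^sup>2 / t ^ DIM('a)) * w1 (t\<^sup>2))"]) measurable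
      also have "\<dots> = (\<integral>\<^sup>+t. ennreal A * (ennreal (2 * t * w1 (t\<^sup>2)) * indicator {0..} t) \<partial>lborel)"
      proof (rule nn_integral_cong)
        fix t :: real
        show "ennreal (A * t ^ (d - 1)) * ennreal (2 * (t\<^sup>2 / t ^ d) * w1 (t\<^sup>2)) * indicator {0..} t = ennreal A * (ennreal (2 * t * w1 (t\<^sup>2)) * indicator {0..} t)"
        proof (cases "t > 0")
          case True
          have "A * t ^ (d - 1) * (2 * (t\<^sup>2 / t ^ d) * w1 (t\<^sup>2)) = A * (2 * t * w1 (t\<^sup>2))"
            using True unfolding k(2) k(3) by (simp add: power2_eq_square)
          then show ?thesis using True A \<eta>1(3)[of "t\<^sup>2"] by (simp add: ennreal_mult'[symmetric])
        next
          case False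
          then show ?thesis using \<eta>1(4)[of 0] r0 by (cases "t = 0") auto
        qed
      qed
      also have "\<dots> = ennreal A * (\<integral>\<^sup>+t\<in>{0..}. ennreal (2 * t * w1 (t\<^sup>2)) \<partial>lborel)"
        by (rule nn_integral_cmult) measurable
      also have "\<dots> = ennreal A"
        using nn_integral_bump_sq[OF \<eta>1(1,2,3,6,7)] by simp
      finally show ?thesis .
    qed
    have F1_0: "F1 x \<ge> 0" for x using \<eta>1(3) by (simp add: F1_def)
    have F1_m: "F1 \<in> borel_measurable lborel" unfolding F1_def by measurable
    have F1_i: "integrable lborel F1" using F1_nn F1_0 F1_m by (intro integrableI_nonneg) auto
    have F1_I: "(LINT x|lborel. F1 x) = A"
      using integral_eq_nn_integral[OF F1_m] F1_0 F1_nn A by simp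
    \<comment> \<open>The Cauchy-Schwarz bound, with A / (k r0^k) being A times the integral of t^(1
      - d) over \<open>{r0..}\<close>.\<close>
    define S where "S = sqrt E * sqrt (A / (real k * r0 ^ k))"
    define \<omega> where "\<omega> = unit_ball_vol (real DIM('a))"
    define mm where "mm \<delta> = measure lborel {x. \<bar>u x\<bar> > \<delta>}" for \<delta>
    have step: "A - 2 * B * (\<delta> * \<omega> * 2 ^ d) - 2 * B * mm \<delta> / R ^ d \<le> S" if R: "r \<le> R" and \<delta>: "\<delta> > 0" for R \<delta>
    proof -
      have R0: "R > 0" using R r by linarith
      obtain X :: "'a \<Rightarrow> 'a" where X: "C1c X"
        "\<And>x. divergence X x = 2 * ((norm (x - c))\<^sup>2 / norm (x - c) ^ DIM('a)) * (w1 ((norm (x - c))\<^sup>2) - w2 ((norm (x - c))\<^sup>2 / R\<^sup>2) / R\<^sup>2)"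
        "\<And>x. norm (X x) \<le> (if r0 \<le> norm (x - c) then norm (x - c) / norm (x - c) ^ DIM('a) else 0)"
        by (rule ex_flux_field[OF \<eta>1(1,2,4,6,7,8,9) \<eta>2(1,2,4,6,7,8,9) r0 R, where c=c]) blast+
      have C1X: "C1 X" using X(1) by (simp add: C1c_iff)
      have cX: "continuous_on UNIV X" by (rule C1_continuous[OF C1X])
      have cdiv: "continuous_on UNIV (divergence X)" by (rule continuous_divergence[OF C1X])
      have iTdiv: "integrable lborel (\<lambda>x. T x * divergence X x)"
        using bounded_support_divergence[OF X(1)]
        by (intro integrable_continuous_bounded_support continuous_intros cT cdiv) (auto intro: bounded_subset)
      have iX: "integrable lborel (\<lambda>x. (norm (X x))\<^sup>2)"
        using X(1) by (intro integrable_continuous_bounded_support continuous_intros cX) (simp add: C1c_iff)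
      have normX: "(LINT x|lborel. (norm (X x))\<^sup>2) \<le> A / (real k * r0 ^ k)"
      proof -
        have "ennreal (LINT x|lborel. (norm (X x))\<^sup>2) = (\<integral>\<^sup>+x. ennreal ((norm (X x))\<^sup>2) \<partial>lborel)"
          by (rule nn_integral_eq_integral[OF iX, symmetric]) auto
        also have "\<dots> \<le> (\<integral>\<^sup>+x. ennreal ((norm (x - c) / norm (x - c) ^ d)\<^sup>2) * indicator {r0..} (norm (x - c)) \<partial>lborel)"
        proof (rule nn_integral_mono)
          fix x
          show "ennreal ((norm (X x))\<^sup>2) \<le> ennreal ((norm (x - c) / norm (x - c) ^ d)\<^sup>2) * indicator {r0..} (norm (x - c))"
          proof (cases "r0 \<le> norm (x - c)")
            case True
            then have "norm (X x) \<le> norm (x - c) / norm (x - c) ^ d" using X(3)[of x] by (simp add: d_def)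
            then have "(norm (X x))\<^sup>2 \<le> (norm (x - c) / norm (x - c) ^ d)\<^sup>2" by (intro power_mono) auto
            then show ?thesis using True by (simp add: ennreal_leI)
          next
            case False
            then have "norm (X x) \<le> 0" using X(3)[of x] by simp
            then show ?thesis by simp
          qed
        qed
        also have "\<dots> = (\<integral>\<^sup>+t\<in>{0..}. ennreal (A * t ^ (d - 1)) * (ennreal ((t / t ^ d)\<^sup>2) * indicator {r0..} t) \<partial>lborel)"
          unfolding A_def d_def
          by (rule nn_integral_radial[where f="\<lambda>t. ennreal ((t / t ^ DIM('a))\<^sup>2) * indicator {r0..} t"]) measurable
        also have "\<dots> = (\<integral>\<^sup>+t\<in>{r0..}. ennreal (1 / ((1 / A) * t ^ (k + 1))) \<partial>lborel)"
        proof (rule nn_integral_cong)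
          fix t :: real
          show "ennreal (A * t ^ (d - 1)) * (ennreal ((t / t ^ d)\<^sup>2) * indicator {r0..} t) * indicator {0..} t = ennreal (1 / ((1 / A) * t ^ (k + 1))) * indicator {r0..} t"
          proof (cases "t \<ge> r0")
            case True
            then have t: "t > 0" using r0 by linarith
            have "A * t ^ (d - 1) * (t / t ^ d)\<^sup>2 = 1 / ((1 / A) * t ^ (k + 1))"
              using t A unfolding k(2) k(3) by (simp add: power2_eq_square field_simps)
            then show ?thesis using True t A by (simp add: ennreal_mult'[symmetric])
          qed simp
        qed
        also have "\<dots> = ennreal (1 / ((1 / A) * k * r0 ^ k))"
          using A by (intro nn_integral_inverse_power r0 k(1)) simp
        finally show ?thesis using A r0 by (subst (asm) ennreal_le_iff) auto
      qed
      have upper: "(LINT x|lborel. T x * divergence X x) \<le> S"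
      proof -
        have "(LINT x|lborel. T x * divergence X x) \<le> sqrt E * sqrt (LINT x|lborel. (norm (X x))\<^sup>2)"
          unfolding E_def by (rule integral_contraction_divergence_le[OF u(1) wg fin X(1) cT T_lip])
        also have "\<dots> \<le> S" unfolding S_def using normX E0 by (intro mult_left_mono) auto
        finally show ?thesis .
      qed
      \<comment> \<open>The negative part of div X lies in the shell from R to 2 R and is at most 2
        B / R^d; T is at most \<delta> off the set where |u| > \<delta>, and at most 1 on
        it.\<close>
      define F2 where "F2 x = 2 * B / R ^ d * (\<delta> * indicator (cball c (2 * R)) x + indicator {x. \<bar>u x\<bar> > \<delta>} x)" for x
      have Um: "{x. \<bar>u x\<bar> > \<delta>} \<in> sets borel" by (intro borel_open open_Collect_less continuous_intros u(1))
      have Uf: "emeasure lborel {x. \<bar>u x\<bar> > \<delta>} < \<infinity>" using van[OF \<delta>] Um by simp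
      have iU: "integrable lborel (indicator {x. \<bar>u x\<bar> > \<delta>} :: 'a \<Rightarrow> real)"
        using Um Uf by (intro integrable_real_indicator) auto
      have iC: "integrable lborel (indicator (cball c (2 * R)) :: 'a \<Rightarrow> real)"
        using emeasure_bounded_finite[OF bounded_cball[of c "2 * R"]] by (intro integrable_real_indicator) auto
      have iF2: "integrable lborel F2" unfolding F2_def
        by (intro integrable_mult_right Bochner_Integration.integrable_add iU iC)
      \<comment> \<open>The volume of the ball of radius 2 R cancels R^d, so the \<delta> term does
        not depend on R.\<close>
      have IF2: "(LINT x|lborel. F2 x) = 2 * B * (\<delta> * \<omega> * 2 ^ d) + 2 * B * mm \<delta> / R ^ d"
      proof -
        have "(LINT x|lborel. F2 x) = 2 * B / R ^ d * (\<delta> * measure lborel (cball c (2 * R)) + mm \<delta>)"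
          unfolding F2_def using iU iC by (simp add: mm_def)
        also have "measure lborel (cball c (2 * R)) = \<omega> * (2 * R) ^ d"
          using content_cball[of "2 * R" c] R0 by (simp add: \<omega>_def d_def)
        finally show ?thesis using R0 by (simp add: power_mult_distrib field_simps)
      qed
      have "A - (LINT x|lborel. F2 x) = (LINT x|lborel. F1 x - F2 x)"
        using F1_i iF2 F1_I by simp
      also have "\<dots> \<le> (LINT x|lborel. T x * divergence X x)"
      proof (rule integral_mono[OF Bochner_Integration.integrable_diff[OF F1_i iF2] iTdiv])
        fix x
        define n where "n = norm (x - c)"
        have n0: "n \<ge> 0" by (simp add: n_def)
        have TF1: "T x * F1 x = F1 x"
        proof (cases "w1 (n\<^sup>2) = 0")
          case False
          then have "n\<^sup>2 < r\<^sup>2" using \<eta>1(4)[of "n\<^sup>2"] by (metis greaterThanLessThan_iff)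
          then have "n < r" using r by (meson less_imp_le power_less_imp_less_base)
          then show ?thesis using T1[of x] by (simp add: n_def)
        qed (simp add: F1_def n_def)
        have TF2: "T x * (2 * (n\<^sup>2 / n ^ d) * (w2 (n\<^sup>2 / R\<^sup>2) / R\<^sup>2)) \<le> F2 x"
        proof (cases "w2 (n\<^sup>2 / R\<^sup>2) = 0")
          case True
          then show ?thesis using B(1) \<delta> R0 by (simp add: F2_def)
        next
          case False
          then have "1 < n\<^sup>2 / R\<^sup>2" "n\<^sup>2 / R\<^sup>2 < 4" using \<eta>2(4)[of "n\<^sup>2 / R\<^sup>2"] by (metis greaterThanLessThan_iff)+
          then have "R\<^sup>2 < n\<^sup>2" "n\<^sup>2 < (2 * R)\<^sup>2" using R0 by (auto simp: field_simps)
          then have nR: "R < n" "n < 2 * R" using n0 R0 by (meson less_imp_le power_less_imp_less_base, meson less_imp_le mult_nonneg_nonneg power_less_imp_less_base zero_le_numeral)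
          have "n\<^sup>2 / n ^ d / R\<^sup>2 \<le> 1 / R ^ d"
          proof -
            have "n\<^sup>2 / n ^ d = 1 / n ^ k" using nR R0 by (simp add: k(3) power2_eq_square)
            also have "\<dots> \<le> 1 / R ^ k" using nR R0 by (intro divide_left_mono power_mono) auto
            finally have "n\<^sup>2 / n ^ d / R\<^sup>2 \<le> 1 / R ^ k / R\<^sup>2" by (intro divide_right_mono) auto
            then show ?thesis by (simp add: k(3) power2_eq_square mult_ac)
          qed
          then have "(n\<^sup>2 / n ^ d / R\<^sup>2) * w2 (n\<^sup>2 / R\<^sup>2) \<le> 1 / R ^ d * B"
            using B \<eta>2(3)[of "n\<^sup>2 / R\<^sup>2"] abs_le_D1[OF B(2)[of "n\<^sup>2 / R\<^sup>2"]] R0 by (intro mult_mono) auto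
          then have "T x * (2 * ((n\<^sup>2 / n ^ d / R\<^sup>2) * w2 (n\<^sup>2 / R\<^sup>2))) \<le> T x * (2 * (1 / R ^ d * B))"
            using T0[of x] by (intro mult_left_mono) auto
          also have "\<dots> \<le> (\<delta> * indicator (cball c (2 * R)) x + indicator {x. \<bar>u x\<bar> > \<delta>} x) * (2 * (1 / R ^ d * B))"
          proof (intro mult_right_mono)
            have "x \<in> cball c (2 * R)" using nR by (simp add: n_def dist_norm norm_minus_commute)
            then show "T x \<le> \<delta> * indicator (cball c (2 * R)) x + indicator {x. \<bar>u x\<bar> > \<delta>} x"
              using T0(2)[of x] \<delta> u0[of x] by (auto simp: T_def indicator_def)
          qed (use B(1) R0 in auto)
          finally show ?thesis by (simp add: F2_def mult_ac)
        qed
        have "T x * divergence X x = T x * F1 x - T x * (2 * (n\<^sup>2 / n ^ d) * (w2 (n\<^sup>2 / R\<^sup>2) / R\<^sup>2))"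
          unfolding X(2) F1_def n_def d_def by (simp add: algebra_simps)
        then show "F1 x - F2 x \<le> T x * divergence X x" using TF1 TF2 by linarith
      qed
      finally show ?thesis using upper IF2 by linarith
    qed
    \<comment> \<open>For fixed \<delta> the set where |u| > \<delta> has finite measure, so the
      last term of \<open>step\<close> is a constant over R^d and vanishes as R grows.\<close>
    have "A - 2 * B * (\<delta> * \<omega> * 2 ^ d) \<le> S" if "\<delta> > 0" for \<delta>
    proof (rule tendsto_upperbound)
      have "filterlim (\<lambda>R::real. R ^ d) at_top at_top"
        using k(3) by (intro filterlim_pow_at_top filterlim_ident) auto
      then have "((\<lambda>R. 2 * B * mm \<delta> / R ^ d) \<longlongrightarrow> 0) at_top"
        by (intro tendsto_divide_0[OF tendsto_const] filterlim_at_top_imp_at_infinity)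
      from tendsto_diff[OF tendsto_const this]
      show "((\<lambda>R. A - 2 * B * (\<delta> * \<omega> * 2 ^ d) - 2 * B * mm \<delta> / R ^ d) \<longlongrightarrow> A - 2 * B * (\<delta> * \<omega> * 2 ^ d)) at_top"
        by (metis diff_zero)
      show "\<forall>\<^sub>F R in at_top. A - 2 * B * (\<delta> * \<omega> * 2 ^ d) - 2 * B * mm \<delta> / R ^ d \<le> S"
        using eventually_ge_at_top[of r] by eventually_elim (rule step[OF _ that])
    qed auto
    then have \<delta>: "\<forall>\<^sub>F \<delta> in at_right 0. A - 2 * B * (\<delta> * \<omega> * 2 ^ d) \<le> S"
      by (auto simp: eventually_at_right_field intro!: exI[of _ 1])
    have "((\<lambda>\<delta>. A - 2 * B * (\<delta> * \<omega> * 2 ^ d)) \<longlongrightarrow> A - 2 * B * (0 * \<omega> * 2 ^ d)) (at_right 0)"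
      by (intro tendsto_intros)
    from tendsto_upperbound[OF this \<delta>] have "A \<le> S" by simp
    then have "A\<^sup>2 \<le> S\<^sup>2" using A by (intro power_mono) auto
    also have "S\<^sup>2 = E * (A / (real k * r0 ^ k))"
      unfolding S_def power_mult_distrib using E0 A r0 by simp
    finally have "A * A \<le> A * (E / (real k * r0 ^ k))" by (simp add: power2_eq_square mult_ac)
    then have "A \<le> E / (real k * r0 ^ k)" using A by (rule mult_left_le_imp_le)
    moreover have "real k * r0 ^ k > 0" using k(1) r0 by simp
    ultimately show ?thesis by (simp add: pos_le_divide_eq mult_ac)
  qed
  have "((\<lambda>r0. A * real k * r0 ^ k) \<longlongrightarrow> A * real k * r ^ k) (at_left r)"
    by (intro tendsto_intros)
  moreover have "\<forall>\<^sub>F r0 in at_left r. A * real k * r0 ^ k \<le> E"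
    unfolding eventually_at_left_field using r main by (intro exI[of _ 0]) auto
  ultimately have "A * real k * r ^ k \<le> E" by (rule tendsto_upperbound) simp
  then show "ennreal (sphere_area TYPE('a) * (real (DIM('a)) - 2) * r ^ (DIM('a) - 2))
     \<le> (\<integral>\<^sup>+ x. ennreal ((norm (snd (u, g) x))\<^sup>2) \<partial>lebesgue)"
    unfolding snd_conv EE d_def[symmetric] A_def[symmetric] k(4) k_def[symmetric] by (rule ennreal_leI)
qed

section \<open>Parallel sets of balls and the final assembly\<close>

lemma parallel_set_cball:
  fixes c :: "'a::euclidean_space"
  assumes "0 \<le> r" "0 \<le> t"
  shows "parallel_set (cball c r) t = cball c (r + t)"
proof (rule set_eqI)
  fix x
  have "infdist x (cball c r) \<le> t \<longleftrightarrow> dist c x \<le> r + t"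
  proof
    assume *: "infdist x (cball c r) \<le> t"
    obtain y where "y \<in> cball c r" "infdist x (cball c r) = dist x y"
      using infdist_attains_inf[of "cball c r" x] assms by auto
    then show "dist c x \<le> r + t" using * dist_triangle[of c x y] by (simp add: dist_commute)
  next
    assume *: "dist c x \<le> r + t"
    show "infdist x (cball c r) \<le> t"
    proof (cases "dist c x \<le> r")
      case True
      then show ?thesis using assms by (simp add: infdist_zero)
    next
      case False
      define n where "n = norm (x - c)"
      have n: "n > r" "n \<le> r + t" using False * by (auto simp: n_def dist_norm norm_minus_commute)
      \<comment> \<open>The radial projection of x onto the sphere of radius r, at distance n - r
        from x.\<close>
      define y where "y = c + (r / n) *\<^sub>R (x - c)"
      have "dist c y = r" using n assms by (simp add: y_def dist_norm n_def[symmetric])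
      moreover have "dist x y \<le> t"
      proof -
        have "x - y = (1 - r / n) *\<^sub>R (x - c)" by (simp add: y_def algebra_simps)
        then have "dist x y = \<bar>1 - r / n\<bar> * n" by (simp add: dist_norm n_def)
        also have "\<dots> = n - r" using n assms by (simp add: abs_if field_simps)
        finally show ?thesis using n by simp
      qed
      ultimately show ?thesis by (intro infdist_le2[of y]) auto
    qed
  qed
  then show "x \<in> parallel_set (cball c r) t \<longleftrightarrow> x \<in> cball c (r + t)"
    by (simp add: parallel_set_def)
qed

theorem theorem1:
  fixes K :: "'a::euclidean_space set"
  assumes "DIM('a) \<ge> 3"
    and "compact K" and "K \<noteq> {}"
    and "(\<integral>\<^sup>+ t\<in>{0<..}. inverse (perimeter (parallel_set (fill_holes K) t)) \<partial>lborel) < \<infinity>"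
  shows "newton_cap K \<le> inverse (\<integral>\<^sup>+ t\<in>{0<..}. inverse (perimeter (parallel_set (fill_holes K) t)) \<partial>lborel)
    \<and> (\<forall>c r. K = cball c r \<longrightarrow>
         newton_cap K = inverse (\<integral>\<^sup>+ t\<in>{0<..}. inverse (perimeter (parallel_set (fill_holes K) t)) \<partial>lborel))"
proof -
  have le: "newton_cap K \<le> inverse (\<integral>\<^sup>+ t\<in>{0<..}. inverse (perimeter (parallel_set (fill_holes K) t)) \<partial>lborel)"
    using compact_fill_holes[OF assms(2)] assms(3) by (intro newton_cap_le_inverse_integral) auto
  moreover have "inverse (\<integral>\<^sup>+ t\<in>{0<..}. inverse (perimeter (parallel_set (fill_holes K) t)) \<partial>lborel) \<le> newton_cap K"
    if K: "K = cball c r" for c r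
  proof -
    have r: "r \<ge> 0" using assms(3) K by simp
    \<comment> \<open>The complement of a convex set lies entirely in its outside, so a ball has no
      holes.\<close>
    have "fill_holes K = K" unfolding fill_holes_def K outside_convex[OF convex_cball] by simp
    then have I: "(\<integral>\<^sup>+ t\<in>{0<..}. inverse (perimeter (parallel_set (fill_holes K) t)) \<partial>lborel)
        = (\<integral>\<^sup>+ t\<in>{0<..}. inverse (perimeter (cball c (r + t))) \<partial>lborel)"
      using r by (intro nn_integral_cong) (auto simp: K parallel_set_cball indicator_def)
    show ?thesis
    proof (cases "r > 0")
      case True
      show ?thesis unfolding I unfolding K
        by (rule order_trans[OF inverse_integral_cball_le[OF assms(1) r order_refl True] newton_cap_cball_ge[OF assms(1) True]])
    next
      case False
      then have "r = 0" using r by simp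
      \<comment> \<open>For a single point the right-hand side is 0: the bound holds with every
        radius s > 0, and the power d - 2 >= 1 tends to 0 with s.\<close>
      let ?C = "sphere_area TYPE('a) * (real (DIM('a)) - 2)"
      have "inverse (\<integral>\<^sup>+ t\<in>{0<..}. inverse (perimeter (cball c (r + t))) \<partial>lborel) \<le> ennreal (?C * 0 ^ (DIM('a) - 2))"
      proof (rule tendsto_lowerbound)
        show "((\<lambda>s. ennreal (?C * s ^ (DIM('a) - 2))) \<longlongrightarrow> ennreal (?C * 0 ^ (DIM('a) - 2))) (at_right 0)"
          by (intro tendsto_ennrealI tendsto_intros)
        show "\<forall>\<^sub>F s in at_right 0. inverse (\<integral>\<^sup>+ t\<in>{0<..}. inverse (perimeter (cball c (r + t))) \<partial>lborel) \<le> ennreal (?C * s ^ (DIM('a) - 2))"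
          unfolding eventually_at_right_field
          using \<open>r = 0\<close> by (intro exI[of _ 1] conjI allI impI inverse_integral_cball_le[OF assms(1)]) auto
      qed simp
      then show ?thesis unfolding I using assms(1) by (simp add: zero_power)
    qed
  qed
  ultimately show ?thesis by (auto intro: antisym)
qed

end
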